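(* Let $\overline M$ be a $7$-dimensional Riemannian manifold with a $G_2$-structure of type $\mathcal X_1$ such that $d\varphi=k*\varphi$. Let $\iota:M\to\overline M$ be an orientable hypersurface with unit normal vector field $n$, with the induced $SU(3)$-structure determined by $n$ and the constant function $\theta=0$ (resp. $\theta=\pi/2$). Put $(\varepsilon,\varepsilon')=(+,-)$ if $\theta=0$ and $(\varepsilon,\varepsilon')=(-,+)$ if $\theta=\pi/2$. Then $M$ is of type $\mathcal W_1^{\varepsilon}+\mathcal W_1^{\varepsilon'}+\mathcal W_2^{\varepsilon}+\mathcal W_3$. Moreover, the $SU(3)$-structure on $M$ is of the type given on the left if and only if the condition on the right holds: 1. $\mathcal W_1^{\varepsilon}+\mathcal W_1^{\varepsilon'}+\mathcal W_2^{\varepsilon}$: $IB=B$. 2. $\mathcal W_1^{\varepsilon}+\mathcal W_1^{\varepsilon'}+\mathcal W_3$: $(1+I)B=2h\langle\cdot,\cdot\rangle$. 3. $\mathcal W_1^{\varepsilon}+\mathcal W_2^{\varepsilon}+\mathcal W_3$: $\overline M$ is of type $\mathcal P$. 4. $\mathcal W_1^{\varepsilon'}+\mathcal W_2^{\varepsilon}+\mathcal W_3$: $M$ is a minimal variety. 5. $\mathcal W_1^{\varepsilon}+\mathcal W_1^{\varepsilon'}$: $M$ is totally umbilic. 6. $\mathcal W_1^{\varepsilon}+\mathcal W_2^{\varepsilon}$: $IB=B$ and $\overline M$ is of type $\mathcal P$. 7. $\mathcal W_1^{\varepsilon'}+\mathcal W_2^{\varepsilon}$: $IB=B$ and $M$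 is a minimal variety. 8. $\mathcal W_1^{\varepsilon}+\mathcal W_3$: $(1+I)B=2h\langle\cdot,\cdot\rangle$ and $\overline M$ is of type $\mathcal P$. 9. $\mathcal W_1^{\varepsilon'}+\mathcal W_3$: $IB=-B$. 10. $\mathcal W_2^{\varepsilon}+\mathcal W_3$: $M$ is a minimal variety and $\overline M$ is of type $\mathcal P$. 11. $\mathcal W_3$: $IB=-B$ and $\overline M$ is of type $\mathcal P$. 12. $\mathcal W_2^{\varepsilon}$: $IB=B$, $M$ is a minimal variety and $\overline M$ is of type $\mathcal P$. 13. $\mathcal W_1^{\varepsilon'}$: $M$ is totally geodesic. 14. $\mathcal W_1^{\varepsilon}$: $M$ is totally umbilic and $\overline M$ is of type $\mathcal P$. 15. $\{0\}$: $M$ is totally geodesic and $\overline M$ is of type $\mathcal P$.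
   Context: $G_2$-structures: a $G_2$-structure on a Riemannian $7$-manifold $(\overline M,\langle\cdot,\cdot\rangle)$ is given by a global three-form $\varphi$ such that locally there is an orthonormal frame $\{e_0,\dots,e_6\}$ (indices in $\mathbb Z_7$) with $\varphi=\sum_ie_i\wedge e_{i+1}\wedge e_{i+3}$ (vectors are identified with one-forms via the metric). $\langle P(x,y),z\rangle=\varphi(x,y,z)$, and $*\varphi=-\sum_{i}e_{i+2}\wedge e_{i+4}\wedge e_{i+5}\wedge e_{i+6}$ (Hodge dual for the orientation $e_0\wedge\dots\wedge e_6$). $\overline\nabla$ is the Levi-Civita connection and $\overline r(\varphi)(x,y)=\frac14\langle\overline\nabla_x\varphi,y\lrcorner*\varphi\rangle$, where $\langle a,b\rangle=\frac1{p!}\sum a(e_{i_1},\dots)b(e_{i_1},\dots)$ for $p$-forms. Type $\mathcal X_1$ (nearly parallel): $\overline r(\varphi)=\frac k4\langle\cdot,\cdot\rangle$ with $k$ constant (then $d\varphi=k*\varphi$). Type $\mathcal P$ (parallel): $\overline r(\varphi)=0$. Induced structure on $M$: the induced metric, $Ix=P(n,x)$, and $\Psi=\psi_++i\psi_-$ with $\psi_+=\cos\theta\,\iota^*\varphi-\sin\theta\,\iota^*(n\lrcorner*\varphi)$, $\psi_-=\sin\theta\,\iota^*\varphi+\cos\theta\,\iota^*(n\lrcorner*\varphi)$. $B(x,y)=\langle II(x,y),n\rangle=\langle\overline\nabla_xy,n\rangle$ is the second fundamental form, $h=\frac16\mathrm{Tr}\,B$ (so $h=\langle H,n\rangle$,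 $H$ the mean curvature); minimal variety means $h=0$, totally umbilic $B=h\langle\cdot,\cdot\rangle$, totally geodesic $B=0$. For a bilinear form $b$ on $M$, $(Ib)(x,y)=b(Ix,Iy)$; for a one-form $\mu$, $(I\mu)(x)=-\mu(Ix)$. Types of $SU(3)$-structure: $\nabla$ is the Levi-Civita connection of $M$, $\omega(x,y)=\langle x,Iy\rangle$. $\nabla\omega$ lies in $\{\alpha\mid\alpha(x,y,z)=-\alpha(x,z,y)=-\alpha(x,Iy,Iz)\}=\mathcal W_1\oplus\mathcal W_2\oplus\mathcal W_3\oplus\mathcal W_4$ (Gray–Hervella), where $\mathcal W_1$: $\alpha$ totally skew; $\mathcal W_2$: cyclic sum of $\alpha(x,y,z)$ is zero; $\mathcal W_3$: $\alpha(Ix,Iy,z)=\alpha(x,y,z)$ and $\sum_i\alpha(e_i,e_i,z)=0$; $\mathcal W_4$: $\alpha(x,y,z)=\langle x,y\rangle\tau(z)-\langle x,z\rangle\tau(y)-\langle x,Iy\rangle\tau(Iz)+\langle x,Iz\rangle\tau(Iy)$ for some one-form $\tau$. With $r(\alpha)(x,y)=\frac12\langle x\lrcorner\alpha,y\lrcorner\psi_+\rangle$, for $i=1,2$ one has $\mathcal W_i=\mathcal W_i^+\oplus\mathcal W_i^-$, where $\mathcal W_i^+$ (resp. $\mathcal W_i^-$) is the set of $\alpha\in\mathcal W_i$ with $r(\alpha)$ symmetric (resp. skew-symmetric). The $\mathcal W_5$-part of the torsion is the one-form $\eta$ determined by requiring that the metric connection $\nabla+\eta+\xi$, with $\eta_XY=(I\eta)(X)IY$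 and $\xi_XY=-\frac12I(\nabla_XI)Y$, makes $\omega,\psi_+,\psi_-$ parallel; equivalently $(I\eta)(X)=-\frac1{12}\langle\nabla_X\psi_+,\psi_-\rangle$. $M$ is of type $\mathcal U$, a sum of some of $\mathcal W_1^\pm,\mathcal W_2^\pm,\mathcal W_3,\mathcal W_4,\mathcal W_5$, if the components of $\nabla\omega$ in the $\mathcal W$'s not occurring in $\mathcal U$ vanish everywhere and, when $\mathcal W_5$ does not occur, $\eta=0$; type $\{0\}$ means $\nabla\omega=0$ and $\eta=0$. *)

theory Defs
  imports "HOL-Analysis.Analysis" "HOL-Combinatorics.Permutations"
begin

section \<open>Smooth manifolds\<close>

(* Only used on open sets S. *)
fun ck_on :: "nat \<Rightarrow> 'a::euclidean_space set \<Rightarrow> ('a \<Rightarrow> 'b::real_normed_vector) \<Rightarrow> bool" where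
  "ck_on 0 S f \<longleftrightarrow> continuous_on S f"
| "ck_on (Suc k) S f \<longleftrightarrow>
     f differentiable_on S \<and> (\<forall>v. ck_on k S (\<lambda>x. frechet_derivative f (at x) v))"

definition smooth_on :: "'a::euclidean_space set \<Rightarrow> ('a \<Rightarrow> 'b::real_normed_vector) \<Rightarrow> bool" where
  "smooth_on S f \<longleftrightarrow> (\<forall>k. ck_on k S f)"

(* A chart is a pair (domain, coordinate map). *)
type_synonym ('m, 'n) chart = "'m set \<times> ('m \<Rightarrow> real ^ 'n)"

definition chart_inv :: "('m, 'n) chart \<Rightarrow> real ^ 'n \<Rightarrow> 'm" where
  "chart_inv c = inv_into (fst c) (snd c)"

(* An n-manifold is a (Hausdorff, second countable) type 'm together with such an atlas;
   the atlas need not be maximal. *)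
definition smooth_atlas ::
    "('m::{t2_space, second_countable_topology}, 'n::finite) chart set \<Rightarrow> bool" where
  "smooth_atlas A \<longleftrightarrow>
     (\<forall>c\<in>A. open (fst c) \<and> open (snd c ` fst c) \<and>
        homeomorphism (fst c) (snd c ` fst c) (snd c) (chart_inv c)) \<and>
     (\<Union>c\<in>A. fst c) = UNIV \<and>
     (\<forall>c\<in>A. \<forall>d\<in>A. smooth_on (snd c ` (fst c \<inter> fst d)) (snd d \<circ> chart_inv c))"

(* Tangent vectors: one chart "chart_at A p" around each p is singled out, and the tangent
   space at p is identified with real ^ 'n by means of it.  So a vector field is a function
   'm => real ^ 'n, a covariant tensor field assigns to p a multilinear form on real ^ 'n, and
   passing to the components in another chart is done by coord_change. *)
definition chart_at :: "('m, 'n) chart set \<Rightarrow> 'm \<Rightarrow> ('m, 'n) chart" where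
  "chart_at A p = (SOME c. c \<in> A \<and> p \<in> fst c)"

(* Components in d of the vector at p whose components in c are given. *)
definition coord_change ::
    "('m, 'n::finite) chart \<Rightarrow> ('m, 'n) chart \<Rightarrow> 'm \<Rightarrow> real ^ 'n \<Rightarrow> real ^ 'n" where
  "coord_change c d p = frechet_derivative (snd d \<circ> chart_inv c) (at (snd c p))"

(* Local extension of the tangent vector x at p to a vector field (evaluated at q): the field
   with constant components in the chart at p. *)
definition extend ::
    "('m, 'n::finite) chart set \<Rightarrow> 'm \<Rightarrow> real ^ 'n \<Rightarrow> 'm \<Rightarrow> real ^ 'n" where
  "extend A p x q = coord_change (chart_at A p) (chart_at A q) q x"

definition deriv_at ::
    "('m, 'n::finite) chart set \<Rightarrow> 'm \<Rightarrow> ('m \<Rightarrow> 'b::real_normed_vector) \<Rightarrow> real ^ 'n \<Rightarrow> 'b" where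
  "deriv_at A p f v =
     frechet_derivative (f \<circ> chart_inv (chart_at A p)) (at (snd (chart_at A p) p)) v"

definition smooth_map ::
    "('m::topological_space, 'a::finite) chart set \<Rightarrow>
     ('n::topological_space, 'b::finite) chart set \<Rightarrow> ('m \<Rightarrow> 'n) \<Rightarrow> bool" where
  "smooth_map A B f \<longleftrightarrow> continuous_on UNIV f \<and>
     (\<forall>c\<in>A. \<forall>d\<in>B. smooth_on (snd c ` (fst c \<inter> f -` fst d)) (snd d \<circ> f \<circ> chart_inv c))"

definition differential ::
    "('m, 'a::finite) chart set \<Rightarrow> ('n, 'b::finite) chart set \<Rightarrow> ('m \<Rightarrow> 'n) \<Rightarrow>
     'm \<Rightarrow> real ^ 'a \<Rightarrow> real ^ 'b" where
  "differential A B f p =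
     frechet_derivative (snd (chart_at B (f p)) \<circ> f \<circ> chart_inv (chart_at A p))
       (at (snd (chart_at A p) p))"

(* V is a vector field along f, i.e. V q is tangent to the target at f q; smoothness on the
   open set U.  Vector fields on a manifold are the case f = id. *)
definition smooth_along ::
    "('m, 'a::finite) chart set \<Rightarrow> ('n, 'b::finite) chart set \<Rightarrow> ('m \<Rightarrow> 'n) \<Rightarrow> 'm set \<Rightarrow>
     ('m \<Rightarrow> real ^ 'b) \<Rightarrow> bool" where
  "smooth_along A B f U V \<longleftrightarrow>
     (\<forall>c\<in>A. \<forall>d\<in>B. smooth_on (snd c ` (fst c \<inter> U \<inter> f -` fst d))
        ((\<lambda>q. coord_change (chart_at B (f q)) d (f q) (V q)) \<circ> chart_inv c))"

section \<open>Tensors\<close>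

type_synonym 'v form2 = "'v \<Rightarrow> 'v \<Rightarrow> real"
type_synonym 'v form3 = "'v \<Rightarrow> 'v \<Rightarrow> 'v \<Rightarrow> real"
type_synonym 'v form4 = "'v \<Rightarrow> 'v \<Rightarrow> 'v \<Rightarrow> 'v \<Rightarrow> real"

definition trilinear :: "('v::real_vector) form3 \<Rightarrow> bool" where
  "trilinear a \<longleftrightarrow> (\<forall>y z. linear (\<lambda>x. a x y z)) \<and> (\<forall>x z. linear (\<lambda>y. a x y z)) \<and>
     (\<forall>x y. linear (\<lambda>z. a x y z))"

definition alternating3 :: "'v form3 \<Rightarrow> bool" where
  "alternating3 a \<longleftrightarrow> (\<forall>x y z. a x y z = - a y x z \<and> a x y z = - a x z y)"

definition smooth_tensor2 ::
    "('m, 'n::finite) chart set \<Rightarrow> ('m \<Rightarrow> (real ^ 'n) form2) \<Rightarrow> bool" where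
  "smooth_tensor2 A T \<longleftrightarrow>
     (\<forall>c\<in>A. \<forall>x y. smooth_on (snd c ` fst c)
        ((\<lambda>q. T q (coord_change c (chart_at A q) q x) (coord_change c (chart_at A q) q y))
           \<circ> chart_inv c))"

definition smooth_tensor3 ::
    "('m, 'n::finite) chart set \<Rightarrow> ('m \<Rightarrow> (real ^ 'n) form3) \<Rightarrow> bool" where
  "smooth_tensor3 A T \<longleftrightarrow>
     (\<forall>c\<in>A. \<forall>x y z. smooth_on (snd c ` fst c)
        ((\<lambda>q. T q (coord_change c (chart_at A q) q x) (coord_change c (chart_at A q) q y)
                (coord_change c (chart_at A q) q z)) \<circ> chart_inv c))"

(* The exterior derivative, evaluated on commuting extensions of x, y, z, w. *)
definition ext_deriv3 ::
    "('m, 'n::finite) chart set \<Rightarrow> ('m \<Rightarrow> (real ^ 'n) form3) \<Rightarrow> 'm \<Rightarrow> (real ^ 'n) form4" where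
  "ext_deriv3 A T p x y z w =
     (let D = (\<lambda>v a b c. deriv_at A p
                (\<lambda>q. T q (extend A p a q) (extend A p b q) (extend A p c q)) v)
      in D x y z w - D y x z w + D z x y w - D w x y z)"

section \<open>Euclidean linear algebra on a tangent space with inner product G\<close>

definition orthonormal :: "(real ^ 'n) form2 \<Rightarrow> ('n::finite \<Rightarrow> real ^ 'n) \<Rightarrow> bool" where
  "orthonormal G e \<longleftrightarrow> (\<forall>i j. G (e i) (e j) = (if i = j then 1 else 0))"

(* The notions defined below through onb do not depend on the choice. *)
definition onb :: "(real ^ 'n::finite) form2 \<Rightarrow> 'n \<Rightarrow> real ^ 'n" where
  "onb G = (SOME e. orthonormal G e)"

definition trace_form :: "(real ^ 'n::finite) form2 \<Rightarrow> (real ^ 'n) form2 \<Rightarrow> real" where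
  "trace_form G b = (\<Sum>i\<in>UNIV. b (onb G i) (onb G i))"

definition inner_form2 ::
    "(real ^ 'n::finite) form2 \<Rightarrow> (real ^ 'n) form2 \<Rightarrow> (real ^ 'n) form2 \<Rightarrow> real" where
  "inner_form2 G a b =
     1 / fact 2 * (\<Sum>i\<in>UNIV. \<Sum>j\<in>UNIV. a (onb G i) (onb G j) * b (onb G i) (onb G j))"

definition inner_form3 ::
    "(real ^ 'n::finite) form2 \<Rightarrow> (real ^ 'n) form3 \<Rightarrow> (real ^ 'n) form3 \<Rightarrow> real" where
  "inner_form3 G a b =
     1 / fact 3 * (\<Sum>i\<in>UNIV. \<Sum>j\<in>UNIV. \<Sum>k\<in>UNIV.
        a (onb G i) (onb G j) (onb G k) * b (onb G i) (onb G j) (onb G k))"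

(* Wedge product of the vectors in es (as one-forms via G), evaluated on the vectors xs,
   normalised as a determinant. *)
definition wedge :: "'v form2 \<Rightarrow> 'v list \<Rightarrow> 'v list \<Rightarrow> real" where
  "wedge G es xs = (\<Sum>\<pi> | \<pi> permutes {..<length es}.
     of_int (sign \<pi>) * (\<Prod>i<length es. G (es ! i) (xs ! \<pi> i)))"

section \<open>Levi-Civita connection\<close>

definition riemannian_metric ::
    "('m, 'n::finite) chart set \<Rightarrow> ('m \<Rightarrow> (real ^ 'n) form2) \<Rightarrow> bool" where
  "riemannian_metric A g \<longleftrightarrow> smooth_tensor2 A g \<and>
     (\<forall>p. bilinear (g p) \<and> (\<forall>x y. g p x y = g p y x) \<and> (\<forall>x. x \<noteq> 0 \<longrightarrow> g p x x > 0))"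

(* christoffel A g p v x is the Levi-Civita derivative at p, in the direction v, of the field
   with constant components x in the chart at p.  It is determined by being symmetric (the
   connection is torsion-free) and by metric compatibility. *)
definition christoffel ::
    "('m, 'n::finite) chart set \<Rightarrow> ('m \<Rightarrow> (real ^ 'n) form2) \<Rightarrow> 'm \<Rightarrow>
     real ^ 'n \<Rightarrow> real ^ 'n \<Rightarrow> real ^ 'n" where
  "christoffel A g p = (THE \<Gamma>. (\<forall>x y. \<Gamma> x y = \<Gamma> y x) \<and>
     (\<forall>v x y. deriv_at A p (\<lambda>q. g q (extend A p x q) (extend A p y q)) v
        = g p (\<Gamma> v x) y + g p x (\<Gamma> v y)))"

(* nabla2 A g T p v x y is (nabla_v T)(x, y) at p; likewise nabla3 and nabla_endo. *)
definition nabla2 ::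
    "('m, 'n::finite) chart set \<Rightarrow> ('m \<Rightarrow> (real ^ 'n) form2) \<Rightarrow> ('m \<Rightarrow> (real ^ 'n) form2) \<Rightarrow>
     'm \<Rightarrow> real ^ 'n \<Rightarrow> (real ^ 'n) form2" where
  "nabla2 A g T p v x y =
     (let \<Gamma> = christoffel A g p v
      in deriv_at A p (\<lambda>q. T q (extend A p x q) (extend A p y q)) v
         - T p (\<Gamma> x) y - T p x (\<Gamma> y))"

definition nabla3 ::
    "('m, 'n::finite) chart set \<Rightarrow> ('m \<Rightarrow> (real ^ 'n) form2) \<Rightarrow> ('m \<Rightarrow> (real ^ 'n) form3) \<Rightarrow>
     'm \<Rightarrow> real ^ 'n \<Rightarrow> (real ^ 'n) form3" where
  "nabla3 A g T p v x y z =
     (let \<Gamma> = christoffel A g p v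
      in deriv_at A p (\<lambda>q. T q (extend A p x q) (extend A p y q) (extend A p z q)) v
         - T p (\<Gamma> x) y z - T p x (\<Gamma> y) z - T p x y (\<Gamma> z))"

(* Covariant derivative of a field of endomorphisms J: (nabla_v J) x = nabla_v (J x) - J (nabla_v x). *)
definition nabla_endo ::
    "('m, 'n::finite) chart set \<Rightarrow> ('m \<Rightarrow> (real ^ 'n) form2) \<Rightarrow>
     ('m \<Rightarrow> real ^ 'n \<Rightarrow> real ^ 'n) \<Rightarrow> 'm \<Rightarrow> real ^ 'n \<Rightarrow> real ^ 'n \<Rightarrow> real ^ 'n" where
  "nabla_endo A g J p v x =
     (let \<Gamma> = christoffel A g p v
      in deriv_at A p
           (\<lambda>q. coord_change (chart_at A q) (chart_at A p) q (J q (extend A p x q))) v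
         + \<Gamma> (J p x) - J p (\<Gamma> x))"

(* Derivative, in the direction x at p, of the vector field V along f for the Levi-Civita
   connection of the metric g on the target. *)
definition nabla_along ::
    "('m, 'a::finite) chart set \<Rightarrow> ('n, 'b::finite) chart set \<Rightarrow> ('n \<Rightarrow> (real ^ 'b) form2) \<Rightarrow>
     ('m \<Rightarrow> 'n) \<Rightarrow> ('m \<Rightarrow> real ^ 'b) \<Rightarrow> 'm \<Rightarrow> real ^ 'a \<Rightarrow> real ^ 'b" where
  "nabla_along A B g f V p x =
     deriv_at A p (\<lambda>q. coord_change (chart_at B (f q)) (chart_at B (f p)) (f q) (V q)) x
     + christoffel B g (f p) (differential A B f p x) (V p)"

section \<open>G2-structures\<close>

(* The index type 7 of real ^ 7 carries arithmetic modulo 7. *)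
definition adapted_frame ::
    "(real ^ 7) form2 \<Rightarrow> (real ^ 7) form3 \<Rightarrow> (7 \<Rightarrow> real ^ 7) \<Rightarrow> bool" where
  "adapted_frame G f e \<longleftrightarrow> orthonormal G e \<and>
     (\<forall>x y z. f x y z = (\<Sum>i\<in>UNIV. wedge G [e i, e (i + 1), e (i + 3)] [x, y, z]))"

definition g2_structure ::
    "('m::{t2_space, second_countable_topology}, 7) chart set \<Rightarrow> ('m \<Rightarrow> (real ^ 7) form2) \<Rightarrow>
     ('m \<Rightarrow> (real ^ 7) form3) \<Rightarrow> bool" where
  "g2_structure A g \<phi> \<longleftrightarrow> smooth_atlas A \<and> riemannian_metric A g \<and> smooth_tensor3 A \<phi> \<and>
     (\<forall>p. trilinear (\<phi> p) \<and> alternating3 (\<phi> p)) \<and>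
     (\<forall>p. \<exists>U e. open U \<and> p \<in> U \<and> (\<forall>i. smooth_along A A id U (\<lambda>q. e q i)) \<and>
        (\<forall>q\<in>U. adapted_frame (g q) (\<phi> q) (e q)))"

(* Hodge dual of the three-form f for the orientation of an adapted frame (all adapted frames
   give the same result). *)
definition star :: "(real ^ 7) form2 \<Rightarrow> (real ^ 7) form3 \<Rightarrow> (real ^ 7) form4" where
  "star G f x y z w =
     (let e = (SOME e. adapted_frame G f e)
      in - (\<Sum>i\<in>UNIV. wedge G [e (i + 2), e (i + 4), e (i + 5), e (i + 6)] [x, y, z, w]))"

(* The product P. *)
definition cross :: "(real ^ 7) form2 \<Rightarrow> (real ^ 7) form3 \<Rightarrow> real ^ 7 \<Rightarrow> real ^ 7 \<Rightarrow> real ^ 7" where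
  "cross G f x y = (THE v. \<forall>z. G v z = f x y z)"

definition rbar ::
    "('m, 7) chart set \<Rightarrow> ('m \<Rightarrow> (real ^ 7) form2) \<Rightarrow> ('m \<Rightarrow> (real ^ 7) form3) \<Rightarrow>
     'm \<Rightarrow> (real ^ 7) form2" where
  "rbar A g \<phi> p x y = 1 / 4 * inner_form3 (g p) (nabla3 A g \<phi> p x) (star (g p) (\<phi> p) y)"

definition type_X1 ::
    "('m, 7) chart set \<Rightarrow> ('m \<Rightarrow> (real ^ 7) form2) \<Rightarrow> ('m \<Rightarrow> (real ^ 7) form3) \<Rightarrow> bool" where
  "type_X1 A g \<phi> \<longleftrightarrow> (\<exists>k. \<forall>p x y. rbar A g \<phi> p x y = k / 4 * g p x y)"

definition type_P ::
    "('m, 7) chart set \<Rightarrow> ('m \<Rightarrow> (real ^ 7) form2) \<Rightarrow> ('m \<Rightarrow> (real ^ 7) form3) \<Rightarrow> bool" where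
  "type_P A g \<phi> \<longleftrightarrow> (\<forall>p x y. rbar A g \<phi> p x y = 0)"

section \<open>Types of SU(3)-structures\<close>

datatype part = PlusPart | MinusPart
datatype wclass = W1 part | W2 part | W3 | W4 | W5

(* G, J, pp are the inner product, the almost complex structure I and psi_+ on one tangent space. *)

definition gh_space ::
    "('v::real_vector \<Rightarrow> 'v) \<Rightarrow> 'v form3 set" where
  "gh_space J = {\<alpha>. trilinear \<alpha> \<and>
     (\<forall>x y z. \<alpha> x y z = - \<alpha> x z y \<and> \<alpha> x y z = - \<alpha> x (J y) (J z))}"

definition r_form ::
    "(real ^ 'n::finite) form2 \<Rightarrow> (real ^ 'n) form3 \<Rightarrow> (real ^ 'n) form3 \<Rightarrow> (real ^ 'n) form2" where
  "r_form G pp \<alpha> x y = 1 / 2 * inner_form2 G (\<alpha> x) (pp y)"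

fun has_part :: "part \<Rightarrow> 'v form2 \<Rightarrow> bool" where
  "has_part PlusPart b \<longleftrightarrow> (\<forall>x y. b x y = b y x)"
| "has_part MinusPart b \<longleftrightarrow> (\<forall>x y. b x y = - b y x)"

(* The W5-part of the torsion is not a component of nabla omega; see w5_form. *)
fun w_space ::
    "(real ^ 6) form2 \<Rightarrow> (real ^ 6 \<Rightarrow> real ^ 6) \<Rightarrow> (real ^ 6) form3 \<Rightarrow> wclass \<Rightarrow>
     (real ^ 6) form3 set" where
  "w_space G J pp (W1 s) = {\<alpha> \<in> gh_space J.
     (\<forall>x y z. \<alpha> x y z = - \<alpha> y x z \<and> \<alpha> x y z = - \<alpha> x z y) \<and> has_part s (r_form G pp \<alpha>)}"
| "w_space G J pp (W2 s) = {\<alpha> \<in> gh_space J.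
     (\<forall>x y z. \<alpha> x y z + \<alpha> y z x + \<alpha> z x y = 0) \<and> has_part s (r_form G pp \<alpha>)}"
| "w_space G J pp W3 = {\<alpha> \<in> gh_space J.
     (\<forall>x y z. \<alpha> (J x) (J y) z = \<alpha> x y z) \<and>
     (\<forall>z. (\<Sum>i\<in>UNIV. \<alpha> (onb G i) (onb G i) z) = 0)}"
| "w_space G J pp W4 = {\<alpha> \<in> gh_space J.
     \<exists>\<tau>. linear \<tau> \<and> (\<forall>x y z. \<alpha> x y z =
        G x y * \<tau> z - G x z * \<tau> y - G x (J y) * \<tau> (J z) + G x (J z) * \<tau> (J y))}"
| "w_space G J pp W5 = {}"

definition kaehler_form ::
    "('m \<Rightarrow> (real ^ 'n) form2) \<Rightarrow> ('m \<Rightarrow> real ^ 'n \<Rightarrow> real ^ 'n) \<Rightarrow> 'm \<Rightarrow> (real ^ 'n) form2" where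
  "kaehler_form g J p x y = g p x (J p y)"

(* The one-form eta at p: the connection nabla + eta + xi, where
   eta_x y = (I eta)(x) I y = - eta(I x) I y and xi_x y = - 1/2 I (nabla_x I) y,
   makes omega, psi_+ and psi_- parallel.  Here C x is the endomorphism eta_x + xi_x. *)
definition w5_form ::
    "('m, 6) chart set \<Rightarrow> ('m \<Rightarrow> (real ^ 6) form2) \<Rightarrow> ('m \<Rightarrow> real ^ 6 \<Rightarrow> real ^ 6) \<Rightarrow>
     ('m \<Rightarrow> (real ^ 6) form3) \<Rightarrow> ('m \<Rightarrow> (real ^ 6) form3) \<Rightarrow> 'm \<Rightarrow> real ^ 6 \<Rightarrow> real" where
  "w5_form A g J pp pm p = (THE \<eta>. linear \<eta> \<and>
     (let \<omega> = kaehler_form g J;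
          C = (\<lambda>x y. (- \<eta> (J p x)) *\<^sub>R J p y - (1 / 2) *\<^sub>R J p (nabla_endo A g J p x y))
      in (\<forall>x y z. nabla2 A g \<omega> p x y z - \<omega> p (C x y) z - \<omega> p y (C x z) = 0) \<and>
         (\<forall>\<psi>\<in>{pp, pm}. \<forall>x y z w.
            nabla3 A g \<psi> p x y z w
              - \<psi> p (C x y) z w - \<psi> p y (C x z) w - \<psi> p y z (C x w) = 0)))"

(* comp W is the W-component of nabla omega; it is unique since the sum of the six spaces
   is direct. *)
definition su3_type ::
    "('m, 6) chart set \<Rightarrow> ('m \<Rightarrow> (real ^ 6) form2) \<Rightarrow> ('m \<Rightarrow> real ^ 6 \<Rightarrow> real ^ 6) \<Rightarrow>
     ('m \<Rightarrow> (real ^ 6) form3) \<Rightarrow> ('m \<Rightarrow> (real ^ 6) form3) \<Rightarrow> wclass set \<Rightarrow> bool" where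
  "su3_type A g J pp pm \<U> \<longleftrightarrow>
     (let GH = {W1 PlusPart, W1 MinusPart, W2 PlusPart, W2 MinusPart, W3, W4}
      in \<forall>p.
        (\<exists>comp. (\<forall>W\<in>GH. comp W \<in> w_space (g p) (J p) (pp p) W) \<and>
           (\<forall>x y z. nabla2 A g (kaehler_form g J) p x y z = (\<Sum>W\<in>GH. comp W x y z)) \<and>
           (\<forall>W\<in>GH - \<U>. \<forall>x y z. comp W x y z = 0)) \<and>
        (W5 \<notin> \<U> \<longrightarrow> (\<forall>x. w5_form A g J pp pm p x = 0)))"

section \<open>Hypersurfaces of G2-manifolds\<close>

(* iota: M -> Mbar is an immersion of a 6-manifold with atlas A' and n is a (global, smooth)
   unit normal vector field. *)
definition hypersurface_with_normal ::
    "('m::{t2_space, second_countable_topology}, 7) chart set \<Rightarrow> ('m \<Rightarrow> (real ^ 7) form2) \<Rightarrow>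
     ('h::{t2_space, second_countable_topology}, 6) chart set \<Rightarrow> ('h \<Rightarrow> 'm) \<Rightarrow>
     ('h \<Rightarrow> real ^ 7) \<Rightarrow> bool" where
  "hypersurface_with_normal A g A' \<iota> n \<longleftrightarrow> smooth_atlas A' \<and> smooth_map A' A \<iota> \<and>
     (\<forall>p. inj (differential A' A \<iota> p)) \<and> smooth_along A' A \<iota> UNIV n \<and>
     (\<forall>p. g (\<iota> p) (n p) (n p) = 1 \<and> (\<forall>x. g (\<iota> p) (n p) (differential A' A \<iota> p x) = 0))"

definition induced_metric ::
    "('m, 7) chart set \<Rightarrow> ('m \<Rightarrow> (real ^ 7) form2) \<Rightarrow> ('h, 6) chart set \<Rightarrow> ('h \<Rightarrow> 'm) \<Rightarrow>
     'h \<Rightarrow> (real ^ 6) form2" where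
  "induced_metric A g A' \<iota> p x y =
     g (\<iota> p) (differential A' A \<iota> p x) (differential A' A \<iota> p y)"

definition induced_I ::
    "('m, 7) chart set \<Rightarrow> ('m \<Rightarrow> (real ^ 7) form2) \<Rightarrow> ('m \<Rightarrow> (real ^ 7) form3) \<Rightarrow>
     ('h, 6) chart set \<Rightarrow> ('h \<Rightarrow> 'm) \<Rightarrow> ('h \<Rightarrow> real ^ 7) \<Rightarrow> 'h \<Rightarrow> real ^ 6 \<Rightarrow> real ^ 6" where
  "induced_I A g \<phi> A' \<iota> n p x =
     (THE y. differential A' A \<iota> p y
        = cross (g (\<iota> p)) (\<phi> (\<iota> p)) (n p) (differential A' A \<iota> p x))"

definition induced_psi_plus ::
    "('m, 7) chart set \<Rightarrow> ('m \<Rightarrow> (real ^ 7) form2) \<Rightarrow> ('m \<Rightarrow> (real ^ 7) form3) \<Rightarrow>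
     ('h, 6) chart set \<Rightarrow> ('h \<Rightarrow> 'm) \<Rightarrow> ('h \<Rightarrow> real ^ 7) \<Rightarrow> ('h \<Rightarrow> real) \<Rightarrow>
     'h \<Rightarrow> (real ^ 6) form3" where
  "induced_psi_plus A g \<phi> A' \<iota> n \<theta> p x y z =
     (let D = differential A' A \<iota> p
      in cos (\<theta> p) * \<phi> (\<iota> p) (D x) (D y) (D z)
         - sin (\<theta> p) * star (g (\<iota> p)) (\<phi> (\<iota> p)) (n p) (D x) (D y) (D z))"

definition induced_psi_minus ::
    "('m, 7) chart set \<Rightarrow> ('m \<Rightarrow> (real ^ 7) form2) \<Rightarrow> ('m \<Rightarrow> (real ^ 7) form3) \<Rightarrow>
     ('h, 6) chart set \<Rightarrow> ('h \<Rightarrow> 'm) \<Rightarrow> ('h \<Rightarrow> real ^ 7) \<Rightarrow> ('h \<Rightarrow> real) \<Rightarrow>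
     'h \<Rightarrow> (real ^ 6) form3" where
  "induced_psi_minus A g \<phi> A' \<iota> n \<theta> p x y z =
     (let D = differential A' A \<iota> p
      in sin (\<theta> p) * \<phi> (\<iota> p) (D x) (D y) (D z)
         + cos (\<theta> p) * star (g (\<iota> p)) (\<phi> (\<iota> p)) (n p) (D x) (D y) (D z))"

definition induced_type ::
    "('m, 7) chart set \<Rightarrow> ('m \<Rightarrow> (real ^ 7) form2) \<Rightarrow> ('m \<Rightarrow> (real ^ 7) form3) \<Rightarrow>
     ('h, 6) chart set \<Rightarrow> ('h \<Rightarrow> 'm) \<Rightarrow> ('h \<Rightarrow> real ^ 7) \<Rightarrow> ('h \<Rightarrow> real) \<Rightarrow>
     wclass set \<Rightarrow> bool" where
  "induced_type A g \<phi> A' \<iota> n \<theta> \<U> \<longleftrightarrow>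
     su3_type A' (induced_metric A g A' \<iota>) (induced_I A g \<phi> A' \<iota> n)
       (induced_psi_plus A g \<phi> A' \<iota> n \<theta>) (induced_psi_minus A g \<phi> A' \<iota> n \<theta>) \<U>"

(* The ambient derivative in the direction x of a tangential extension of y, paired with n. *)
definition second_fund ::
    "('m, 7) chart set \<Rightarrow> ('m \<Rightarrow> (real ^ 7) form2) \<Rightarrow> ('h, 6) chart set \<Rightarrow> ('h \<Rightarrow> 'm) \<Rightarrow>
     ('h \<Rightarrow> real ^ 7) \<Rightarrow> 'h \<Rightarrow> (real ^ 6) form2" where
  "second_fund A g A' \<iota> n p x y =
     g (\<iota> p)
       (nabla_along A' A g \<iota> (\<lambda>q. differential A' A \<iota> q (extend A' p y q)) p x) (n p)"

definition mean_h ::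
    "('m, 7) chart set \<Rightarrow> ('m \<Rightarrow> (real ^ 7) form2) \<Rightarrow> ('h, 6) chart set \<Rightarrow> ('h \<Rightarrow> 'm) \<Rightarrow>
     ('h \<Rightarrow> real ^ 7) \<Rightarrow> 'h \<Rightarrow> real" where
  "mean_h A g A' \<iota> n p =
     1 / 6 * trace_form (induced_metric A g A' \<iota> p) (second_fund A g A' \<iota> n p)"

definition minimal_variety ::
    "('m, 7) chart set \<Rightarrow> ('m \<Rightarrow> (real ^ 7) form2) \<Rightarrow> ('h, 6) chart set \<Rightarrow> ('h \<Rightarrow> 'm) \<Rightarrow>
     ('h \<Rightarrow> real ^ 7) \<Rightarrow> bool" where
  "minimal_variety A g A' \<iota> n \<longleftrightarrow> (\<forall>p. mean_h A g A' \<iota> n p = 0)"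

definition totally_umbilic ::
    "('m, 7) chart set \<Rightarrow> ('m \<Rightarrow> (real ^ 7) form2) \<Rightarrow> ('h, 6) chart set \<Rightarrow> ('h \<Rightarrow> 'm) \<Rightarrow>
     ('h \<Rightarrow> real ^ 7) \<Rightarrow> bool" where
  "totally_umbilic A g A' \<iota> n \<longleftrightarrow>
     (\<forall>p x y. second_fund A g A' \<iota> n p x y = mean_h A g A' \<iota> n p * induced_metric A g A' \<iota> p x y)"

definition totally_geodesic ::
    "('m, 7) chart set \<Rightarrow> ('m \<Rightarrow> (real ^ 7) form2) \<Rightarrow> ('h, 6) chart set \<Rightarrow> ('h \<Rightarrow> 'm) \<Rightarrow>
     ('h \<Rightarrow> real ^ 7) \<Rightarrow> bool" where
  "totally_geodesic A g A' \<iota> n \<longleftrightarrow> (\<forall>p x y. second_fund A g A' \<iota> n p x y = 0)"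

(* (I b)(x, y) = b (I x, I y) for a field b of bilinear forms. *)
definition act_I :: "('h \<Rightarrow> 'v \<Rightarrow> 'v) \<Rightarrow> ('h \<Rightarrow> 'v form2) \<Rightarrow> 'h \<Rightarrow> 'v form2" where
  "act_I J b p x y = b p (J p x) (J p y)"

end

theory Submission
  imports Defs
begin

text \<open>Nearly parallel means \<open>\<nabla>\<phi> = (k/4) (\<cdot> \<lrcorner> *\<phi>)\<close>: in a local adapted frame \<open>\<nabla>\<phi>\<close> is the action of a skew
  endomorphism on \<open>\<phi>\<close>, and this action has values in \<open>{T \<lrcorner> *\<phi>}\<close>. With the formulas of Gauss and Weingarten, and
  \<open>\<omega>(x, y) = \<phi>(n, y, x)\<close>, \<open>\<rho> = \<iota>\<^sup>*\<phi>\<close>, \<open>\<iota>\<^sup>*(n \<lrcorner> *\<phi>) = - \<rho>(I \<cdot>, \<cdot>, \<cdot>)\<close>, it follows that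
  \<open>(\<nabla>\<^sub>w \<omega>)(x, y) = \<rho>(S w - (k/4) I w, x, y)\<close>, where \<open>S\<close> is the shape operator. Since \<open>E \<mapsto> \<rho>(E \<cdot>, \<cdot>, \<cdot>)\<close> identifies
  the endomorphisms of the tangent space with the Gray-Hervella space, the components of \<open>\<nabla>\<omega>\<close> are \<open>h\<close>, \<open>- (k/4) I\<close>, the trace-free
  \<open>I\<close>-linear part and the \<open>I\<close>-antilinear part of \<open>S\<close>; in particular there is no \<open>W4\<close>-component. The same formulas
  show that \<open>\<nabla> + \<xi>\<close> already makes \<open>\<omega>\<close>, \<open>\<psi>\<^sub>+\<close> and \<open>\<psi>\<^sub>-\<close> parallel, so \<open>\<eta> = 0\<close>. For \<open>\<theta> = \<pi>/2\<close> the roles of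
  the two parts are interchanged because \<open>\<psi>\<^sub>+ = \<rho>(I \<cdot>, \<cdot>, \<cdot>)\<close>.\<close>

section \<open>Inner products on coordinate spaces\<close>

text \<open>Two splittings explain the shape of the result. \<open>so(7)\<close> is
  \<open>g_2\<close>, which annihilates \<open>\<phi>\<close>, plus a copy of the tangent space; so
  an infinitesimal rotation can move \<open>\<phi>\<close> only by some
  \<open>T \<lrcorner> *\<phi>\<close>, and \<open>rbar\<close> is normalised to return
  \<open>T\<close>. The 36-dimensional space of endomorphisms of a tangent space of \<open>M\<close>
  splits into 18 dimensions commuting with \<open>I\<close>, which give W1 and W2, and 18
  anticommuting with it, of which the self-adjoint ones (12) give W3 and the skew-adjoint ones (6)
  give W4. The shape operator is self-adjoint: this excludes W4 and leaves a single sign of W2. The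
  obstacle is that frames, Christoffel symbols, \<open>I\<close> and \<open>\<eta>\<close> are given
  by choice or description, and that tangent vectors at different points are read in unrelated
  charts. Hence the algebra is confined to one tangent space, and analysis enters only through
  Leibniz rules at a point for fields along a map. In particular the regularity of \<open>I\<close>
  has to be recovered from that of the metric and of \<open>\<omega>\<close>.\<close>

lemma bilinear_form_simps:
  assumes "bilinear (b :: _ \<Rightarrow> _ \<Rightarrow> real)"
  shows "b (x + y) z = b x z + b y z" "b z (x + y) = b z x + b z y"
    "b (x - y) z = b x z - b y z" "b z (x - y) = b z x - b z y"
    "b (- x) z = - b x z" "b z (- x) = - b z x"
    "b (r *\<^sub>R x) z = r * b x z" "b z (r *\<^sub>R x) = r * b z x"
    "b 0 z = 0" "b z 0 = 0"
    "b (sum f S) z = (\<Sum>i\<in>S. b (f i) z)" "b z (sum f S) = (\<Sum>i\<in>S. b z (f i))"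
proof -
  have l: "linear (\<lambda>x. b x y)" "linear (b x)" for x y
    using assms by (auto simp: bilinear_def)
  show "b (x + y) z = b x z + b y z" "b z (x + y) = b z x + b z y"
    "b (x - y) z = b x z - b y z" "b z (x - y) = b z x - b z y"
    "b (- x) z = - b x z" "b z (- x) = - b z x"
    "b (r *\<^sub>R x) z = r * b x z" "b z (r *\<^sub>R x) = r * b z x"
    "b 0 z = 0" "b z 0 = 0"
    "b (sum f S) z = (\<Sum>i\<in>S. b (f i) z)" "b z (sum f S) = (\<Sum>i\<in>S. b z (f i))"
    by (simp_all add: linear_add[OF l(1)] linear_add[OF l(2)] linear_diff[OF l(1)]
        linear_diff[OF l(2)] linear_neg[OF l(1)] linear_neg[OF l(2)] linear_scale[OF l(1)]
        linear_scale[OF l(2)] linear_0[OF l(1)] linear_0[OF l(2)] linear_sum[OF l(1)] linear_sum[OF l(2)])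
qed

lemma trilinear_simps:
  assumes "trilinear a"
  shows "a (x + x') y z = a x y z + a x' y z" "a x (y + y') z = a x y z + a x y' z"
    "a x y (z + z') = a x y z + a x y z'"
    "a (x - x') y z = a x y z - a x' y z" "a x (y - y') z = a x y z - a x y' z"
    "a x y (z - z') = a x y z - a x y z'"
    "a (- x) y z = - a x y z" "a x (- y) z = - a x y z" "a x y (- z) = - a x y z"
    "a (r *\<^sub>R x) y z = r * a x y z" "a x (r *\<^sub>R y) z = r * a x y z"
    "a x y (r *\<^sub>R z) = r * a x y z"
    "a 0 y z = 0" "a x 0 z = 0" "a x y 0 = 0"
    "a (sum f S) y z = (\<Sum>i\<in>S. a (f i) y z)" "a x (sum f S) z = (\<Sum>i\<in>S. a x (f i) z)"
    "a x y (sum f S) = (\<Sum>i\<in>S. a x y (f i))"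
proof -
  have l: "linear (\<lambda>x. a x y z)" "linear (\<lambda>y. a x y z)" "linear (\<lambda>z. a x y z)" for x y z
    using assms by (auto simp: trilinear_def)
  have b: "bilinear (\<lambda>x y. a x y z)" "bilinear (\<lambda>y z. a x y z)" for x z
    using l by (auto simp: bilinear_def)
  show "a (x + x') y z = a x y z + a x' y z" "a x (y + y') z = a x y z + a x y' z"
    "a x y (z + z') = a x y z + a x y z'"
    "a (x - x') y z = a x y z - a x' y z" "a x (y - y') z = a x y z - a x y' z"
    "a x y (z - z') = a x y z - a x y z'"
    "a (- x) y z = - a x y z" "a x (- y) z = - a x y z" "a x y (- z) = - a x y z"
    "a (r *\<^sub>R x) y z = r * a x y z" "a x (r *\<^sub>R y) z = r * a x y z"
    "a x y (r *\<^sub>R z) = r * a x y z"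
    "a 0 y z = 0" "a x 0 z = 0" "a x y 0 = 0"
    "a (sum f S) y z = (\<Sum>i\<in>S. a (f i) y z)" "a x (sum f S) z = (\<Sum>i\<in>S. a x (f i) z)"
    "a x y (sum f S) = (\<Sum>i\<in>S. a x y (f i))"
    by (simp_all add: bilinear_form_simps[OF b(1)] bilinear_form_simps[OF b(2)])
qed

locale euclid =
  fixes G :: "(real ^ 'n::finite) form2"
  assumes bil: "bilinear G"
    and sym: "G x y = G y x"
    and pos: "x \<noteq> 0 \<Longrightarrow> G x x > 0"
begin

lemma linear_left: "linear (\<lambda>x. G x y)" and linear_right: "linear (G x)"
  using bil by (auto simp: bilinear_def)

lemma G_simps:
  "G (x + y) z = G x z + G y z" "G x (y + z) = G x y + G x z"
  "G (x - y) z = G x z - G y z" "G x (y - z) = G x y - G x z"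
  "G (- x) z = - G x z" "G x (- z) = - G x z"
  "G (a *\<^sub>R x) z = a * G x z" "G x (a *\<^sub>R z) = a * G x z"
  "G 0 z = 0" "G x 0 = 0"
  using linear_add[OF linear_left] linear_add[OF linear_right]
    linear_diff[OF linear_left] linear_diff[OF linear_right]
    linear_neg[OF linear_left] linear_neg[OF linear_right]
    linear_scale[OF linear_left] linear_scale[OF linear_right]
    linear_0[OF linear_left] linear_0[OF linear_right]
  by auto

lemma G_sum: "G (sum f S) z = (\<Sum>i\<in>S. G (f i) z)" "G x (sum f S) = (\<Sum>i\<in>S. G x (f i))"
  using linear_sum[OF linear_left] linear_sum[OF linear_right] by auto

lemma G_eq_0_iff: "G x x = 0 \<longleftrightarrow> x = 0"
  using pos[of x] by (cases "x = 0") (auto simp: G_simps)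

lemma G_eqI: "(\<And>z. G x z = G y z) \<Longrightarrow> x = y"
  using G_eq_0_iff[of "x - y"] by (simp add: G_simps)

text \<open>Gram-Schmidt: below full dimension some vector lies outside the span of those already
  found, and its orthogonal residue can be normalised.\<close>

lemma ex_orthonormal_list:
  assumes "k \<le> CARD('n)"
  shows "\<exists>f::nat \<Rightarrow> real ^ 'n. \<forall>i<k. \<forall>j<k. G (f i) (f j) = (if i = j then 1 else 0)"
  using assms
proof (induction k)
  case (Suc k)
  then obtain f :: "nat \<Rightarrow> real ^ 'n"
    where f: "\<forall>i<k. \<forall>j<k. G (f i) (f j) = (if i = j then 1 else 0)" by auto
  have "dim (f ` {..<k}) \<le> k"
    using dim_le_card'[of "f ` {..<k}"] card_image_le[of "{..<k}" f] by simp
  then have "span (f ` {..<k}) \<noteq> UNIV"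
    using Suc.prems dim_UNIV[where 'a="real ^ 'n"] dim_span[of "f ` {..<k}"]
    by (metis DIM_cart DIM_real Suc_le_lessD mult.right_neutral not_le)
  then obtain x where x: "x \<notin> span (f ` {..<k})" by auto
  define y where "y = x - (\<Sum>i<k. G x (f i) *\<^sub>R f i)"
  have "y \<noteq> 0"
  proof
    assume "y = 0"
    then have "x = (\<Sum>i<k. G x (f i) *\<^sub>R f i)" by (simp add: y_def)
    also have "\<dots> \<in> span (f ` {..<k})" by (intro span_sum span_scale span_base) auto
    finally show False using x by simp
  qed
  then have gy: "G y y > 0" by (rule pos)
  have yf: "G y (f j) = 0" if "j < k" for j
  proof -
    have "(\<Sum>i<k. G x (f i) * G (f i) (f j)) = (\<Sum>i<k. if i = j then G x (f i) else 0)"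
      using that f by (intro sum.cong) auto
    then show ?thesis using that by (simp add: y_def G_simps G_sum)
  qed
  have yf': "G (f j) y = 0" if "j < k" for j using yf[OF that] by (simp add: sym[of "f j"])
  define c where "c = 1 / sqrt (G y y)"
  have c: "c * (c * G y y) = 1"
    using gy by (simp add: c_def field_simps)
  have "\<forall>i<Suc k. \<forall>j<Suc k. G ((f(k := c *\<^sub>R y)) i) ((f(k := c *\<^sub>R y)) j) = (if i = j then 1 else 0)"
    using f yf yf' c by (auto simp: less_Suc_eq G_simps)
  then show ?case by blast
qed simp

lemma ex_orthonormal: "\<exists>e. orthonormal G e"
proof -
  obtain f :: "nat \<Rightarrow> real ^ 'n"
    where f: "\<forall>i<CARD('n). \<forall>j<CARD('n). G (f i) (f j) = (if i = j then 1 else 0)"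
    using ex_orthonormal_list[of "CARD('n)"] by auto
  obtain h where h: "bij_betw h (UNIV :: 'n set) {..<CARD('n)}"
    using finite_same_card_bij[of "UNIV :: 'n set" "{..<CARD('n)}"] by auto
  have "orthonormal G (f \<circ> h)"
  proof -
    have "h i < CARD('n)" "h i = h j \<longleftrightarrow> i = j" for i j
      using h by (auto simp: bij_betw_def inj_on_def)
    then show ?thesis using f by (simp add: orthonormal_def)
  qed
  then show ?thesis by blast
qed

lemma onb: "orthonormal G (onb G)"
  unfolding onb_def using ex_orthonormal by (rule someI_ex)

context
  fixes e :: "'n \<Rightarrow> real ^ 'n"
  assumes e: "orthonormal G e"
begin

lemma orthonormal_G: "G (e i) (e j) = (if i = j then 1 else 0)"
  using e by (simp add: orthonormal_def)

lemma orthonormal_span: "span (range e) = UNIV"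
proof -
  have inj: "inj e"
    using orthonormal_G by (metis injI zero_neq_one)
  have "independent (range e)"
    unfolding independent_explicit_finite_subsets
  proof (intro allI impI ballI)
    fix S u v
    assume S: "S \<subseteq> range e" "finite S" "(\<Sum>v\<in>S. u v *\<^sub>R v) = 0" and v: "v \<in> S"
    then obtain i where i: "v = e i" by auto
    have "G (e j) v = (if e j = v then 1 else 0)" for j
      using orthonormal_G inj by (auto simp: i inj_eq)
    then have "G w v = (if w = v then 1 else 0)" if "w \<in> S" for w
      using S that by auto
    then have "(\<Sum>w\<in>S. u w * G w v) = (\<Sum>w\<in>S. if w = v then u w else 0)"
      by (intro sum.cong) auto
    then have "u v = (\<Sum>w\<in>S. u w * G w v)"
      using v S(2) by simp
    also have "\<dots> = G (\<Sum>w\<in>S. u w *\<^sub>R w) v" by (simp add: G_simps G_sum)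
    finally show "u v = 0" by (simp add: S(3) G_simps)
  qed
  moreover have "card (range e) = CARD('n)" using inj by (simp add: card_image)
  ultimately show ?thesis
    using card_ge_dim_independent[of "range e" UNIV] by (auto simp: dim_UNIV)
qed

lemma orthonormal_expand: "x = (\<Sum>i\<in>UNIV. G x (e i) *\<^sub>R e i)"
proof -
  define z where "z = x - (\<Sum>i\<in>UNIV. G x (e i) *\<^sub>R e i)"
  have "G z (e j) = 0" for j
    by (simp add: z_def G_simps G_sum orthonormal_G if_distrib cong: if_cong)
  then have "\<forall>w\<in>range e. G z w = 0" by auto
  then have "G z w = 0" for w
    using linear_eq_on_span[OF linear_right[of z], of "\<lambda>_. 0" "range e" w] orthonormal_span
    by (auto simp: linear_zero)
  then show ?thesis using G_eq_0_iff[of z] by (simp add: z_def)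
qed

lemma linear_expand: "linear L \<Longrightarrow> L x = (\<Sum>i\<in>UNIV. G x (e i) *\<^sub>R L (e i))"
  using arg_cong[OF orthonormal_expand, of L x] by (simp add: linear_sum linear_scale)

lemma linear_expand_real: "linear (l :: _ \<Rightarrow> real) \<Longrightarrow> (\<Sum>i\<in>UNIV. G x (e i) * l (e i)) = l x"
  "linear (l :: _ \<Rightarrow> real) \<Longrightarrow> (\<Sum>i\<in>UNIV. l (e i) * G x (e i)) = l x"
  "linear (l :: _ \<Rightarrow> real) \<Longrightarrow> (\<Sum>i\<in>UNIV. G (e i) x * l (e i)) = l x"
  "linear (l :: _ \<Rightarrow> real) \<Longrightarrow> (\<Sum>i\<in>UNIV. l (e i) * G (e i) x) = l x"
proof -
  show *: "(\<Sum>i\<in>UNIV. G x (e i) * l (e i)) = l x" if "linear l" for l :: "_ \<Rightarrow> real"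
    using linear_expand[OF that, of x] by simp
  show "(\<Sum>i\<in>UNIV. l (e i) * G x (e i)) = l x" if "linear l" for l :: "_ \<Rightarrow> real"
    by (subst mult.commute) (rule *[OF that])
  have s: "G (e i) x = G x (e i)" for i by (rule sym)
  show "(\<Sum>i\<in>UNIV. G (e i) x * l (e i)) = l x" if "linear l" for l :: "_ \<Rightarrow> real"
    unfolding s by (rule *[OF that])
  show "(\<Sum>i\<in>UNIV. l (e i) * G (e i) x) = l x" if "linear l" for l :: "_ \<Rightarrow> real"
    unfolding s by (subst mult.commute) (rule *[OF that])
qed

lemma parseval: "(\<Sum>i\<in>UNIV. G x (e i) * G y (e i)) = G x y"
  using linear_expand_real(1)[OF linear_right, of x y] by (simp add: sym[of y x])

lemma bilinear_expand:
  assumes "bilinear b"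
  shows "(\<Sum>i\<in>UNIV. \<Sum>j\<in>UNIV. b (e i) (e j) * (G x (e i) * G y (e j))) = (b x y :: real)"
proof -
  have l: "linear (\<lambda>x. b x y)" "linear (b x)" for x y
    using assms by (auto simp: bilinear_def)
  have "(\<Sum>j\<in>UNIV. b (e i) (e j) * (G x (e i) * G y (e j))) = G x (e i) * b (e i) y" for i
    using linear_expand_real(2)[OF l(2), of "e i" y]
    by (simp add: sum_distrib_left[symmetric] mult.left_commute[of _ "G x (e i)"])
  then show ?thesis by (simp add: linear_expand_real(1)[OF l(1)])
qed

end

lemma riesz: "linear l \<Longrightarrow> \<exists>v. \<forall>z. G v z = l z"
  by (rule exI[of _ "\<Sum>i\<in>UNIV. l (onb G i) *\<^sub>R onb G i"])
    (auto simp: G_simps G_sum linear_expand_real[OF onb])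

text \<open>Used whenever a contraction computed in one chosen frame, such as \<open>onb\<close> or
  an adapted frame, has to be evaluated in another.\<close>

lemma trace_orthonormal:
  assumes "bilinear b" and e: "orthonormal G e" and f: "orthonormal G f"
  shows "(\<Sum>i\<in>UNIV. b (e i) (e i)) = (\<Sum>i\<in>UNIV. b (f i) (f i) :: real)"
proof -
  have l: "linear (\<lambda>x. b x y)" "linear (b x)" for x y
    using assms(1) by (auto simp: bilinear_def)
  have "(\<Sum>i\<in>UNIV. b (f i) (f i)) = (\<Sum>i\<in>UNIV. \<Sum>j\<in>UNIV. G (f i) (e j) * b (e j) (f i))"
    by (intro sum.cong refl) (simp add: linear_expand_real(1)[OF e l(1)])
  also have "\<dots> = (\<Sum>i\<in>UNIV. \<Sum>j\<in>UNIV. \<Sum>k\<in>UNIV. G (f i) (e j) * (G (f i) (e k) * b (e j) (e k)))"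
    by (intro sum.cong refl) (simp add: sum_distrib_left[symmetric] linear_expand_real(1)[OF e l(2)])
  also have "\<dots> = (\<Sum>j\<in>UNIV. \<Sum>k\<in>UNIV. (\<Sum>i\<in>UNIV. G (f i) (e j) * G (f i) (e k)) * b (e j) (e k))"
    by (subst sum.swap, rule sum.cong[OF refl], subst sum.swap)
      (simp add: sum_distrib_right mult.assoc)
  also have "\<dots> = (\<Sum>j\<in>UNIV. \<Sum>k\<in>UNIV. (if j = k then 1 else 0) * b (e j) (e k))"
  proof -
    have "(\<Sum>i\<in>UNIV. G (f i) (e j) * G (f i) (e k)) = G (e j) (e k)" for j k
      unfolding sym[of "f _"] by (rule parseval[OF f])
    then show ?thesis by (simp only: orthonormal_G[OF e])
  qed
  also have "\<dots> = (\<Sum>i\<in>UNIV. b (e i) (e i))"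
    by (simp add: if_distribR[of _ "\<lambda>x. _"] if_distrib[of "\<lambda>x. x * _"] cong: if_cong)
  finally show ?thesis by simp
qed

end

section \<open>The torsion of an SU(3)-structure at a point\<close>

text \<open>The last assumption stands in for a complex volume form in an adapted frame: the squared
  length of the vector dual to \<open>\<rho> x y\<close> is the Hermitian Gram determinant of
  \<open>x\<close> and \<open>y\<close>. Quantifying over \<open>v\<close> lets it be stated before
  that vector has a name.\<close>

locale su3 = euclid G for G :: "(real ^ 6) form2" +
  fixes J :: "real ^ 6 \<Rightarrow> real ^ 6" and \<rho> :: "(real ^ 6) form3"
  assumes J_linear: "linear J"
    and JJ: "J (J x) = - x"
    and GJJ: "G (J x) (J y) = G x y"
    and tri: "trilinear \<rho>"
    and alt: "alternating3 \<rho>"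
    and rho_J12: "\<rho> (J x) y z = \<rho> x (J y) z"
    and norm_contraction: "(\<And>z. G v z = \<rho> x y z) \<Longrightarrow> G v v = G x x * G y y - (G x y)\<^sup>2 - (G (J x) y)\<^sup>2"
begin

section \<open>The cross product dual to the real part of the volume form\<close>

lemmas J_simps = linear_add[OF J_linear] linear_diff[OF J_linear] linear_neg[OF J_linear]
  linear_scale[OF J_linear] linear_0[OF J_linear] linear_sum[OF J_linear] JJ
lemmas rho_simps = trilinear_simps[OF tri]

lemma rho_swap: "\<rho> x y z = - \<rho> y x z" "\<rho> x y z = - \<rho> x z y"
  using alt unfolding alternating3_def by blast+

lemma rho_cycle: "\<rho> x y z = \<rho> y z x"
  using rho_swap(1)[of x y z] rho_swap(2)[of y x z] by simp

lemma rho_J23: "\<rho> x (J y) z = \<rho> x y (J z)"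
  using rho_J12[of y z x] rho_cycle[of x "J y" z] rho_cycle[of x y "J z"] by simp

lemma rho_J: "\<rho> x (J y) z = \<rho> (J x) y z" "\<rho> x y (J z) = \<rho> (J x) y z"
  using rho_J12[of x y z] rho_J23[of x y z] by simp_all

lemma GJ: "G x (J y) = - G (J x) y"
  using GJJ[of x "J y"] by (simp add: JJ G_simps)

lemma GJ_swap: "G (J x) y = - G (J y) x"
  using GJ[of y x] sym[of y "J x"] by simp

lemma GJ_same: "G (J x) x = 0"
  using GJ[of x x] sym[of x "J x"] by simp

text \<open>The complex cross product on C^3, conjugate linear in both arguments by
  \<open>K_J\<close>. Contractions of \<open>\<rho>\<close> with itself are inner products of its
  values.\<close>

definition K :: "real ^ 6 \<Rightarrow> real ^ 6 \<Rightarrow> real ^ 6" where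
  "K x y = (SOME v. \<forall>z. G v z = \<rho> x y z)"

lemma G_K: "G (K x y) z = \<rho> x y z"
proof -
  have "linear (\<rho> x y)" using tri by (simp add: trilinear_def)
  from someI_ex[OF riesz[OF this]] show ?thesis unfolding K_def by blast
qed

lemma K_add: "K (x + x') y = K x y + K x' y" "K x (y + y') = K x y + K x y'"
  by (rule G_eqI, simp add: G_simps G_K rho_simps)+

lemma K_J: "K (J x) y = - J (K x y)" "K x (J y) = - J (K x y)"
proof -
  have *: "G (- J (K x y)) z = \<rho> (J x) y z" for z
    using GJ[of "K x y" z] by (simp add: G_simps G_K rho_J)
  show "K (J x) y = - J (K x y)" "K x (J y) = - J (K x y)"
    by (rule G_eqI, simp add: * G_K rho_J)+
qed

lemma norm_K: "G (K x y) (K x y) = G x x * G y y - (G x y)\<^sup>2 - (G (J x) y)\<^sup>2"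
  by (rule norm_contraction) (rule G_K)

text \<open>Polarising the norm of \<open>K\<close> once in each slot leaves a symmetric combination of two
  products; replacing \<open>a\<close>, \<open>b\<close> by \<open>J a\<close>, \<open>J b\<close> separates them.\<close>

lemma G_K_K:
  "G (K a b) (K c d) = G a c * G b d - G a d * G b c - G (J a) c * G (J b) d + G (J a) d * G (J b) c"
proof -
  let ?Q = "\<lambda>a b c d. G (K a b) (K c d)"
  have p1: "?Q a b c b = G a c * G b b - G a b * G c b - G (J a) b * G (J c) b" for a b c
    using norm_K[of "a + c" b] norm_K[of a b] norm_K[of c b] sym[of a c] sym[of "K a b" "K c b"]
    by (simp add: K_add G_simps J_simps power2_eq_square algebra_simps)
  have p2: "?Q a b c d + ?Q a d c b = 2 * G a c * G b d - G a b * G c d - G a d * G c b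
      - G (J a) b * G (J c) d - G (J a) d * G (J c) b" for a b c d
    using p1[of a "b + d" c] p1[of a b c] p1[of a d c] sym[of b d]
    by (simp add: K_add G_simps J_simps algebra_simps)
  have "?Q (J a) (J b) c d = - ?Q a b c d"
    by (simp add: K_J J_simps G_simps)
  moreover have "?Q (J a) d c (J b) = ?Q a d c b"
    by (simp add: K_J J_simps G_simps GJJ)
  moreover have "G (J c) b = - G (J b) c" "G (J c) (J b) = G b c" "G (J c) d = - G (J d) c"
    using GJ_swap[of c b] GJ_swap[of c d] GJJ[of c b] sym[of b c] by simp_all
  ultimately show ?thesis
    using p2[of a b c d] p2[of "J a" "J b" c d] sym[of d c] sym[of b c]
    by (simp add: J_simps GJ GJJ G_simps algebra_simps)
qed

text \<open>The constant is \<open>6 - 1 - 1\<close>: in the trace of \<open>G_K_K\<close> over six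
  directions, the two squares of the Hermitian product each remove one copy of
  \<open>G u v\<close>.\<close>

lemma contraction: "(\<Sum>i\<in>UNIV. \<Sum>j\<in>UNIV. \<rho> u (onb G i) (onb G j) * \<rho> v (onb G i) (onb G j)) = 4 * G u v"
proof -
  let ?e = "onb G"
  have "(\<Sum>j\<in>UNIV. \<rho> u (?e i) (?e j) * \<rho> v (?e i) (?e j)) = G (K u (?e i)) (K v (?e i))" for i
    using parseval[OF onb, of "K u (?e i)" "K v (?e i)"] by (simp add: G_K)
  also have "\<dots> i = G u v - G u (?e i) * G v (?e i) - G (J u) (?e i) * G (J v) (?e i)" for i
    using sym[of "?e i" v] GJ[of "?e i" v] sym[of "?e i" "J v"]
    by (simp add: G_K_K orthonormal_G[OF onb] GJ_same)
  finally show ?thesis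
    by (simp add: sum_subtractf parseval[OF onb] GJJ)
qed

section \<open>Gray-Hervella forms as endomorphisms\<close>

lemma rho_eqI: "(\<And>y z. \<rho> u y z = \<rho> v y z) \<Longrightarrow> u = v"
  using contraction[of "u - v" "u - v"] G_eq_0_iff[of "u - v"] by (simp add: rho_simps)

text \<open>The factors \<open>1 / 2\<close> and \<open>1 / 2!\<close> cancel the 4 of
  \<open>contraction\<close>. Thus the plus and minus parts of a class are its self-adjoint and
  skew-adjoint endomorphisms.\<close>

lemma r_form_rho: "r_form G \<rho> (\<lambda>x. \<rho> (E x)) x y = G (E x) y"
  by (simp add: r_form_def inner_form2_def contraction)

lemma gh_rep:
  assumes "\<alpha> \<in> gh_space J"
  obtains E where "linear E" "\<And>x y z. \<alpha> x y z = \<rho> (E x) y z"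
proof -
  let ?e = "onb G"
  from assms have tr: "trilinear \<alpha>" and sk: "\<And>x y z. \<alpha> x y z = - \<alpha> x z y"
    and aJ: "\<And>x y z. \<alpha> x y z = - \<alpha> x (J y) (J z)"
    unfolding gh_space_def by blast+
  \<comment> \<open>The adjoint of \<open>u \<mapsto> \<rho> u\<close>, applied to the two-form
    \<open>\<alpha> x\<close>. The four terms of \<open>G_K_K\<close> contribute equally, because
    \<open>\<alpha> x\<close> is skew and changes sign under \<open>J\<close>; this is the origin of
    the \<open>1 / 4\<close>.\<close>
  define E where "E x = (\<Sum>i\<in>UNIV. \<Sum>j\<in>UNIV. (\<alpha> x (?e i) (?e j) / 4) *\<^sub>R K (?e i) (?e j))" for x
  have "linear E"
    by (rule linearI) (simp_all add: E_def trilinear_simps[OF tr] add_divide_distrib scaleR_add_left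
        sum.distrib scaleR_sum_right)
  moreover have "\<alpha> x y z = \<rho> (E x) y z" for x y z
  proof -
    have b: "bilinear (\<alpha> x)"
      using tr by (auto simp: trilinear_def bilinear_def)
    have "\<rho> (E x) y z = (\<Sum>i\<in>UNIV. \<Sum>j\<in>UNIV. \<alpha> x (?e i) (?e j) / 4 * G (K (?e i) (?e j)) (K y z))"
      unfolding E_def rho_simps
      by (intro sum.cong refl) (metis G_K rho_cycle sym)
    also have "\<dots> = (\<Sum>i\<in>UNIV. \<Sum>j\<in>UNIV. \<alpha> x (?e i) (?e j) / 4 *
        (G y (?e i) * G z (?e j) - G z (?e i) * G y (?e j)
          - G (J y) (?e i) * G (J z) (?e j) + G (J z) (?e i) * G (J y) (?e j)))"
      using sym[of y "?e _"] sym[of z "?e _"] GJ_swap[of y "?e _"] GJ_swap[of z "?e _"]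
      by (simp add: G_K_K)
    also have "\<dots> = (\<alpha> x y z - \<alpha> x z y - \<alpha> x (J y) (J z) + \<alpha> x (J z) (J y)) / 4"
    proof -
      have *: "(\<Sum>i\<in>UNIV. \<Sum>j\<in>UNIV. \<alpha> x (?e i) (?e j) / 4 * (G u (?e i) * G v (?e j))) = \<alpha> x u v / 4" for u v
        using bilinear_expand[OF onb b, of u v] by (simp add: sum_divide_distrib[symmetric])
      show ?thesis
        by (simp only: right_diff_distrib distrib_left sum.distrib sum_subtractf *
            add_divide_distrib diff_divide_distrib)
    qed
    also have "\<dots> = \<alpha> x y z"
      using sk[of x y z] aJ[of x y z] aJ[of x z y] by simp
    finally show ?thesis by simp
  qed
  ultimately show ?thesis by (rule that)
qed

lemma gh_space_rho:
  assumes "linear E"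
  shows "(\<lambda>x. \<rho> (E x)) \<in> gh_space J"
proof -
  have "linear (\<lambda>x. \<rho> (E x) y z)" for y z
    using linear_compose[OF assms, of "\<lambda>x. \<rho> x y z"] tri by (simp add: trilinear_def o_def)
  then have "trilinear (\<lambda>x. \<rho> (E x))"
    using tri by (simp add: trilinear_def)
  then show ?thesis
    unfolding gh_space_def mem_Collect_eq
    by (intro conjI allI rho_swap(2)) (simp_all add: rho_J JJ rho_simps)
qed

text \<open>Skewness makes \<open>E\<close> commute with \<open>J\<close>; contracting the skewness
  relation with \<open>\<rho>\<close> then expresses \<open>E\<close> through the traces of
  \<open>E\<close> and of \<open>J E\<close> alone.\<close>

lemma W1_scalar:
  assumes E: "linear E" and skew: "\<And>x y z. \<rho> (E x) y z = - \<rho> (E y) x z"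
  obtains a b where "\<And>x. E x = a *\<^sub>R x + b *\<^sub>R J x"
proof -
  let ?e = "onb G"
  have EJ: "E (J x) = J (E x)" for x
  proof (rule rho_eqI)
    fix y z
    have "\<rho> (E (J x)) y z = - \<rho> (E y) (J x) z" by (rule skew)
    also have "\<dots> = \<rho> (J (E x)) y z" using skew[of x y "J z"] by (simp add: rho_J)
    finally show "\<rho> (E (J x)) y z = \<rho> (J (E x)) y z" .
  qed
  let ?t = "\<Sum>i\<in>UNIV. G (E (?e i)) (?e i)" and ?s = "\<Sum>i\<in>UNIV. G (J (E (?e i))) (?e i)"
  \<comment> \<open>4 comes from \<open>contraction\<close>; 2 more are moved over from the right,
    where \<open>G (E x) w\<close> appears once directly and once through
    \<open>E (J (J x)) = - E x\<close>.\<close>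
  have "6 * G (E x) w = ?t * G x w - ?s * G (J x) w" for x w
  proof -
    have "4 * G (E x) w = (\<Sum>i\<in>UNIV. \<Sum>j\<in>UNIV. \<rho> (E x) (?e i) (?e j) * \<rho> w (?e i) (?e j))"
      by (rule contraction[symmetric])
    also have "\<dots> = - (\<Sum>i\<in>UNIV. G (K (E (?e i)) x) (K w (?e i)))"
    proof -
      have "(\<Sum>j\<in>UNIV. \<rho> (E x) (?e i) (?e j) * \<rho> w (?e i) (?e j)) = - G (K (E (?e i)) x) (K w (?e i))" for i
        using parseval[OF onb, of "K (E (?e i)) x" "K w (?e i)"]
        by (simp add: G_K skew[of x "?e i"] sum_negf)
      then show ?thesis by (simp add: sum_negf)
    qed
    also have "\<dots> = - (\<Sum>i\<in>UNIV. G (E (?e i)) w * G x (?e i) - G (E (?e i)) (?e i) * G x w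
        + G (E (J (?e i))) w * - G (J x) (?e i) + G (J (E (?e i))) (?e i) * G (J x) w)"
      by (simp add: G_K_K EJ)
    also have "\<dots> = - (G (E x) w - ?t * G x w - G (E (J (J x))) w + ?s * G (J x) w)"
    proof -
      have l: "linear (\<lambda>y. G (E y) w)" "linear (\<lambda>y. G (E (J y)) w)"
        using linear_compose[OF E linear_left[of w]]
          linear_compose[OF J_linear linear_compose[OF E linear_left[of w]]] by (simp_all add: o_def)
      show ?thesis
        by (simp add: sum.distrib sum_subtractf sum_negf sum_distrib_right linear_expand_real[OF onb l(1)]
            linear_expand_real[OF onb l(2)])
    qed
    finally show ?thesis by (simp add: JJ linear_neg[OF E] G_simps)
  qed
  then have "E x = (?t / 6) *\<^sub>R x + (- ?s / 6) *\<^sub>R J x" for x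
    by (intro G_eqI) (simp add: G_simps field_simps)
  then show ?thesis by (rule that)
qed

lemma r_form_rep: "\<alpha> = (\<lambda>x. \<rho> (E x)) \<Longrightarrow> r_form G \<rho> \<alpha> x y = G (E x) y"
  by (simp add: r_form_rho)

section \<open>Endomorphisms belonging to W1, W2 and W3\<close>

lemma W1_rep:
  assumes "\<alpha> \<in> w_space G J pp (W1 s)"
  obtains a b where "\<alpha> = (\<lambda>x. \<rho> (a *\<^sub>R x + b *\<^sub>R J x))"
proof -
  have "\<alpha> \<in> gh_space J" and sk: "\<alpha> x y z = - \<alpha> y x z" for x y z
    using assms unfolding w_space.simps by blast+
  then obtain E where E: "linear E" "\<And>x y z. \<alpha> x y z = \<rho> (E x) y z" by (metis gh_rep)
  obtain a b where ab: "\<And>x. E x = a *\<^sub>R x + b *\<^sub>R J x"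
    using W1_scalar[OF E(1)] sk unfolding E(2) by metis
  have "\<alpha> = (\<lambda>x. \<rho> (a *\<^sub>R x + b *\<^sub>R J x))"
    by (intro ext) (simp add: E(2) ab)
  then show ?thesis by (rule that)
qed

lemma sum_cycle: "(\<Sum>k\<in>A. \<Sum>i\<in>A. \<Sum>j\<in>A. f i j k) = (\<Sum>k\<in>A. \<Sum>i\<in>A. \<Sum>j\<in>A. (f k i j :: real))"
proof -
  have "(\<Sum>k\<in>A. \<Sum>i\<in>A. \<Sum>j\<in>A. f i j k) = (\<Sum>i\<in>A. \<Sum>k\<in>A. \<Sum>j\<in>A. f i j k)"
    by (rule sum.swap)
  also have "\<dots> = (\<Sum>i\<in>A. \<Sum>j\<in>A. \<Sum>k\<in>A. f i j k)"
    by (rule sum.cong[OF refl]) (rule sum.swap)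
  finally show ?thesis .
qed

text \<open>Cyclic invariance of the second factor makes the three triple sums equal, and each is 4
  times a trace by \<open>contraction\<close>. Taking \<open>H\<close> to be the identity or
  \<open>J\<close> detects the two traces of \<open>E\<close>.\<close>

lemma cyclic_contraction:
  assumes H: "\<And>x y z. \<rho> (H x) y z = \<rho> (H y) z x"
  shows "(\<Sum>k\<in>UNIV. \<Sum>i\<in>UNIV. \<Sum>j\<in>UNIV.
      (\<rho> (E (onb G k)) (onb G i) (onb G j) + \<rho> (E (onb G i)) (onb G j) (onb G k)
        + \<rho> (E (onb G j)) (onb G k) (onb G i)) * \<rho> (H (onb G k)) (onb G i) (onb G j))
    = 12 * (\<Sum>k\<in>UNIV. G (E (onb G k)) (H (onb G k)))"
proof -
  let ?f = "\<lambda>k i j. \<rho> (E (onb G k)) (onb G i) (onb G j) * \<rho> (H (onb G k)) (onb G i) (onb G j)"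
  have "(\<Sum>k\<in>UNIV. \<Sum>i\<in>UNIV. \<Sum>j\<in>UNIV.
      (\<rho> (E (onb G k)) (onb G i) (onb G j) + \<rho> (E (onb G i)) (onb G j) (onb G k)
        + \<rho> (E (onb G j)) (onb G k) (onb G i)) * \<rho> (H (onb G k)) (onb G i) (onb G j))
    = (\<Sum>k\<in>UNIV. \<Sum>i\<in>UNIV. \<Sum>j\<in>UNIV. ?f k i j + ?f i j k + ?f j k i)"
  proof (intro sum.cong refl)
    fix k i j
    have "\<rho> (H (onb G k)) (onb G i) (onb G j) = \<rho> (H (onb G i)) (onb G j) (onb G k)"
      "\<rho> (H (onb G i)) (onb G j) (onb G k) = \<rho> (H (onb G j)) (onb G k) (onb G i)"
      by (rule H)+
    then show "(\<rho> (E (onb G k)) (onb G i) (onb G j) + \<rho> (E (onb G i)) (onb G j) (onb G k)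
        + \<rho> (E (onb G j)) (onb G k) (onb G i)) * \<rho> (H (onb G k)) (onb G i) (onb G j)
      = ?f k i j + ?f i j k + ?f j k i"
      by (simp only: distrib_right)
  qed
  also have "\<dots> = 3 * (\<Sum>k\<in>UNIV. \<Sum>i\<in>UNIV. \<Sum>j\<in>UNIV. ?f k i j)"
    using sum_cycle[of "\<lambda>k i j. ?f k i j" UNIV] sum_cycle[of "\<lambda>k i j. ?f i j k" UNIV]
    by (simp add: sum.distrib)
  also have "\<dots> = 12 * (\<Sum>k\<in>UNIV. G (E (onb G k)) (H (onb G k)))"
    by (simp add: contraction sum_distrib_left)
  finally show ?thesis .
qed

lemma W2_rep:
  assumes "\<alpha> \<in> w_space G J pp (W2 s)"
  obtains E where "linear E" "\<alpha> = (\<lambda>x. \<rho> (E x))" "\<And>x. E (J x) = J (E x)"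
    "(\<Sum>k\<in>UNIV. G (E (onb G k)) (onb G k)) = 0"
proof -
  have "\<alpha> \<in> gh_space J" and cy: "\<alpha> x y z + \<alpha> y z x + \<alpha> z x y = 0" for x y z
    using assms unfolding w_space.simps by blast+
  then obtain E where E: "linear E" "\<And>x y z. \<alpha> x y z = \<rho> (E x) y z" by (metis gh_rep)
  have cyE: "\<rho> (E x) y z + \<rho> (E y) z x + \<rho> (E z) x y = 0" for x y z
    using cy[of x y z] by (simp add: E(2))
  have "E (J x) = J (E x)" for x
  proof (rule rho_eqI)
    fix y z
    \<comment> \<open>\<open>\<beta>\<close> is the failure of \<open>E\<close> to commute with
      \<open>J\<close>. Adding the cyclic identities at \<open>(J x, J y, z)\<close> and
      \<open>(x, y, z)\<close> shows that a cyclic shift changes its sign, and three shifts give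
      \<open>\<beta> = - \<beta>\<close>.\<close>
    define \<beta> where "\<beta> x y z = \<rho> (E (J x)) (J y) z + \<rho> (E x) y z" for x y z
    have \<beta>: "\<beta> x y z = - \<beta> y z x" for x y z
      using cyE[of "J x" "J y" z] cyE[of x y z] by (simp add: \<beta>_def rho_J JJ rho_simps)
    have "\<beta> x (J y) z = 0"
      using \<beta>[of x "J y" z] \<beta>[of "J y" z x] \<beta>[of z x "J y"] by simp
    then show "\<rho> (E (J x)) y z = \<rho> (J (E x)) y z"
      by (simp add: \<beta>_def rho_J JJ rho_simps)
  qed
  moreover have "(\<Sum>k\<in>UNIV. G (E (onb G k)) (onb G k)) = 0"
    using cyclic_contraction[of "\<lambda>x. x" E, OF rho_cycle] by (simp add: cyE)
  moreover have "\<alpha> = (\<lambda>x. \<rho> (E x))" by (intro ext) (simp add: E(2))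
  ultimately show ?thesis using that E(1) by blast
qed

lemma W3_rep:
  assumes "\<alpha> \<in> w_space G J pp W3"
  obtains E where "linear E" "\<alpha> = (\<lambda>x. \<rho> (E x))" "\<And>x. E (J x) = - J (E x)"
proof -
  have "\<alpha> \<in> gh_space J" and inv: "\<alpha> (J x) (J y) z = \<alpha> x y z" for x y z
    using assms unfolding w_space.simps by blast+
  then obtain E where E: "linear E" "\<And>x y z. \<alpha> x y z = \<rho> (E x) y z" by (metis gh_rep)
  have "E (J x) = - J (E x)" for x
  proof (rule rho_eqI)
    fix y z
    show "\<rho> (E (J x)) y z = \<rho> (- J (E x)) y z"
      using inv[of x "J y" z] by (simp add: E(2) rho_J JJ rho_simps)
  qed
  moreover have "\<alpha> = (\<lambda>x. \<rho> (E x))" by (intro ext) (simp add: E(2))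
  ultimately show ?thesis using that E(1) by blast
qed

lemma sum_sym_skew:
  assumes "linear E" and E: "\<And>x y. G (E x) y = G x (E y)"
    and b: "bilinear b" "\<And>x y. b x y = - b y x"
  shows "(\<Sum>i\<in>UNIV. b (E (onb G i)) (onb G i)) = (0 :: real)"
proof -
  let ?e = "onb G"
  have 1: "(\<Sum>i\<in>UNIV. b (E (?e i)) (?e i)) = (\<Sum>i\<in>UNIV. \<Sum>j\<in>UNIV. G (E (?e i)) (?e j) * b (?e j) (?e i))"
    using b(1) by (intro sum.cong refl linear_expand_real(1)[OF onb, symmetric]) (simp add: bilinear_def)
  also have "\<dots> = (\<Sum>i\<in>UNIV. \<Sum>j\<in>UNIV. G (E (?e j)) (?e i) * b (?e i) (?e j))"
    by (rule sum.swap)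
  also have "\<dots> = - (\<Sum>i\<in>UNIV. \<Sum>j\<in>UNIV. G (E (?e i)) (?e j) * b (?e j) (?e i))"
  proof -
    have "G (E (?e j)) (?e i) * b (?e i) (?e j) = - (G (E (?e i)) (?e j) * b (?e j) (?e i))" for i j
      using E[of "?e j" "?e i"] sym[of "?e j" "E (?e i)"] b(2)[of "?e i" "?e j"] by simp
    then show ?thesis unfolding sum_negf[symmetric] by (intro sum.cong refl)
  qed
  finally show ?thesis unfolding 1 by linarith
qed

text \<open>Rotating \<open>\<psi>\<^sub>+\<close> replaces \<open>E\<close> by \<open>- J E\<close>
  in the bilinear form. If \<open>E\<close> commutes with the skew-adjoint \<open>J\<close>, this
  exchanges self-adjoint and skew-adjoint.\<close>

lemma rotated_part:
  assumes "\<alpha> = (\<lambda>x. \<rho> (E x))" and EJ: "\<And>x. E (J x) = J (E x)"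
  shows "has_part PlusPart (r_form G (\<lambda>x. \<rho> (J x)) \<alpha>) = has_part MinusPart (r_form G \<rho> \<alpha>)"
    "has_part MinusPart (r_form G (\<lambda>x. \<rho> (J x)) \<alpha>) = has_part PlusPart (r_form G \<rho> \<alpha>)"
proof -
  have r: "r_form G (\<lambda>x. \<rho> (J x)) \<alpha> x y = G (E x) (J y)" for x y
    using r_form_rho[of E x "J y"] by (simp add: assms(1) r_form_def)
  have r': "r_form G \<rho> \<alpha> x y = G (E x) y" for x y
    by (rule r_form_rep[OF assms(1)])
  have *: "G (E y) (J x) = - G (E (J y)) x" for x y by (simp add: EJ GJ)
  have "(\<forall>x y. G (E x) (J y) = c * G (E y) (J x)) = (\<forall>x y. G (E x) y = - c * G (E y) x)" for c
  proof (intro iffI allI)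
    fix x y
    assume "\<forall>x y. G (E x) (J y) = c * G (E y) (J x)"
    then have "G (E (J x)) (J y) = c * G (E y) (J (J x))" by blast
    then show "G (E x) y = - c * G (E y) x"
      by (simp add: JJ EJ G_simps GJJ)
  next
    fix x y
    assume "\<forall>x y. G (E x) y = - c * G (E y) x"
    then have "G (E x) (J y) = - c * G (E (J y)) x" by blast
    then show "G (E x) (J y) = c * G (E y) (J x)" by (simp only: * minus_mult_commute)
  qed
  from this[of 1] this[of "- 1"]
  show "has_part PlusPart (r_form G (\<lambda>x. \<rho> (J x)) \<alpha>) = has_part MinusPart (r_form G \<rho> \<alpha>)"
    "has_part MinusPart (r_form G (\<lambda>x. \<rho> (J x)) \<alpha>) = has_part PlusPart (r_form G \<rho> \<alpha>)"
    unfolding has_part.simps r r' by (simp_all only: mult_1 mult_minus1 minus_minus)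
qed

section \<open>Membership in W1, W2 and W3\<close>

lemma linear_scalar: "linear (\<lambda>x. a *\<^sub>R x)" "linear (\<lambda>x. b *\<^sub>R J x)"
proof -
  show "linear (\<lambda>x. a *\<^sub>R x)" by (rule linearI) (simp_all add: algebra_simps)
  show "linear (\<lambda>x. b *\<^sub>R J x)" by (rule linearI) (simp_all add: J_simps(1,4) scaleR_add_right)
qed

lemma W1_mem:
  "(\<lambda>x. \<rho> (a *\<^sub>R x)) \<in> w_space G J \<rho> (W1 PlusPart)"
  "(\<lambda>x. \<rho> (b *\<^sub>R J x)) \<in> w_space G J \<rho> (W1 MinusPart)"
proof -
  have r: "r_form G \<rho> (\<lambda>x. \<rho> (E x)) x y = G (E x) y" for E x y by (rule r_form_rho)
  have "has_part PlusPart (r_form G \<rho> (\<lambda>x. \<rho> (a *\<^sub>R x)))"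
    unfolding has_part.simps r G_simps
  proof (intro allI)
    fix x y show "a * G x y = a * G y x" using sym[of x y] by simp
  qed
  moreover have "has_part MinusPart (r_form G \<rho> (\<lambda>x. \<rho> (b *\<^sub>R J x)))"
    unfolding has_part.simps r G_simps
  proof (intro allI)
    fix x y show "b * G (J x) y = - (b * G (J y) x)" using GJ_swap[of x y] by simp
  qed
  moreover have "\<rho> (a *\<^sub>R x) y z = - \<rho> (a *\<^sub>R y) x z" for x y z
    using rho_swap(1)[of x y z] by (simp add: rho_simps)
  moreover have "\<rho> (b *\<^sub>R J x) y z = - \<rho> (b *\<^sub>R J y) x z" for x y z
    using rho_swap(1)[of "J x" y z] rho_J(1)[of y x z] by (simp add: rho_simps)
  moreover have "\<rho> (a *\<^sub>R x) y z = - \<rho> (a *\<^sub>R x) z y" "\<rho> (b *\<^sub>R J x) y z = - \<rho> (b *\<^sub>R J x) z y" for x y z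
    by (rule rho_swap(2))+
  ultimately show "(\<lambda>x. \<rho> (a *\<^sub>R x)) \<in> w_space G J \<rho> (W1 PlusPart)"
    "(\<lambda>x. \<rho> (b *\<^sub>R J x)) \<in> w_space G J \<rho> (W1 MinusPart)"
    using gh_space_rho[OF linear_scalar(1)] gh_space_rho[OF linear_scalar(2)]
    unfolding w_space.simps by blast+
qed

text \<open>The cyclic sum is totally skew, hence \<open>\<rho> (a x + b J x)\<close>; the traces \<open>a\<close> and \<open>b\<close> vanish.\<close>

lemma W2_mem:
  assumes E: "linear E" and s: "\<And>x y. G (E x) y = G x (E y)" and EJ: "\<And>x. E (J x) = J (E x)"
    and tr0: "(\<Sum>k\<in>UNIV. G (E (onb G k)) (onb G k)) = 0"
  shows "(\<lambda>x. \<rho> (E x)) \<in> w_space G J \<rho> (W2 PlusPart)"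
proof -
  let ?e = "onb G"
  note E_simps = linear_add[OF E] linear_scale[OF E] linear_neg[OF E]
  define \<gamma> where "\<gamma> x y z = \<rho> (E x) y z + \<rho> (E y) z x + \<rho> (E z) x y" for x y z
  have tri\<gamma>: "trilinear \<gamma>"
    unfolding trilinear_def \<gamma>_def
    by (intro conjI allI linearI) (simp_all add: E_simps rho_simps algebra_simps)
  have sk1: "\<gamma> x y z = - \<gamma> y x z" for x y z
    using rho_swap(2)[of "E x" y z] rho_swap(2)[of "E y" z x] rho_swap(2)[of "E z" x y]
    by (simp add: \<gamma>_def)
  have sk2: "\<gamma> x y z = - \<gamma> x z y" for x y z
    using rho_swap(2)[of "E x" y z] rho_swap(2)[of "E y" z x] rho_swap(2)[of "E z" x y]
    by (simp add: \<gamma>_def)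
  have "\<gamma> x y z = - \<gamma> x (J y) (J z)" for x y z
    by (simp add: \<gamma>_def EJ rho_J JJ rho_simps)
  then have "\<gamma> \<in> gh_space J"
    using tri\<gamma> sk2 unfolding gh_space_def by blast
  then obtain F where F: "linear F" "\<And>x y z. \<gamma> x y z = \<rho> (F x) y z" by (metis gh_rep)
  obtain a b where ab: "\<And>x. F x = a *\<^sub>R x + b *\<^sub>R J x"
    using W1_scalar[OF F(1)] sk1 unfolding F(2) by metis
  \<comment> \<open>\<open>J E\<close> is skew-adjoint, so its trace vanishes; this is what will
    force \<open>b = 0\<close>.\<close>
  have GEJ: "G (E x) (J x) = 0" for x
    using s[of x "J x"] sym[of x "J (E x)"] GJ[of "E x" x] by (simp add: EJ)
  \<comment> \<open>\<open>\<gamma>\<close> is paired with the form of \<open>H\<close> in two ways: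
    written through \<open>F\<close> it gives the factor 4, written as a cyclic sum the factor
    12.\<close>
  have 1: "4 * (\<Sum>k\<in>UNIV. G (F (?e k)) (H (?e k))) = 12 * (\<Sum>k\<in>UNIV. G (E (?e k)) (H (?e k)))"
    if "\<And>x y z. \<rho> (H x) y z = \<rho> (H y) z x" for H
    using cyclic_contraction[of H E, OF that]
    by (simp add: \<gamma>_def[symmetric] F(2) contraction sum_distrib_left)
  have "a = 0"
    using 1[of "\<lambda>x. x", OF rho_cycle] tr0
    by (simp add: ab G_simps sum.distrib GJ_same orthonormal_G[OF onb])
  moreover have "\<rho> (J x) y z = \<rho> (J y) z x" for x y z
    using rho_cycle[of x "J y" z] by (simp add: rho_J)
  from 1[of J, OF this] have "b = 0"
    using sym[of "?e _" "J (?e _)"]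
    by (simp add: ab G_simps sum.distrib GJ_same GEJ orthonormal_G[OF onb] GJJ)
  ultimately have cy: "\<rho> (E x) y z + \<rho> (E y) z x + \<rho> (E z) x y = 0" for x y z
    using F(2)[of x y z] by (simp add: \<gamma>_def ab rho_simps)
  have "has_part PlusPart (r_form G \<rho> (\<lambda>x. \<rho> (E x)))"
    unfolding has_part.simps r_form_rho
  proof (intro allI)
    fix x y show "G (E x) y = G (E y) x" using s[of x y] sym[of x "E y"] by simp
  qed
  then show ?thesis
    using gh_space_rho[OF E] cy unfolding w_space.simps by blast
qed

text \<open>The trace condition of W3 pairs the self-adjoint \<open>E\<close> with a skew form,
  which gives zero by \<open>sum_sym_skew\<close>; the invariance condition is antilinearity of
  \<open>E\<close>.\<close>

lemma W3_mem:
  assumes E: "linear E" and s: "\<And>x y. G (E x) y = G x (E y)" and EJ: "\<And>x. E (J x) = - J (E x)"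
  shows "(\<lambda>x. \<rho> (E x)) \<in> w_space G J \<rho> W3"
proof -
  have "bilinear (\<lambda>x y. \<rho> x y z)" for z
    using tri by (simp add: trilinear_def bilinear_def)
  then have "(\<Sum>i\<in>UNIV. \<rho> (E (onb G i)) (onb G i) z) = 0" for z
    using sum_sym_skew[OF E s, of "\<lambda>x y. \<rho> x y z"] rho_swap(1) by blast
  moreover have "\<rho> (E (J x)) (J y) z = \<rho> (E x) y z" for x y z
    by (simp add: EJ rho_J J_simps rho_simps)
  ultimately show ?thesis
    using gh_space_rho[OF E] unfolding w_space.simps by blast
qed

lemma zero_mem_w_space: "W \<noteq> W5 \<Longrightarrow> (\<lambda>x y z. 0) \<in> w_space G J pp W"
proof -
  have "trilinear (\<lambda>x y z. 0 :: real)" by (simp add: trilinear_def linear_zero)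
  then have gh: "(\<lambda>x y z. 0) \<in> gh_space J" by (simp add: gh_space_def)
  have hp: "has_part s (r_form G pp (\<lambda>x y z. 0))" for s
    by (cases s) (simp_all add: r_form_def inner_form2_def)
  assume "W \<noteq> W5"
  then consider s where "W = W1 s" | s where "W = W2 s" | "W = W3" | "W = W4" by (cases W) auto
  then show ?thesis
  proof cases
    case 4
    have "linear (\<lambda>_::real ^ 6. 0 :: real)" by (rule linear_zero)
    then show ?thesis
      unfolding 4 w_space.simps by (intro CollectI conjI gh exI[of _ "\<lambda>_. 0"]) auto
  qed (simp_all add: gh hp)
qed

text \<open>Only the sign condition sees \<open>\<psi>\<^sub>+\<close>, and the endomorphisms of W1
  and W2 commute with \<open>J\<close>, so \<open>rotated_part\<close> applies.\<close>

lemma w_space_rotated: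
  "w_space G J (\<lambda>x. \<rho> (J x)) (W1 PlusPart) = w_space G J \<rho> (W1 MinusPart)"
  "w_space G J (\<lambda>x. \<rho> (J x)) (W1 MinusPart) = w_space G J \<rho> (W1 PlusPart)"
  "w_space G J (\<lambda>x. \<rho> (J x)) (W2 PlusPart) = w_space G J \<rho> (W2 MinusPart)"
  "w_space G J (\<lambda>x. \<rho> (J x)) (W2 MinusPart) = w_space G J \<rho> (W2 PlusPart)"
proof -
  have 1: "\<alpha> \<in> w_space G J pp (W1 s) \<longleftrightarrow>
      \<alpha> \<in> w_space G J pp' (W1 s')" if h: "\<And>\<beta> E. (\<And>x. E (J x) = J (E x)) \<Longrightarrow> \<beta> = (\<lambda>x. \<rho> (E x)) \<Longrightarrow>
        has_part s (r_form G pp \<beta>) = has_part s' (r_form G pp' \<beta>)" for \<alpha> s s' pp pp'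
  proof -
    have *: "has_part s (r_form G pp \<alpha>) = has_part s' (r_form G pp' \<alpha>)"
      if "\<alpha> = (\<lambda>x. \<rho> (a *\<^sub>R x + b *\<^sub>R J x))" for a b
      by (rule h[OF _ that]) (simp add: J_simps)
    show ?thesis
    proof
      assume a: "\<alpha> \<in> w_space G J pp (W1 s)"
      then obtain a b where "\<alpha> = (\<lambda>x. \<rho> (a *\<^sub>R x + b *\<^sub>R J x))" by (rule W1_rep)
      with a * show "\<alpha> \<in> w_space G J pp' (W1 s')" unfolding w_space.simps by blast
    next
      assume a: "\<alpha> \<in> w_space G J pp' (W1 s')"
      then obtain a b where "\<alpha> = (\<lambda>x. \<rho> (a *\<^sub>R x + b *\<^sub>R J x))" by (rule W1_rep)
      with a * show "\<alpha> \<in> w_space G J pp (W1 s)" unfolding w_space.simps by blast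
    qed
  qed
  have 2: "\<alpha> \<in> w_space G J pp (W2 s) \<longleftrightarrow>
      \<alpha> \<in> w_space G J pp' (W2 s')" if h: "\<And>\<beta> E. (\<And>x. E (J x) = J (E x)) \<Longrightarrow> \<beta> = (\<lambda>x. \<rho> (E x)) \<Longrightarrow>
        has_part s (r_form G pp \<beta>) = has_part s' (r_form G pp' \<beta>)" for \<alpha> s s' pp pp'
  proof
    assume a: "\<alpha> \<in> w_space G J pp (W2 s)"
    obtain E where "linear E" and E: "\<alpha> = (\<lambda>x. \<rho> (E x))" "\<And>x. E (J x) = J (E x)"
      and "(\<Sum>k\<in>UNIV. G (E (onb G k)) (onb G k)) = 0" by (rule W2_rep[OF a]) (rule that)
    from a show "\<alpha> \<in> w_space G J pp' (W2 s')"
      unfolding w_space.simps mem_Collect_eq h[OF E(2,1)] .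
  next
    assume a: "\<alpha> \<in> w_space G J pp' (W2 s')"
    obtain E where "linear E" and E: "\<alpha> = (\<lambda>x. \<rho> (E x))" "\<And>x. E (J x) = J (E x)"
      and "(\<Sum>k\<in>UNIV. G (E (onb G k)) (onb G k)) = 0" by (rule W2_rep[OF a]) (rule that)
    from a show "\<alpha> \<in> w_space G J pp (W2 s)"
      unfolding w_space.simps mem_Collect_eq h[OF E(2,1)] .
  qed
  show "w_space G J (\<lambda>x. \<rho> (J x)) (W1 PlusPart) = w_space G J \<rho> (W1 MinusPart)"
  proof (rule set_eqI, rule 1)
    fix \<beta> E
    assume EJ: "\<And>x. E (J x) = J (E x)" and b: "\<beta> = (\<lambda>x. \<rho> (E x))"
    show "has_part PlusPart (r_form G (\<lambda>x. \<rho> (J x)) \<beta>) = has_part MinusPart (r_form G \<rho> \<beta>)"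
      by (rule rotated_part(1)[OF b EJ])
  qed
  show "w_space G J (\<lambda>x. \<rho> (J x)) (W1 MinusPart) = w_space G J \<rho> (W1 PlusPart)"
  proof (rule set_eqI, rule 1)
    fix \<beta> E
    assume EJ: "\<And>x. E (J x) = J (E x)" and b: "\<beta> = (\<lambda>x. \<rho> (E x))"
    show "has_part MinusPart (r_form G (\<lambda>x. \<rho> (J x)) \<beta>) = has_part PlusPart (r_form G \<rho> \<beta>)"
      by (rule rotated_part(2)[OF b EJ])
  qed
  show "w_space G J (\<lambda>x. \<rho> (J x)) (W2 PlusPart) = w_space G J \<rho> (W2 MinusPart)"
  proof (rule set_eqI, rule 2)
    fix \<beta> E
    assume EJ: "\<And>x. E (J x) = J (E x)" and b: "\<beta> = (\<lambda>x. \<rho> (E x))"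
    show "has_part PlusPart (r_form G (\<lambda>x. \<rho> (J x)) \<beta>) = has_part MinusPart (r_form G \<rho> \<beta>)"
      by (rule rotated_part(1)[OF b EJ])
  qed
  show "w_space G J (\<lambda>x. \<rho> (J x)) (W2 MinusPart) = w_space G J \<rho> (W2 PlusPart)"
  proof (rule set_eqI, rule 2)
    fix \<beta> E
    assume EJ: "\<And>x. E (J x) = J (E x)" and b: "\<beta> = (\<lambda>x. \<rho> (E x))"
    show "has_part MinusPart (r_form G (\<lambda>x. \<rho> (J x)) \<beta>) = has_part PlusPart (r_form G \<rho> \<beta>)"
      by (rule rotated_part(2)[OF b EJ])
  qed
qed

text \<open>In terms of endomorphisms \<open>E\<close> with \<open>\<alpha> x y z = \<rho> (E x) y z\<close>, the classes \<open>W1\<close>, \<open>W2\<close>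
  and \<open>W3\<close> are the scalar, trace-free \<open>J\<close>-linear and symmetric \<open>J\<close>-antilinear parts of \<open>E\<close>.\<close>

theorem su3_components:
  assumes S: "linear S" "\<And>x y. G (S x) y = G x (S y)"
    and pp: "pp = \<rho> \<and> \<epsilon> = PlusPart \<and> \<epsilon>' = MinusPart \<or>
      pp = (\<lambda>x. \<rho> (J x)) \<and> \<epsilon> = MinusPart \<and> \<epsilon>' = PlusPart"
    and U: "U \<subseteq> {W1 \<epsilon>, W1 \<epsilon>', W2 \<epsilon>, W3}"
    and t: "t = (\<Sum>i\<in>UNIV. G (S (onb G i)) (onb G i))"
  shows "(\<exists>comp. (\<forall>W\<in>{W1 PlusPart, W1 MinusPart, W2 PlusPart, W2 MinusPart, W3, W4}. comp W \<in> w_space G J pp W) \<and>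
      (\<forall>x y z. \<rho> (S x) y z + c * \<rho> (J x) y z =
        (\<Sum>W\<in>{W1 PlusPart, W1 MinusPart, W2 PlusPart, W2 MinusPart, W3, W4}. comp W x y z)) \<and>
      (\<forall>W\<in>{W1 PlusPart, W1 MinusPart, W2 PlusPart, W2 MinusPart, W3, W4} - U. \<forall>x y z. comp W x y z = 0))
    \<longleftrightarrow> (W1 \<epsilon> \<in> U \<or> t = 0) \<and> (W1 \<epsilon>' \<in> U \<or> c = 0) \<and>
      (W2 \<epsilon> \<in> U \<or> (\<forall>x y. G (S x) y + G (S (J x)) (J y) = t / 3 * G x y)) \<and>
      (W3 \<in> U \<or> (\<forall>x y. G (S (J x)) (J y) = G (S x) y))" (is "?lhs \<longleftrightarrow> ?rhs")
proof -
  let ?e = "onb G" and ?GH = "{W1 PlusPart, W1 MinusPart, W2 PlusPart, W2 MinusPart, W3, W4}"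
  note S_simps = linear_add[OF S(1)] linear_scale[OF S(1)] linear_neg[OF S(1)]
  \<comment> \<open>From here on both values of \<open>\<theta>\<close> are treated at once:
    relative to \<open>\<rho>\<close>, \<open>\<epsilon>\<close> is always the self-adjoint
    sign.\<close>
  have ws: "w_space G J pp (W1 \<epsilon>) = w_space G J \<rho> (W1 PlusPart)"
    "w_space G J pp (W1 \<epsilon>') = w_space G J \<rho> (W1 MinusPart)"
    "w_space G J pp (W2 \<epsilon>) = w_space G J \<rho> (W2 PlusPart)"
    "w_space G J pp W3 = w_space G J \<rho> W3"
    using pp by (elim disjE conjE; simp only: w_space_rotated w_space.simps(3))+
  have dist: "\<epsilon>' \<noteq> \<epsilon>" and GH: "?GH = {W1 \<epsilon>, W1 \<epsilon>', W2 \<epsilon>, W2 \<epsilon>', W3, W4}"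
    using pp by auto
  have memGH: "W1 \<epsilon> \<in> ?GH" "W1 \<epsilon>' \<in> ?GH" "W2 \<epsilon> \<in> ?GH" "W2 \<epsilon>' \<in> ?GH" "W3 \<in> ?GH" "W4 \<in> ?GH"
    unfolding GH by simp_all
  have tr_J: "(\<Sum>i\<in>UNIV. G (S (J (?e i))) (J (?e i))) = t"
  proof -
    have "bilinear (\<lambda>x y. G (S x) y)"
      using linear_compose[OF S(1) linear_left] linear_right by (simp add: bilinear_def o_def)
    moreover have "orthonormal G (\<lambda>i. J (?e i))"
      using onb by (simp add: orthonormal_def GJJ)
    ultimately show ?thesis unfolding t by (rule trace_orthonormal[OF _ _ onb])
  qed
  show ?thesis
  proof
    assume ?lhs
    then obtain comp where c1: "\<And>W. W \<in> ?GH \<Longrightarrow> comp W \<in> w_space G J pp W"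
      and c2: "\<And>x y z. \<rho> (S x) y z + c * \<rho> (J x) y z = (\<Sum>W\<in>?GH. comp W x y z)"
      and c3: "\<And>W x y z. W \<in> ?GH \<Longrightarrow> W \<notin> U \<Longrightarrow> comp W x y z = 0" by blast
    have zero: "comp (W2 \<epsilon>') x y z = 0" "comp W4 x y z = 0" for x y z
    proof -
      have "W2 \<epsilon>' \<notin> U" "W4 \<notin> U" using U dist by auto
      then show "comp (W2 \<epsilon>') x y z = 0" "comp W4 x y z = 0"
        using c3[OF memGH(4)] c3[OF memGH(6)] by simp_all
    qed
    have "comp (W1 \<epsilon>) \<in> w_space G J \<rho> (W1 PlusPart)" "comp (W1 \<epsilon>') \<in> w_space G J \<rho> (W1 MinusPart)"
      "comp (W2 \<epsilon>) \<in> w_space G J \<rho> (W2 PlusPart)" "comp W3 \<in> w_space G J \<rho> W3"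
      using c1[OF memGH(1)] c1[OF memGH(2)] c1[OF memGH(3)] c1[OF memGH(5)] unfolding ws .
    note mem = this
    obtain a b where ab: "comp (W1 \<epsilon>) = (\<lambda>x. \<rho> (a *\<^sub>R x + b *\<^sub>R J x))" by (rule W1_rep[OF mem(1)])
    obtain a' b' where ab': "comp (W1 \<epsilon>') = (\<lambda>x. \<rho> (a' *\<^sub>R x + b' *\<^sub>R J x))" by (rule W1_rep[OF mem(2)])
    obtain E where E: "linear E" "comp (W2 \<epsilon>) = (\<lambda>x. \<rho> (E x))" "\<And>x. E (J x) = J (E x)"
      "(\<Sum>k\<in>UNIV. G (E (?e k)) (?e k)) = 0" by (rule W2_rep[OF mem(3)]) (rule that)
    obtain F where F: "linear F" "comp W3 = (\<lambda>x. \<rho> (F x))" "\<And>x. F (J x) = - J (F x)"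
      by (rule W3_rep[OF mem(4)]) (rule that)
    have ne: "onb G 0 \<noteq> 0" using orthonormal_G[OF onb, of 0 0] by (auto simp: G_simps)
    \<comment> \<open>Symmetry tested on \<open>?e 0\<close> and its image under \<open>J\<close>
      isolates the coefficient of the skew-adjoint \<open>J\<close>.\<close>
    have b0: "b = 0"
    proof -
      let ?x = "?e 0"
      have "G (a *\<^sub>R ?x + b *\<^sub>R J ?x) (J ?x) = G (a *\<^sub>R J ?x + b *\<^sub>R J (J ?x)) ?x"
        using mem(1) unfolding w_space.simps mem_Collect_eq has_part.simps r_form_rep[OF ab] by blast
      then show ?thesis using ne G_eq_0_iff[of ?x] sym[of ?x "J ?x"] by (simp add: G_simps JJ GJJ GJ_same)
    qed
    have a0: "a' = 0"
    proof -
      let ?x = "?e 0"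
      have "G (a' *\<^sub>R ?x + b' *\<^sub>R J ?x) ?x = - G (a' *\<^sub>R ?x + b' *\<^sub>R J ?x) ?x"
        using mem(2) unfolding w_space.simps mem_Collect_eq has_part.simps r_form_rep[OF ab'] by blast
      then show ?thesis using ne G_eq_0_iff[of ?x] by (simp add: G_simps JJ GJJ GJ_same)
    qed
    have Es: "G (E x) y = G (E y) x" for x y
      using mem(3) unfolding w_space.simps mem_Collect_eq has_part.simps r_form_rep[OF E(2)] by blast
    \<comment> \<open>Injectivity of \<open>u \<mapsto> \<rho> u\<close> turns the decomposition of
      forms into one of endomorphisms.\<close>
    have dec: "S x + c *\<^sub>R J x = a *\<^sub>R x + b' *\<^sub>R J x + E x + F x" for x
    proof (rule rho_eqI)
      fix y z
      have "\<rho> (S x) y z + c * \<rho> (J x) y z = comp (W1 \<epsilon>) x y z + comp (W1 \<epsilon>') x y z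
          + comp (W2 \<epsilon>) x y z + comp W3 x y z"
        unfolding c2 GH using dist zero by simp
      then show "\<rho> (S x + c *\<^sub>R J x) y z = \<rho> (a *\<^sub>R x + b' *\<^sub>R J x + E x + F x) y z"
        by (simp add: ab ab' E(2) F(2) b0 a0 rho_simps)
    qed
    \<comment> \<open>The operation \<open>X \<mapsto> X - J X J\<close> doubles the
      \<open>J\<close>-linear terms of \<open>dec\<close> and kills the antilinear
      \<open>F\<close>.\<close>
    have com: "S x - J (S (J x)) + (2 * c) *\<^sub>R J x = (2 * a) *\<^sub>R x + (2 * b') *\<^sub>R J x + 2 *\<^sub>R E x" for x
    proof -
      have "J (S (J x) + c *\<^sub>R J (J x)) = J (a *\<^sub>R J x + b' *\<^sub>R J (J x) + E (J x) + F (J x))"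
        by (simp only: dec)
      then have *: "J (S (J x)) - c *\<^sub>R J x = - (a *\<^sub>R x) - b' *\<^sub>R J x - E x + F x"
        by (simp add: J_simps E(3) F(3))
      show ?thesis
      proof (rule G_eqI)
        fix z
        from arg_cong[OF *, of "\<lambda>v. G v z"] arg_cong[OF dec[of x], of "\<lambda>v. G v z"]
        show "G (S x - J (S (J x)) + (2 * c) *\<^sub>R J x) z
            = G ((2 * a) *\<^sub>R x + (2 * b') *\<^sub>R J x + 2 *\<^sub>R E x) z"
          by (simp add: G_simps algebra_simps)
      qed
    qed
    \<comment> \<open>The trace of \<open>com\<close>: both halves of the left side have trace
      \<open>t\<close> by \<open>tr_J\<close>, the identity has trace 6, and \<open>E\<close> has
      trace 0.\<close>
    have "2 * t = 12 * a"
    proof -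
      have "G (S (?e i)) (?e i) + G (S (J (?e i))) (J (?e i)) = 2 * a + 2 * G (E (?e i)) (?e i)" for i
        using arg_cong[OF com[of "?e i"], of "\<lambda>v. G v (?e i)"] GJ[of "S (J (?e i))" "?e i"]
        by (simp add: G_simps GJ_same orthonormal_G[OF onb])
      then have "(\<Sum>i\<in>UNIV. G (S (?e i)) (?e i) + G (S (J (?e i))) (J (?e i))) = (\<Sum>i\<in>UNIV. 2 * a + 2 * G (E (?e i)) (?e i))"
        by simp
      then show ?thesis
        by (simp add: sum.distrib tr_J t[symmetric] sum_distrib_left[symmetric] E(4))
    qed
    then have a: "a = t / 6" by simp
    \<comment> \<open>Pairing \<open>com\<close> with \<open>J (?e i)\<close> sees only the
      multiples of \<open>J\<close>, since \<open>S\<close> and the \<open>J\<close>-linear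
      \<open>E\<close> are self-adjoint.\<close>
    have "c = b'"
    proof -
      have "G (S (?e i)) (J (?e i)) - G (S (J (?e i))) (?e i) + 2 * c
          = 2 * b' + 2 * G (E (?e i)) (J (?e i))" for i
        using arg_cong[OF com[of "?e i"], of "\<lambda>v. G v (J (?e i))"] sym[of "?e i" "J (?e i)"]
        by (simp add: G_simps GJ_same GJJ orthonormal_G[OF onb])
      moreover have "G (S (J (?e i))) (?e i) = G (S (?e i)) (J (?e i))" for i
        using S(2) sym by metis
      moreover have "G (E (?e i)) (J (?e i)) = 0" for i
        using Es[of "?e i" "J (?e i)"] GJ[of "E (?e i)" "?e i"] by (simp add: E(3))
      ultimately show ?thesis by simp
    qed
    then have com': "S x - J (S (J x)) = (2 * a) *\<^sub>R x + 2 *\<^sub>R E x" for x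
      using com[of x] by simp
    have F': "2 *\<^sub>R F x = S x + J (S (J x))" for x
    proof -
      have "2 *\<^sub>R F x = 2 *\<^sub>R S x - ((2 * a) *\<^sub>R x + 2 *\<^sub>R E x)"
        using arg_cong[OF dec[of x], of "\<lambda>v. 2 *\<^sub>R v"] \<open>c = b'\<close> by (simp add: algebra_simps)
      then show ?thesis unfolding com'[symmetric] by (simp add: scaleR_2)
    qed
    have v0: "v = 0" if "\<And>y z. \<rho> v y z = 0" for v
      by (rule rho_eqI) (simp add: that rho_simps)
    show ?rhs
    proof (intro conjI)
      have "t = 0" if "W1 \<epsilon> \<notin> U"
      proof -
        have "a *\<^sub>R ?e 0 = 0"
          using c3[OF memGH(1) that, of "?e 0"] by (intro v0) (simp add: ab b0)
        then show "t = 0" using ne a by simp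
      qed
      then show "W1 \<epsilon> \<in> U \<or> t = 0" by blast
      have "c = 0" if "W1 \<epsilon>' \<notin> U"
      proof -
        have "b' *\<^sub>R J (?e 0) = 0"
          using c3[OF memGH(2) that, of "?e 0"] by (intro v0) (simp add: ab' a0)
        then have "b' *\<^sub>R J (J (?e 0)) = 0" by (metis J_simps(4,5))
        then show "c = 0" using ne \<open>c = b'\<close> by (simp add: JJ)
      qed
      then show "W1 \<epsilon>' \<in> U \<or> c = 0" by blast
      have "G (S x) y + G (S (J x)) (J y) = t / 3 * G x y" if "W2 \<epsilon> \<notin> U" for x y
      proof -
        have "E x = 0"
          using c3[OF memGH(3) that, of x] by (intro v0) (simp add: E(2))
        then show ?thesis
          using arg_cong[OF com'[of x], of "\<lambda>v. G v y"] GJ[of "S (J x)" y] by (simp add: a G_simps)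
      qed
      then show "W2 \<epsilon> \<in> U \<or> (\<forall>x y. G (S x) y + G (S (J x)) (J y) = t / 3 * G x y)" by blast
      have "G (S (J x)) (J y) = G (S x) y" if "W3 \<notin> U" for x y
      proof -
        have "F x = 0"
          using c3[OF memGH(5) that, of x] by (intro v0) (simp add: F(2))
        then show ?thesis
          using arg_cong[OF F'[of x], of "\<lambda>v. G v y"] GJ[of "S (J x)" y] by (simp add: G_simps)
      qed
      then show "W3 \<in> U \<or> (\<forall>x y. G (S (J x)) (J y) = G (S x) y)" by blast
    qed
  next
    assume r: ?rhs
    \<comment> \<open>The \<open>J\<close>-linear part of \<open>S\<close>, with
      \<open>t / 6\<close> subtracted to make it trace free in dimension 6; \<open>F\<close> is the
      antilinear part.\<close>
    define E where "E x = (1 / 2) *\<^sub>R (S x - J (S (J x))) - (t / 6) *\<^sub>R x" for x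
    define F where "F x = (1 / 2) *\<^sub>R (S x + J (S (J x)))" for x
    have GE: "G (E x) y = (G (S x) y + G (S (J x)) (J y)) / 2 - t / 6 * G x y"
      and GF: "G (F x) y = (G (S x) y - G (S (J x)) (J y)) / 2" for x y
      using GJ[of "S (J x)" y] by (simp_all add: E_def F_def G_simps)
    have lE: "linear E" and lF: "linear F"
      by (rule linearI; simp add: E_def F_def S_simps J_simps algebra_simps)+
    have Ss: "G (S x) y = G (S y) x" for x y using S(2)[of x y] sym[of x "S y"] by simp
    have Es: "G (E x) y = G x (E y)" for x y
      unfolding sym[of x "E y"] GE using Ss[of x y] Ss[of "J x" "J y"] sym[of x y] by simp
    have Fs: "G (F x) y = G x (F y)" for x y
      unfolding sym[of x "F y"] GF using Ss[of x y] Ss[of "J x" "J y"] by simp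
    have EJ: "E (J x) = J (E x)" and FJ: "F (J x) = - J (F x)" for x
      by (simp_all add: E_def F_def S_simps J_simps algebra_simps)
    have trE: "(\<Sum>k\<in>UNIV. G (E (?e k)) (?e k)) = 0"
      by (simp add: GE sum_subtractf sum.distrib sum_divide_distrib[symmetric] tr_J t[symmetric] orthonormal_G[OF onb])
    define comp where "comp W = (if W = W1 \<epsilon> then (\<lambda>x. \<rho> ((t / 6) *\<^sub>R x)) else if W = W1 \<epsilon>' then (\<lambda>x. \<rho> (c *\<^sub>R J x))
      else if W = W2 \<epsilon> then (\<lambda>x. \<rho> (E x)) else if W = W3 then (\<lambda>x. \<rho> (F x)) else (\<lambda>x y z. 0))" for W
    have comp: "comp (W1 \<epsilon>) = (\<lambda>x. \<rho> ((t / 6) *\<^sub>R x))" "comp (W1 \<epsilon>') = (\<lambda>x. \<rho> (c *\<^sub>R J x))"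
      "comp (W2 \<epsilon>) = (\<lambda>x. \<rho> (E x))" "comp (W2 \<epsilon>') = (\<lambda>x y z. 0)"
      "comp W3 = (\<lambda>x. \<rho> (F x))" "comp W4 = (\<lambda>x y z. 0)"
      using dist by (simp_all add: comp_def)
    have "\<forall>W\<in>?GH. comp W \<in> w_space G J pp W"
      unfolding GH ball_simps comp ws
      using W1_mem W2_mem[OF lE Es EJ trE] W3_mem[OF lF Fs FJ] zero_mem_w_space[of "W2 \<epsilon>'"] zero_mem_w_space[of W4]
      by blast
    moreover have "\<rho> (S x) y z + c * \<rho> (J x) y z = (\<Sum>W\<in>?GH. comp W x y z)" for x y z
    proof -
      have "S x = (t / 6) *\<^sub>R x + E x + F x"
        by (simp add: E_def F_def scaleR_2[symmetric] scaleR_left_distrib[symmetric] algebra_simps)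
      then have "\<rho> (S x) y z = \<rho> ((t / 6) *\<^sub>R x) y z + \<rho> (E x) y z + \<rho> (F x) y z"
        by (simp add: rho_simps)
      then show ?thesis
        unfolding GH using dist by (simp add: comp rho_simps)
    qed
    moreover have "comp W x y z = 0" if "W \<in> ?GH" "W \<notin> U" for W x y z
    proof -
      have "E x = 0" if "W2 \<epsilon> \<notin> U"
      proof (rule G_eqI)
        fix z
        have "G (S x) z + G (S (J x)) (J z) = t / 3 * G x z" using r that by blast
        then show "G (E x) z = G 0 z" by (simp add: GE G_simps)
      qed
      moreover have "F x = 0" if "W3 \<notin> U" by (rule G_eqI) (use that r in \<open>simp add: GF G_simps\<close>)
      ultimately show ?thesis
        using that r unfolding GH by (auto simp: comp rho_simps)
    qed
    ultimately show ?lhs by blast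
  qed
qed

end

section \<open>The algebra of an adapted frame\<close>

lemma wedge3:
  "wedge G [a, b, c] [x, y, z] =
    G a x * G b y * G c z + G a y * G b z * G c x + G a z * G b x * G c y
    - G a x * G b z * G c y - G a y * G b x * G c z - G a z * G b y * G c x"
proof -
  have s: "{..<length [a, b, c]} = {0, 1, 2::nat}" by auto
  have f: "finite {1, 2::nat}" "0 \<notin> {1, 2::nat}" "finite {2::nat}" "1 \<notin> {2::nat}" by auto
  have p: "(\<Prod>i\<in>{0, 1, 2}. h i) = h 0 * h 1 * h 2" for h :: "nat \<Rightarrow> real" by simp
  show ?thesis
    unfolding wedge_def s p
    unfolding sum_over_permutations_insert[OF f(1,2)]
    unfolding sum_over_permutations_insert[OF f(3,4)]
    unfolding permutes_sing
    by (simp add: sign_swap_id permutation_swap_id sign_compose sign_id swap_id_eq)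
qed

lemma wedge4:
  "wedge G [a, b, c, d] [x, y, z, w] =
    G a x * wedge G [b, c, d] [y, z, w] - G a y * wedge G [b, c, d] [x, z, w]
    + G a z * wedge G [b, c, d] [x, y, w] - G a w * wedge G [b, c, d] [x, y, z]"
proof -
  have s: "{..<length [a, b, c, d]} = {0, 1, 2, 3::nat}" by auto
  have f: "finite {1, 2, 3::nat}" "0 \<notin> {1, 2, 3::nat}" "finite {2, 3::nat}" "1 \<notin> {2, 3::nat}"
    "finite {3::nat}" "2 \<notin> {3::nat}" by auto
  have p: "(\<Prod>i\<in>{0, 1, 2, 3}. h i) = h 0 * h 1 * h 2 * h 3" for h :: "nat \<Rightarrow> real"
    by (simp add: mult.assoc)
  show ?thesis
    unfolding wedge3
    unfolding wedge_def s p
    unfolding sum_over_permutations_insert[OF f(1,2)]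
    unfolding sum_over_permutations_insert[OF f(3,4)]
    unfolding sum_over_permutations_insert[OF f(5,6)]
    unfolding permutes_sing
    by (simp add: sign_swap_id permutation_swap_id permutation_compose sign_compose sign_id swap_id_eq algebra_simps)
qed

lemma UNIV_7: "(UNIV :: 7 set) = {0, 1, 2, 3, 4, 5, 6}"
proof -
  have "card {0, 1, 2, 3, 4, 5, 6 :: 7} = 7" by simp
  then show ?thesis
    by (intro card_subset_eq[symmetric]) auto
qed

lemma sum_UNIV_7: "(\<Sum>i\<in>UNIV. f (i :: 7)) = f 0 + f 1 + f 2 + f 3 + f 4 + f 5 + (f 6 :: real)"
  unfolding UNIV_7 by simp

lemma numeral_7: "(7 :: 7) = 0" "(8 :: 7) = 1" "(9 :: 7) = 2" "(10 :: 7) = 3" "(11 :: 7) = 4" "(12 :: 7) = 5"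
  by simp_all

text \<open>This makes every cyclic shift of an adapted frame adapted again, the symmetry on which
  the reduction to a few index pairs rests.\<close>

lemma sum_shift_7: "(\<Sum>i\<in>UNIV. f (i + k :: 7)) = (\<Sum>i\<in>UNIV. f i :: real)"
  by (rule sum.reindex_bij_witness[of _ "\<lambda>i. i - k" "\<lambda>i. i + k"]) auto

lemma wedge4_swap:
  "wedge G [a, b, c, d] [x, y, z, w] = - wedge G [a, b, c, d] [y, x, z, w]"
  "wedge G [a, b, c, d] [x, y, z, w] = - wedge G [a, b, c, d] [x, z, y, w]"
  "wedge G [a, b, c, d] [x, y, z, w] = - wedge G [a, b, c, d] [x, y, w, z]"
  by (simp_all add: wedge4 wedge3 algebra_simps)

locale g2 = euclid G for G :: "(real ^ 7) form2" +
  fixes \<phi> :: "(real ^ 7) form3"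
  assumes ex_frame: "\<exists>e. adapted_frame G \<phi> e"
    and tri: "trilinear \<phi>" and alt: "alternating3 \<phi>"
begin

lemmas phi_simps = trilinear_simps[OF tri]

lemma phi_swap: "\<phi> x y z = - \<phi> y x z" "\<phi> x y z = - \<phi> x z y"
  using alt unfolding alternating3_def by blast+

lemma phi_cycle: "\<phi> x y z = \<phi> y z x"
  using phi_swap(1)[of x y z] phi_swap(2)[of y x z] by simp

lemma phi_same: "\<phi> x x y = 0" "\<phi> y x x = 0" "\<phi> x y x = 0"
  using phi_swap(1)[of x x y] phi_swap(2)[of y x x] phi_cycle[of x y x] by simp_all

text \<open>The very choice made inside \<open>star\<close>, so that \<open>sigma_eq\<close> holds
  by unfolding alone.\<close>

definition E :: "7 \<Rightarrow> real ^ 7" where "E = (SOME e. adapted_frame G \<phi> e)"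

abbreviation \<sigma> :: "(real ^ 7) form4" where "\<sigma> \<equiv> star G \<phi>"

lemma adapted_E: "adapted_frame G \<phi> E"
  unfolding E_def using ex_frame by (rule someI_ex)

lemma orthonormal_E: "orthonormal G E"
  using adapted_E by (simp add: adapted_frame_def)

lemma sigma_eq: "\<sigma> x y z w = - (\<Sum>i\<in>UNIV. wedge G [E (i + 2), E (i + 4), E (i + 5), E (i + 6)] [x, y, z, w])"
  unfolding star_def Let_def E_def[symmetric] by (rule refl)

lemma sigma_swap: "\<sigma> x y z w = - \<sigma> y x z w" "\<sigma> x y z w = - \<sigma> x z y w" "\<sigma> x y z w = - \<sigma> x y w z"
  unfolding sigma_eq sum_negf[symmetric] minus_minus
  by (intro sum.cong refl, subst wedge4_swap, simp)
    (intro sum.cong refl, subst wedge4_swap(2), simp, intro sum.cong refl, subst wedge4_swap(3), simp)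

lemma sigma_same: "\<sigma> x x z w = 0" "\<sigma> z x x w = 0" "\<sigma> z w x x = 0"
  using sigma_swap(1)[of x x z w] sigma_swap(2)[of z x x w] sigma_swap(3)[of z w x x] by simp_all

lemma sigma_first:
  "\<sigma> (x + x') y z w = \<sigma> x y z w + \<sigma> x' y z w"
  "\<sigma> (r *\<^sub>R x) y z w = r * \<sigma> x y z w"
  unfolding sigma_eq
  by (simp_all add: wedge4 wedge3 G_simps sum_distrib_left sum.distrib[symmetric] algebra_simps)

lemma trilinear_sigma: "trilinear (\<lambda>x y z. \<sigma> x y z w)" "trilinear (\<sigma> w)"
proof -
  have 1: "linear (\<lambda>x. \<sigma> x y z w)" for y z w
    by (rule linearI) (simp_all add: sigma_first)
  have 2: "(\<lambda>y. \<sigma> x y z w) = (\<lambda>y. - \<sigma> y x z w)" for x z w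
    by (intro ext sigma_swap)
  have l2: "linear (\<lambda>y. \<sigma> x y z w)" for x z w
    by (subst 2) (rule linear_compose_neg[OF 1])
  have 3: "(\<lambda>z. \<sigma> x y z w) = (\<lambda>z. - \<sigma> x z y w)" for x y w
    by (intro ext sigma_swap)
  have l3: "linear (\<lambda>z. \<sigma> x y z w)" for x y w
    by (subst 3) (rule linear_compose_neg[OF l2])
  have 4: "(\<lambda>w. \<sigma> x y z w) = (\<lambda>w. - \<sigma> x y w z)" for x y z
    by (intro ext sigma_swap)
  have l4: "linear (\<lambda>w. \<sigma> x y z w)" for x y z
    by (subst 4) (rule linear_compose_neg[OF l3])
  show "trilinear (\<lambda>x y z. \<sigma> x y z w)" "trilinear (\<sigma> w)"
    by (simp_all add: trilinear_def 1 l2 l3 l4)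
qed

lemmas sigma_simps = trilinear_simps[OF trilinear_sigma(1)] trilinear_simps[OF trilinear_sigma(2)]

text \<open>An identity that is bilinear and skew in two arguments need only be checked on the pairs
  \<open>(e 0, e 1)\<close>, \<open>(e 0, e 2)\<close>, \<open>(e 0, e 3)\<close> for the cyclic shifts \<open>e\<close> of the frame.\<close>

lemma skew_bilinear_eq_0:
  fixes b :: "real ^ 7 \<Rightarrow> real ^ 7 \<Rightarrow> real"
  assumes b: "bilinear b" "\<And>x y. b x y = - b y x"
    and base: "\<And>e. orthonormal G e \<Longrightarrow>
      (\<And>x y z. \<phi> x y z = (\<Sum>i\<in>UNIV. wedge G [e i, e (i + 1), e (i + 3)] [x, y, z])) \<Longrightarrow>
      (\<And>x y z w. \<sigma> x y z w = - (\<Sum>i\<in>UNIV. wedge G [e (i + 2), e (i + 4), e (i + 5), e (i + 6)] [x, y, z, w])) \<Longrightarrow>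
      b (e 0) (e 1) = 0 \<and> b (e 0) (e 2) = 0 \<and> b (e 0) (e 3) = 0"
  shows "b x y = 0"
proof -
  have bs: "b (E k) (E (1 + k)) = 0 \<and> b (E k) (E (2 + k)) = 0 \<and> b (E k) (E (3 + k)) = 0" for k
  proof -
    let ?e = "\<lambda>i. E (i + k)"
    have "orthonormal G ?e"
      using orthonormal_E by (simp add: orthonormal_def)
    moreover have "\<phi> x y z = (\<Sum>i\<in>UNIV. wedge G [?e i, ?e (i + 1), ?e (i + 3)] [x, y, z])" for x y z
      using sum_shift_7[of "\<lambda>i. wedge G [E i, E (i + 1), E (i + 3)] [x, y, z]" k] adapted_E
      by (simp add: adapted_frame_def add_ac)
    moreover have "\<sigma> x y z w = - (\<Sum>i\<in>UNIV. wedge G [?e (i + 2), ?e (i + 4), ?e (i + 5), ?e (i + 6)] [x, y, z, w])" for x y z w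
      unfolding sigma_eq
      using sum_shift_7[of "\<lambda>i. wedge G [E (i + 2), E (i + 4), E (i + 5), E (i + 6)] [x, y, z, w]" k]
      by (simp add: add_ac)
    ultimately have "b (?e 0) (?e 1) = 0 \<and> b (?e 0) (?e 2) = 0 \<and> b (?e 0) (?e 3) = 0"
      by (rule base)
    then show ?thesis by simp
  qed
  have "b (E p) (E q) = 0" for p q
  proof -
    \<comment> \<open>Modulo 7, a difference of 4, 5 or 6 becomes 3, 2 or 1 once the two indices are
      exchanged, at the cost of a sign.\<close>
    have "q - p \<in> {0, 1, 2, 3, 4, 5, 6}" unfolding UNIV_7[symmetric] by simp
    moreover have "p = - d + q" if "q - p = d" for d by (simp add: that[symmetric])
    moreover have "q = d + p" if "q - p = d" for d using that by (simp add: algebra_simps)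
    moreover have "- 4 = (3 :: 7)" "- 5 = (2 :: 7)" "- 6 = (1 :: 7)" by simp_all
    ultimately consider "q = p" | "q = 1 + p" | "q = 2 + p" | "q = 3 + p" | "p = 3 + q" | "p = 2 + q" | "p = 1 + q"
      by (smt (verit) add_0 empty_iff insert_iff)
    then show ?thesis
      using bs b(2)[of "E p" "E q"] b(2)[of "E p" "E p"] by cases simp_all
  qed
  then show ?thesis
    using bilinear_expand[OF orthonormal_E b(1), of x y] by simp
qed

section \<open>Identities in an adapted frame\<close>

context
  fixes e :: "7 \<Rightarrow> real ^ 7"
  assumes e: "orthonormal G e"
    and f: "\<And>x y z. \<phi> x y z = (\<Sum>i\<in>UNIV. wedge G [e i, e (i + 1), e (i + 3)] [x, y, z])"
    and s: "\<And>x y z w. \<sigma> x y z w = - (\<Sum>i\<in>UNIV. wedge G [e (i + 2), e (i + 4), e (i + 5), e (i + 6)] [x, y, z, w])"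
begin

lemma frame_phi:
  "\<phi> (e 0) (e 1) z = G (e 3) z" "\<phi> (e 0) (e 2) z = G (e 6) z" "\<phi> (e 0) (e 3) z = - G (e 1) z"
  unfolding sum_UNIV_7 f by (simp_all add: numeral_7 wedge3 orthonormal_G[OF e])

text \<open>The three base cases of \<open>phi_contraction\<close>, solved for
  \<open>\<sigma>\<close>, with the products from \<open>frame_phi\<close> inserted.\<close>

lemma frame_sigma:
  "\<sigma> (e 0) (e 1) z w = G (e 0) z * G (e 1) w - G (e 0) w * G (e 1) z - \<phi> z w (e 3)"
  "\<sigma> (e 0) (e 2) z w = G (e 0) z * G (e 2) w - G (e 0) w * G (e 2) z - \<phi> z w (e 6)"
  "\<sigma> (e 0) (e 3) z w = G (e 0) z * G (e 3) w - G (e 0) w * G (e 3) z + \<phi> z w (e 1)"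
  unfolding sum_UNIV_7 f s by (simp_all add: numeral_7 wedge3 wedge4 orthonormal_G[OF e])

text \<open>Together with \<open>frame_sigma2\<close> and \<open>frame_sigma3\<close> these are the
  base cases of \<open>sigma_contraction\<close>: \<open>e 3\<close>, \<open>e 6\<close> and
  \<open>- e 1\<close> are the products of \<open>e 0\<close> with \<open>e 1\<close>,
  \<open>e 2\<close> and \<open>e 3\<close>.\<close>

lemma frame_sigma1:
  "\<sigma> (e 3) x y z = - (G (e 0) x * \<phi> (e 1) y z + G (e 0) y * \<phi> (e 1) z x + G (e 0) z * \<phi> (e 1) x y
    - G (e 1) x * \<phi> (e 0) y z - G (e 1) y * \<phi> (e 0) z x - G (e 1) z * \<phi> (e 0) x y)"
  unfolding sum_UNIV_7 f s by (simp add: numeral_7 wedge3 wedge4 orthonormal_G[OF e] algebra_simps)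

lemma frame_sigma2:
  "\<sigma> (e 6) x y z = - (G (e 0) x * \<phi> (e 2) y z + G (e 0) y * \<phi> (e 2) z x + G (e 0) z * \<phi> (e 2) x y
    - G (e 2) x * \<phi> (e 0) y z - G (e 2) y * \<phi> (e 0) z x - G (e 2) z * \<phi> (e 0) x y)"
  unfolding sum_UNIV_7 f s by (simp add: numeral_7 wedge3 wedge4 orthonormal_G[OF e] algebra_simps)

lemma frame_sigma3:
  "- \<sigma> (e 1) x y z = - (G (e 0) x * \<phi> (e 3) y z + G (e 0) y * \<phi> (e 3) z x + G (e 0) z * \<phi> (e 3) x y
    - G (e 3) x * \<phi> (e 0) y z - G (e 3) y * \<phi> (e 0) z x - G (e 3) z * \<phi> (e 0) x y)"
  unfolding sum_UNIV_7 f s by (simp add: numeral_7 wedge3 wedge4 orthonormal_G[OF e] algebra_simps)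

end

text \<open>Both sides are bilinear and skew in \<open>x\<close> and \<open>y\<close>, so three
  frame values suffice. The result is the formula for inner products of values of \<open>P\<close>,
  in which \<open>*\<phi>\<close> measures the deviation from the Gram determinant.\<close>

lemma phi_contraction:
  "(\<Sum>i\<in>UNIV. \<phi> x y (E i) * \<phi> z w (E i)) = G x z * G y w - G x w * G y z - \<sigma> x y z w"
proof -
  define b where "b x y = (\<Sum>i\<in>UNIV. \<phi> x y (E i) * \<phi> z w (E i)) - (G x z * G y w - G x w * G y z - \<sigma> x y z w)" for x y
  have "b x y = 0" for x y
  proof (rule skew_bilinear_eq_0)
    show "bilinear b"
      unfolding bilinear_def b_def
      by (intro conjI allI linearI)
        (simp_all add: phi_simps sigma_simps G_simps algebra_simps sum.distrib sum_distrib_left)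
    show "b x y = - b y x" for x y
      unfolding b_def using sigma_swap(1)[of x y z w] phi_swap(1)[of x y]
      by (simp add: sum_negf)
    fix e
    assume e: "orthonormal G e"
      and f: "\<And>x y z. \<phi> x y z = (\<Sum>i\<in>UNIV. wedge G [e i, e (i + 1), e (i + 3)] [x, y, z])"
      and s: "\<And>x y z w. \<sigma> x y z w = - (\<Sum>i\<in>UNIV. wedge G [e (i + 2), e (i + 4), e (i + 5), e (i + 6)] [x, y, z, w])"
    have "bilinear (\<lambda>u v. \<phi> x y u * \<phi> z w v)" for x y
      using tri unfolding bilinear_def trilinear_def
      by (auto intro!: linearI simp: phi_simps algebra_simps)
    \<comment> \<open>\<open>b\<close> was defined with the frame \<open>E\<close>; independence of
      the trace allows it to be evaluated in the shifted frame \<open>e\<close>.\<close>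
    from trace_orthonormal[OF this orthonormal_E e]
    have "b x y = (\<Sum>i\<in>UNIV. \<phi> x y (e i) * \<phi> z w (e i)) - (G x z * G y w - G x w * G y z - \<sigma> x y z w)" for x y
      by (simp add: b_def)
    note b_e = this
    show "b (e 0) (e 1) = 0 \<and> b (e 0) (e 2) = 0 \<and> b (e 0) (e 3) = 0"
    proof -
      have "linear (\<phi> z w)" using tri by (simp add: trilinear_def)
      note l = linear_expand_real(1,3)[OF e this]
      show ?thesis
        using b_e
        by (simp add: frame_phi[OF e f s] frame_sigma[OF e f s] sum_negf l)
    qed
  qed
  then show ?thesis by (simp add: b_def)
qed

text \<open>The bracket is the action on \<open>\<phi>\<close> of the elementary skew endomorphism
  \<open>x \<mapsto> G u x *\<^sub>R v - G v x *\<^sub>R u\<close>. That action is therefore the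
  contraction of \<open>*\<phi>\<close> with \<open>- P u v\<close>.\<close>

lemma sigma_contraction:
  "(\<Sum>i\<in>UNIV. \<phi> u v (E i) * \<sigma> (E i) x y z) =
    - (G u x * \<phi> v y z + G u y * \<phi> v z x + G u z * \<phi> v x y
    - G v x * \<phi> u y z - G v y * \<phi> u z x - G v z * \<phi> u x y)"
proof -
  define b where "b u v = (\<Sum>i\<in>UNIV. \<phi> u v (E i) * \<sigma> (E i) x y z) + (
    G u x * \<phi> v y z + G u y * \<phi> v z x + G u z * \<phi> v x y
    - G v x * \<phi> u y z - G v y * \<phi> u z x - G v z * \<phi> u x y)" for u v
  have "b u v = 0" for u v
  proof (rule skew_bilinear_eq_0)
    show "bilinear b"
      unfolding bilinear_def b_def
      by (intro conjI allI linearI)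
        (simp_all add: phi_simps sigma_simps G_simps algebra_simps sum.distrib sum_distrib_left)
    show "b u v = - b v u" for u v
      unfolding b_def using phi_swap(1)[of u v] by (simp add: sum_negf)
    fix e
    assume e: "orthonormal G e"
      and f: "\<And>x y z. \<phi> x y z = (\<Sum>i\<in>UNIV. wedge G [e i, e (i + 1), e (i + 3)] [x, y, z])"
      and s: "\<And>x y z w. \<sigma> x y z w = - (\<Sum>i\<in>UNIV. wedge G [e (i + 2), e (i + 4), e (i + 5), e (i + 6)] [x, y, z, w])"
    have "bilinear (\<lambda>a c. \<phi> u v a * \<sigma> c x y z)" for u v
      using tri unfolding bilinear_def trilinear_def
      by (auto intro!: linearI simp: phi_simps sigma_simps algebra_simps)
    from trace_orthonormal[OF this orthonormal_E e]
    have "b u v = (\<Sum>i\<in>UNIV. \<phi> u v (e i) * \<sigma> (e i) x y z) + (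
      G u x * \<phi> v y z + G u y * \<phi> v z x + G u z * \<phi> v x y
      - G v x * \<phi> u y z - G v y * \<phi> u z x - G v z * \<phi> u x y)" for u v
      by (simp add: b_def)
    note b_e = this
    show "b (e 0) (e 1) = 0 \<and> b (e 0) (e 2) = 0 \<and> b (e 0) (e 3) = 0"
    proof -
      have "linear (\<lambda>a. \<sigma> a x y z)" using trilinear_sigma(1) by (simp add: trilinear_def)
      note l = linear_expand_real(1,3)[OF e this]
      show ?thesis
        using b_e frame_sigma3[OF e f s, of x y z]
        by (simp add: frame_phi[OF e f s] frame_sigma1[OF e f s] frame_sigma2[OF e f s] sum_negf l)
    qed
  qed
  from this[of u v] show ?thesis unfolding b_def by linarith
qed


section \<open>The vector product and the action of skew endomorphisms\<close>

abbreviation P :: "real ^ 7 \<Rightarrow> real ^ 7 \<Rightarrow> real ^ 7" where "P \<equiv> cross G \<phi>"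

lemma G_P: "G (P x y) z = \<phi> x y z"
proof -
  have "linear (\<phi> x y)" using tri by (simp add: trilinear_def)
  then obtain v where v: "\<forall>z. G v z = \<phi> x y z" using riesz by blast
  have "P x y = v"
    unfolding cross_def
  proof (rule the_equality)
    show "\<forall>z. G v z = \<phi> x y z" by (rule v)
    fix w assume "\<forall>z. G w z = \<phi> x y z"
    then show "w = v" using v by (intro G_eqI) simp
  qed
  then show ?thesis using v by simp
qed

lemma G_P_P: "G (P x y) (P z w) = G x z * G y w - G x w * G y z - \<sigma> x y z w"
  using parseval[OF orthonormal_E, of "P x y" "P z w"] by (simp add: G_P phi_contraction)

lemma P_trace: "(\<Sum>i\<in>UNIV. G (P u (onb G i)) (P v (onb G i))) = 6 * G u v"
proof -
  have "G (P u (onb G i)) (P v (onb G i)) = G u v - G u (onb G i) * G v (onb G i)" for i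
    using sym[of v "onb G i"] sigma_swap(2)[of u v "onb G i" "onb G i"]
    by (simp add: G_P_P orthonormal_G[OF onb] sigma_swap(2)[of u "onb G i" v] sigma_same)
  then show ?thesis by (simp add: sum_subtractf parseval[OF onb])
qed

lemma phi_phi_trace:
  "(\<Sum>i\<in>UNIV. \<Sum>j\<in>UNIV. \<phi> u (onb G i) (onb G j) * \<phi> v (onb G i) (onb G j)) = 6 * G u v"
proof -
  have "(\<Sum>j\<in>UNIV. \<phi> u (onb G i) (onb G j) * \<phi> v (onb G i) (onb G j)) = G (P u (onb G i)) (P v (onb G i))" for i
    using parseval[OF onb, of "P u (onb G i)" "P v (onb G i)"] by (simp add: G_P)
  then show ?thesis by (simp add: P_trace)
qed

text \<open>The constant is \<open>4 * 6 / 3!\<close>, with 6 from \<open>P_trace\<close>. It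
  explains the \<open>1 / 4\<close> in \<open>rbar\<close>: from
  \<open>T \<lrcorner> *\<phi>\<close> that form recovers exactly the inner product with
  \<open>T\<close>.\<close>

lemma sigma_inner: "inner_form3 G (\<sigma> u) (\<sigma> v) = 4 * G u v"
proof -
  let ?e = "onb G"
  have bil_phi: "bilinear (\<phi> w)" and bil_sigma: "bilinear (\<sigma> u w)" for u w
    using tri trilinear_sigma(2) by (simp_all add: trilinear_def bilinear_def)
  have s: "\<sigma> u a b c = G u b * G a c - G u c * G a b - \<phi> (P u a) b c" for u a b c
    using G_P_P[of u a b c] sym[of "P u a" "P b c"] phi_cycle[of "P u a" b c] by (simp add: G_P)
  \<comment> \<open>Two-forms of the shape \<open>\<phi> w\<close> are eigenvectors of
    \<open>*\<phi>\<close> acting on two-forms; the eigenvalue is \<open>2 - 6\<close>, from the two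
    metric terms of \<open>s\<close> and from \<open>phi_phi_trace\<close>.\<close>
  have 1: "(\<Sum>i\<in>UNIV. \<Sum>j\<in>UNIV. \<phi> w (?e i) (?e j) * \<sigma> v a (?e i) (?e j)) = - 4 * G w (P v a)" for w a
  proof -
    have "(\<Sum>i\<in>UNIV. \<Sum>j\<in>UNIV. \<phi> w (?e i) (?e j) * \<sigma> v a (?e i) (?e j)) =
      (\<Sum>i\<in>UNIV. \<Sum>j\<in>UNIV. \<phi> w (?e i) (?e j) * (G v (?e i) * G a (?e j)))
      - (\<Sum>i\<in>UNIV. \<Sum>j\<in>UNIV. \<phi> w (?e i) (?e j) * (G a (?e i) * G v (?e j)))
      - (\<Sum>i\<in>UNIV. \<Sum>j\<in>UNIV. \<phi> w (?e i) (?e j) * \<phi> (P v a) (?e i) (?e j))"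
      unfolding s by (simp add: right_diff_distrib sum_subtractf mult_ac)
    also have "\<dots> = \<phi> w v a - \<phi> w a v - 6 * G w (P v a)"
      unfolding bilinear_expand[OF onb bil_phi] phi_phi_trace ..
    also have "\<dots> = - 4 * G w (P v a)"
      using phi_swap(2)[of w a v] phi_cycle[of w v a] sym[of w "P v a"] by (simp add: G_P)
    finally show ?thesis .
  qed
  have "(\<Sum>i\<in>UNIV. \<Sum>j\<in>UNIV. \<sigma> u a (?e i) (?e j) * \<sigma> v a (?e i) (?e j)) = 4 * G (P u a) (P v a)" for a
  proof -
    have "(\<Sum>i\<in>UNIV. \<Sum>j\<in>UNIV. \<sigma> u a (?e i) (?e j) * \<sigma> v a (?e i) (?e j)) =
      (\<Sum>i\<in>UNIV. \<Sum>j\<in>UNIV. \<sigma> v a (?e i) (?e j) * (G u (?e i) * G a (?e j)))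
      - (\<Sum>i\<in>UNIV. \<Sum>j\<in>UNIV. \<sigma> v a (?e i) (?e j) * (G a (?e i) * G u (?e j)))
      - (\<Sum>i\<in>UNIV. \<Sum>j\<in>UNIV. \<phi> (P u a) (?e i) (?e j) * \<sigma> v a (?e i) (?e j))"
      unfolding s[of u] by (simp add: left_diff_distrib right_diff_distrib sum_subtractf mult_ac)
    also have "\<dots> = \<sigma> v a u a - \<sigma> v a a u + 4 * G (P u a) (P v a)"
      unfolding bilinear_expand[OF onb bil_sigma] 1 by simp
    finally show ?thesis using sigma_swap(3)[of v a u a] by (simp add: sigma_same)
  qed
  then show ?thesis
    by (simp add: inner_form3_def sum_distrib_left[symmetric] P_trace fact_numeral)
qed

text \<open>The action of \<open>so(7)\<close> on \<open>\<phi>\<close> has the seven-dimensional image \<open>{T \<lrcorner> *\<phi>}\<close>.\<close>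

lemma skew_action:
  assumes a: "linear a" "\<And>x y. G (a x) y = - G x (a y)"
  shows "\<exists>T. \<forall>x y z. \<phi> (a x) y z + \<phi> x (a y) z + \<phi> x y (a z) = \<sigma> T x y z"
proof -
  define A where "A i j = G (a (E i)) (E j)" for i j
  \<comment> \<open>\<open>a\<close> is a combination of elementary skew endomorphisms of the frame,
    each acting through \<open>- P (E i) (E j)\<close> by \<open>sigma_contraction\<close>; the
    \<open>1 / 2\<close> corrects for counting every pair of indices twice.\<close>
  define T where "T = (\<Sum>i\<in>UNIV. \<Sum>j\<in>UNIV. (- A i j / 2) *\<^sub>R (\<Sum>k\<in>UNIV. \<phi> (E i) (E j) (E k) *\<^sub>R E k))"
  have skA: "A j i = - A i j" for i j
    using a(2)[of "E j" "E i"] sym[of "E j" "a (E i)"] by (simp add: A_def)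
  have lin: "(\<Sum>i\<in>UNIV. \<Sum>j\<in>UNIV. A i j * (G (E i) x * l (E j))) = l (a x)"
    if l: "linear l" for x and l :: "_ \<Rightarrow> real"
  proof -
    have "(\<Sum>j\<in>UNIV. A i j * (G (E i) x * l (E j))) = G (E i) x * l (a (E i))" for i
      using linear_expand_real(1)[OF orthonormal_E l, of "a (E i)"]
      by (simp add: A_def sum_distrib_left[symmetric] mult.left_commute[of _ "G (E i) x"])
    then show ?thesis
      using linear_expand_real(3)[OF orthonormal_E linear_compose[OF a(1) l], of x] by simp
  qed
  have lin': "(\<Sum>i\<in>UNIV. \<Sum>j\<in>UNIV. A i j * (G (E j) x * l (E i))) = - l (a x)"
    if l: "linear l" for x and l :: "_ \<Rightarrow> real"
  proof -
    have "(\<Sum>i\<in>UNIV. \<Sum>j\<in>UNIV. A i j * (G (E j) x * l (E i))) = (\<Sum>j\<in>UNIV. \<Sum>i\<in>UNIV. A i j * (G (E j) x * l (E i)))"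
      by (rule sum.swap)
    also have "\<dots> = (\<Sum>j\<in>UNIV. \<Sum>i\<in>UNIV. - (A j i * (G (E j) x * l (E i))))"
      by (intro sum.cong refl) (subst skA, simp)
    also have "\<dots> = - l (a x)"
      unfolding sum_negf lin[OF l] ..
    finally show ?thesis .
  qed
  have "\<phi> (a x) y z + \<phi> x (a y) z + \<phi> x y (a z) = \<sigma> T x y z" for x y z
  proof -
    have l: "linear (\<lambda>u. \<phi> u y z)" "linear (\<lambda>u. \<phi> u z x)" "linear (\<lambda>u. \<phi> u x y)"
      using tri by (simp_all add: trilinear_def)
    have "\<sigma> T x y z = (\<Sum>i\<in>UNIV. \<Sum>j\<in>UNIV. (- A i j / 2) * (\<Sum>k\<in>UNIV. \<phi> (E i) (E j) (E k) * \<sigma> (E k) x y z))"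
      by (simp add: T_def sigma_simps)
    also have "\<dots> = (\<Sum>i\<in>UNIV. \<Sum>j\<in>UNIV. (A i j * (G (E i) x * \<phi> (E j) y z) + A i j * (G (E i) y * \<phi> (E j) z x)
        + A i j * (G (E i) z * \<phi> (E j) x y) - A i j * (G (E j) x * \<phi> (E i) y z)
        - A i j * (G (E j) y * \<phi> (E i) z x) - A i j * (G (E j) z * \<phi> (E i) x y)) / 2)"
      unfolding sigma_contraction by (intro sum.cong refl) (simp add: field_simps)
    also have "\<dots> = (\<phi> (a x) y z + \<phi> (a y) z x + \<phi> (a z) x y) "
      unfolding sum_divide_distrib[symmetric] sum.distrib sum_subtractf lin[OF l(1)] lin[OF l(2)] lin[OF l(3)]
        lin'[OF l(1)] lin'[OF l(2)] lin'[OF l(3)] by simp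
    finally show ?thesis
      using phi_cycle[of x "a y" z] phi_cycle[of "a z" x y] by simp
  qed
  then show ?thesis by blast
qed

end

section \<open>The SU(3)-structure of a hyperplane\<close>

locale hyperplane = g2 G \<phi> for G \<phi> +
  fixes n :: "real ^ 7" and D :: "real ^ 6 \<Rightarrow> real ^ 7"
  assumes D_linear: "linear D" and inj_D: "inj D"
    and n_unit: "G n n = 1" and n_normal: "G n (D x) = 0"
begin

lemmas D_simps = linear_add[OF D_linear] linear_diff[OF D_linear] linear_neg[OF D_linear]
  linear_scale[OF D_linear] linear_0[OF D_linear]

lemma D_eq_iff: "D x = D y \<longleftrightarrow> x = y"
  using inj_D by (simp add: inj_eq)

text \<open>Dimension count: the image of the injective \<open>D\<close> has dimension 6 and lies in
  the proper subspace orthogonal to \<open>n\<close>.\<close>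

lemma tangent: "G n v = 0 \<Longrightarrow> \<exists>x. D x = v"
proof -
  let ?S = "{v. G n v = 0}"
  have S: "subspace ?S"
    by (auto simp: subspace_def G_simps)
  have "n \<notin> ?S" using n_unit by simp
  moreover have "span ?S = ?S" using S by (simp only: span_eq_iff)
  ultimately have "span ?S \<subset> span UNIV" unfolding span_UNIV by blast
  then have "dim ?S < dim (UNIV :: (real ^ 7) set)" by (rule dim_psubset)
  moreover have "dim (range D) = dim (UNIV :: (real ^ 6) set)"
    using D_linear inj_D by (intro dim_image_eq) auto
  ultimately have "dim ?S \<le> dim (range D)" by (simp add: dim_UNIV)
  then have "range D = ?S"
    using subspace_dim_equal[of "range D" ?S] linear_subspace_image[OF D_linear subspace_UNIV] S n_normal by auto
  then show "G n v = 0 \<Longrightarrow> \<exists>x. D x = v" by (metis (mono_tags) image_iff mem_Collect_eq)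
qed

text \<open>\<open>G'\<close>, \<open>\<rho>\<close> and \<open>J\<close> repeat the bodies of the
  induced objects at a point, so that they are identified with them later by unfolding.\<close>

definition G' :: "(real ^ 6) form2" where "G' x y = G (D x) (D y)"
definition \<rho> :: "(real ^ 6) form3" where "\<rho> x y z = \<phi> (D x) (D y) (D z)"
definition J :: "real ^ 6 \<Rightarrow> real ^ 6" where "J x = (THE y. D y = P n (D x))"

lemma D_J: "D (J x) = P n (D x)"
proof -
  have "G n (P n (D x)) = 0"
    using sym[of n "P n (D x)"] by (simp add: G_P phi_same)
  then obtain y where "D y = P n (D x)" using tangent by blast
  then show ?thesis
    unfolding J_def by (rule theI) (metis D_eq_iff \<open>D y = P n (D x)\<close>)
qed

lemma phi_n: "\<phi> n (D x) (D y) = G' (J x) y"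
  by (simp add: G'_def D_J G_P)

lemma sigma_n: "\<sigma> n (D x) (D y) (D z) = - \<rho> (J x) y z"
  using G_P_P[of n "D x" "D y" "D z"] sym[of "P n (D x)" "P (D y) (D z)"] phi_cycle[of "P n (D x)" "D y" "D z"]
  by (simp add: n_normal \<rho>_def D_J G_P)

lemma normal_decomposition:
  obtains x where "v = D x + G n v *\<^sub>R n"
proof -
  have "G n (v - G n v *\<^sub>R n) = 0" by (simp add: G_simps n_unit)
  then obtain x where "D x = v - G n v *\<^sub>R n" using tangent by blast
  then show ?thesis using that[of x] by simp
qed

sublocale su3: su3 G' J \<rho>
proof (intro su3.intro euclid.intro su3_axioms.intro)
  show "bilinear G'"
    unfolding bilinear_def G'_def
    by (intro conjI allI linearI) (simp_all add: D_simps G_simps)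
  show "G' x y = G' y x" for x y unfolding G'_def by (rule sym)
  show "0 < G' x x" if "x \<noteq> 0" for x
  proof -
    have "D x \<noteq> 0" using that D_eq_iff[of x 0] by (simp add: D_simps)
    then show ?thesis unfolding G'_def by (rule pos)
  qed
  have P_add: "P n (u + v) = P n u + P n v" "P n (r *\<^sub>R u) = r *\<^sub>R P n u" for u v r
    by (rule G_eqI; simp add: G_simps G_P phi_simps)+
  show "linear J"
  proof (rule linearI)
    show "J (x + y) = J x + J y" for x y
      unfolding D_eq_iff[symmetric] by (simp add: D_simps D_J P_add)
    show "J (r *\<^sub>R x) = r *\<^sub>R J x" for r x
      unfolding D_eq_iff[symmetric] by (simp add: D_simps D_J P_add)
  qed
  have PP: "G (P n (D x)) (P n (D y)) = G (D x) (D y)" for x y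
    using sigma_swap(2)[of n "D x" n "D y"] sym[of "D x" n]
    by (simp add: G_P_P n_unit n_normal sigma_same)
  show "G' (J x) (J y) = G' x y" for x y
    by (simp add: G'_def D_J PP)
  show "J (J x) = - x" for x
    unfolding D_eq_iff[symmetric]
  proof (rule G_eqI)
    fix z
    show "G (D (J (J x))) z = G (D (- x)) z"
    proof (rule normal_decomposition[of z])
      fix y assume y: "z = D y + G n z *\<^sub>R n"
      have "\<phi> n (P n (D x)) (D y) = - G (P n (D y)) (P n (D x))"
        using phi_swap(2)[of n "P n (D x)" "D y"] by (simp add: G_P)
      then have "G (D (J (J x))) (D y) = G (D (- x)) (D y)"
        using PP[of y x] sym[of "D x" "D y"] by (simp add: D_J G_P D_simps G_simps)
      moreover have "G (D (J (J x))) n = 0" "G (D (- x)) n = 0"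
        using n_normal sym[of n] by simp_all
      ultimately show ?thesis by (subst (1 2) y) (simp add: G_simps)
    qed
  qed
  show "trilinear \<rho>"
    unfolding trilinear_def \<rho>_def
    by (intro conjI allI linearI) (simp_all add: D_simps phi_simps)
  show "alternating3 \<rho>"
    unfolding alternating3_def \<rho>_def by (intro allI conjI phi_swap)
  \<comment> \<open>By \<open>sigma_n\<close> the form
    \<open>\<rho>(J \<cdot>, \<cdot>, \<cdot>)\<close> is a restriction of \<open>*\<phi>\<close>,
    hence skew in its first two arguments as well.\<close>
  show "\<rho> (J x) y z = \<rho> x (J y) z" for x y z
  proof -
    have "\<rho> x (J y) z = - \<rho> (J y) x z" unfolding \<rho>_def by (rule phi_swap)
    then show ?thesis
      using sigma_n[of x y z] sigma_n[of y x z] sigma_swap(2)[of n "D x" "D y" "D z"] by simp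
  qed
  show "G' v v = G' x x * G' y y - (G' x y)\<^sup>2 - (G' (J x) y)\<^sup>2"
    if v: "\<And>z. G' v z = \<rho> x y z" for v x y
  proof -
    \<comment> \<open>\<open>v\<close> is the tangential part of the product in the ambient space;
      removing the normal component accounts for the last square in the claim.\<close>
    have "D v = P (D x) (D y) - G' (J x) y *\<^sub>R n"
    proof (rule G_eqI)
      fix z
      show "G (D v) z = G (P (D x) (D y) - G' (J x) y *\<^sub>R n) z"
      proof (rule normal_decomposition[of z])
        fix u assume u: "z = D u + G n z *\<^sub>R n"
        have "G (D v) (D u) = G (P (D x) (D y) - G' (J x) y *\<^sub>R n) (D u)"
          using v[of u] by (simp add: G'_def \<rho>_def G_simps G_P n_normal)
        moreover have "G (D v) n = G (P (D x) (D y) - G' (J x) y *\<^sub>R n) n"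
          using phi_n[of x y] phi_cycle[of n "D x" "D y"] sym[of "D v" n]
          by (simp add: G_simps G_P n_normal n_unit)
        ultimately show ?thesis by (subst (1 2) u) (simp add: G_simps)
      qed
    qed
    then have "G' v v = G (P (D x) (D y)) (P (D x) (D y)) - (G' (J x) y)\<^sup>2"
      using phi_n[of x y] phi_cycle[of n "D x" "D y"] sym[of n "P (D x) (D y)"]
      by (simp add: G'_def[of v] G_simps n_unit G_P power2_eq_square)
    then show ?thesis
      using sigma_swap(2)[of "D x" "D y" "D x" "D y"] sym[of "D x" "D y"]
      by (simp add: G_P_P sigma_same G'_def power2_eq_square)
  qed
qed

text \<open>Up to sign this is half of \<open>\<omega> \<and> \<omega>\<close>. It comes from
  computing \<open>G (P (D a) (D b)) (P (D c) (D d))\<close> twice: by \<open>G_P_P\<close>, and by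
  splitting \<open>P\<close> into \<open>su3.K\<close> and its normal part.\<close>

lemma sigma_tangent:
  "\<sigma> (D a) (D b) (D c) (D d) =
    G' (J a) c * G' (J b) d - G' (J a) d * G' (J b) c - G' (J a) b * G' (J c) d"
proof -
  have P: "P (D x) (D y) = D (su3.K x y) + G' (J x) y *\<^sub>R n" for x y
  proof (rule G_eqI)
    fix z
    show "G (P (D x) (D y)) z = G (D (su3.K x y) + G' (J x) y *\<^sub>R n) z"
    proof (rule normal_decomposition[of z])
      fix u assume u: "z = D u + G n z *\<^sub>R n"
      have "G (P (D x) (D y)) (D u) = G (D (su3.K x y) + G' (J x) y *\<^sub>R n) (D u)"
        using su3.G_K[of x y u] by (simp add: G'_def[of "su3.K x y"] \<rho>_def G_simps G_P n_normal)
      moreover have "G (P (D x) (D y)) n = G (D (su3.K x y) + G' (J x) y *\<^sub>R n) n"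
        using phi_n[of x y] phi_cycle[of n "D x" "D y"] sym[of "D (su3.K x y)" n]
        by (simp add: G_simps G_P n_normal n_unit)
      ultimately show ?thesis by (subst (1 2) u) (simp add: G_simps)
    qed
  qed
  have "G (P (D a) (D b)) (P (D c) (D d)) = G' (su3.K a b) (su3.K c d) + G' (J a) b * G' (J c) d"
    unfolding P using sym[of "D (su3.K a b)" n] by (simp add: G_simps n_normal n_unit G'_def)
  then show ?thesis
    unfolding G_P_P su3.G_K_K by (simp add: G'_def)
qed

end

context su3 begin

text \<open>Here \<open>NJ\<close>, \<open>N\<omega>\<close>, \<open>N\<rho>\<close> and \<open>N\<mu>\<close> stand for the covariant derivatives at a point of \<open>J\<close>, \<open>\<omega>\<close>,
  \<open>\<rho>\<close> and \<open>\<mu> = \<rho>(J \<cdot>, \<cdot>, \<cdot>)\<close>.\<close>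

lemma torsion_one_form:
  fixes NJ :: "real ^ 6 \<Rightarrow> real ^ 6 \<Rightarrow> real ^ 6"
  assumes S: "linear S" "\<And>x y. G (S x) y = G x (S y)"
    and N\<omega>: "\<And>x y z. N\<omega> x y z = \<rho> (S x) y z + c * \<rho> (J x) y z"
    and NJ: "\<And>x y z. G z (NJ x y) = N\<omega> x z y"
    and N\<rho>: "\<And>x y z w. N\<rho> x y z w =
        - c * (G (J x) z * G (J y) w - G (J x) w * G (J y) z - G (J x) y * G (J z) w)
        + G (S x) y * G (J z) w + G (S x) z * G (J w) y + G (S x) w * G (J y) z"
    and N\<mu>: "\<And>x y z w. N\<mu> x y z w = N\<rho> x (J y) z w + \<rho> (NJ x y) z w"
    and \<eta>: "linear \<eta>"
    and C: "\<And>x y. C x y = (- \<eta> (J x)) *\<^sub>R J y - (1 / 2) *\<^sub>R J (NJ x y)"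
  shows "N\<omega> x y z - G (C x y) (J z) - G y (J (C x z)) = 0"
    and "(\<forall>x y z w. N\<rho> x y z w - \<rho> (C x y) z w - \<rho> y (C x z) w - \<rho> y z (C x w) = 0)
      \<longleftrightarrow> \<eta> = (\<lambda>x. 0)"
    and "\<eta> = (\<lambda>x. 0) \<Longrightarrow> N\<mu> x y z w - \<rho> (J (C x y)) z w - \<rho> (J y) (C x z) w - \<rho> (J y) z (C x w) = 0"
proof -
  \<comment> \<open>With \<open>E x = S x + c *\<^sub>R J x\<close> this is
    \<open>- (1 / 2) *\<^sub>R J (E x)\<close>, chosen so that the torsion \<open>\<xi>\<close>
    becomes the cross product with \<open>u x\<close>.\<close>
  define u where "u x = (c / 2) *\<^sub>R x - (1 / 2) *\<^sub>R J (S x)" for x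
  have JNJ: "- (1 / 2) *\<^sub>R J (NJ x y) = K (u x) y" for x y
  proof (rule G_eqI)
    fix z
    have "G (J (NJ x y)) z = - N\<omega> x (J z) y"
      using GJ[of z "NJ x y"] sym[of z "J (NJ x y)"] NJ[of "J z" x y] by simp
    then show "G (- (1 / 2) *\<^sub>R J (NJ x y)) z = G (K (u x) y) z"
      using rho_swap(2)[of "J (S x)" y z] rho_swap(2)[of x y z]
      by (simp add: G_simps G_K N\<omega> u_def rho_simps rho_J JJ field_simps)
  qed
  then have C': "C x y = K (u x) y - \<eta> (J x) *\<^sub>R J y" for x y
    unfolding C JNJ[symmetric] by simp
  have NJ': "NJ x y = 2 *\<^sub>R J (K (u x) y)" for x y
    unfolding JNJ[symmetric] by (simp add: J_simps)
  have N\<omega>': "N\<omega> x y z = 2 * \<rho> (u x) y (J z)" for x y z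
    by (simp add: N\<omega> u_def rho_simps rho_J J_simps)
  show "N\<omega> x y z - G (C x y) (J z) - G y (J (C x z)) = 0"
    using GJ[of y "C x z"] sym[of "J y" "K (u x) z"] sym[of "J y" "J z"] rho_swap(2)[of "u x" z "J y"]
    by (simp add: C' G_simps G_K N\<omega>' GJJ rho_J)
  \<comment> \<open>The torsion \<open>\<xi>\<close> alone already accounts for the whole derivative
    of \<open>\<rho>\<close>, which leaves no room for a W5-part.\<close>
  have K_rho: "\<rho> (K (u x) y) z w + \<rho> y (K (u x) z) w + \<rho> y z (K (u x) w) = N\<rho> x y z w" for x y z w
  proof -
    have 1: "\<rho> (K a b) c d = G (K a b) (K c d)" for a b c d
      using rho_cycle[of "K a b" c d] sym[of "K a b" "K c d"] by (simp add: G_K)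
    have "\<rho> y (K (u x) z) w = \<rho> (K (u x) z) w y" "\<rho> y z (K (u x) w) = \<rho> (K (u x) w) y z"
      using rho_cycle by metis+
    moreover have "G (J z) y = - G (J y) z" "G (J w) y = - G (J y) w" "G (J w) z = - G (J z) w"
      by (rule GJ_swap)+
    moreover have "G z y = G y z" "G w y = G y w" "G w z = G z w" by (rule sym)+
    moreover have "G (J (u x)) v = (1 / 2) * (G (S x) v + c * G (J x) v)" for v
      by (simp add: u_def J_simps G_simps)
    ultimately show ?thesis
      by (simp only: 1 G_K_K N\<rho>) (simp add: algebra_simps)
  qed
  \<comment> \<open>A multiple of \<open>J\<close> acts on each of the three slots of
    \<open>\<rho>\<close> in the same way, hence the factor 3. As \<open>\<rho>\<close> is nonzero,
    only \<open>\<eta> = 0\<close> removes this defect.\<close>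
  have C_rho: "N\<rho> x y z w - \<rho> (C x y) z w - \<rho> y (C x z) w - \<rho> y z (C x w) = 3 * \<eta> (J x) * \<rho> (J y) z w" for x y z w
    unfolding K_rho[symmetric] C' by (simp add: rho_simps rho_J)
  have "\<eta> = (\<lambda>x. 0)" if "\<forall>x y z w. 3 * \<eta> (J x) * \<rho> (J y) z w = 0"
  proof
    fix x
    obtain y z w where "\<rho> y z w \<noteq> 0"
      using contraction[of "onb G 0" "onb G 0"] orthonormal_G[OF onb, of 0 0]
      by (metis (no_types, lifting) mult_zero_left one_neq_zero sum.neutral mult_1_right zero_neq_numeral)
    then have "\<rho> (J (- J y)) z w \<noteq> 0" by (simp add: J_simps)
    moreover have "3 * \<eta> (J (- J x)) * \<rho> (J (- J y)) z w = 0" using that by blast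
    ultimately show "\<eta> x = 0" by (simp add: J_simps)
  qed
  then show "(\<forall>x y z w. N\<rho> x y z w - \<rho> (C x y) z w - \<rho> y (C x z) w - \<rho> y z (C x w) = 0)
      \<longleftrightarrow> \<eta> = (\<lambda>x. 0)"
    unfolding C_rho by auto
  \<comment> \<open>\<open>K (u x)\<close> anticommutes with \<open>J\<close>; the derivative of
    \<open>J\<close>, which is \<open>2 *\<^sub>R J (K (u x) y)\<close>, corrects exactly the
    resulting sign in the first slot.\<close>
  show "N\<mu> x y z w - \<rho> (J (C x y)) z w - \<rho> (J y) (C x z) w - \<rho> (J y) z (C x w) = 0" if "\<eta> = (\<lambda>x. 0)"
    unfolding N\<mu> K_rho[symmetric] NJ' C' that by (simp add: K_J rho_simps)
qed

end

section \<open>Differential calculus in charts\<close>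

lemma has_derivative_cong_ev:
  assumes "(f has_derivative f') (at x)" "\<forall>\<^sub>F y in nhds x. g y = f y"
  shows "(g has_derivative f') (at x)"
proof -
  have "\<forall>\<^sub>F y in at x. f y = g y"
    using assms(2) unfolding eventually_at_filter by (rule eventually_mono) simp
  then show ?thesis
    using has_derivative_transform_eventually[OF assms(1)] eventually_nhds_x_imp_x[OF assms(2)] by simp
qed

lemma differentiable_cong_ev:
  assumes "f differentiable (at x)" "\<forall>\<^sub>F y in nhds x. g y = f y"
  shows "g differentiable (at x)"
  using assms has_derivative_cong_ev unfolding differentiable_def by blast

lemma frechet_derivative_eq: "(f has_derivative f') (at x) \<Longrightarrow> frechet_derivative f (at x) = f'"
  by (rule frechet_derivative_at[symmetric])

lemma smooth_on_differentiable:
  assumes "smooth_on S f" "open S" "x \<in> S"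
  shows "f differentiable (at x)"
proof -
  have "f differentiable_on S"
    using assms(1) unfolding smooth_on_def by (metis ck_on.simps(2))
  then show ?thesis
    using assms(2,3) by (metis at_within_open differentiable_on_def)
qed

lemma smooth_on_has_derivative:
  assumes "smooth_on S f" "open S" "x \<in> S"
  shows "(f has_derivative frechet_derivative f (at x)) (at x)"
  using smooth_on_differentiable[OF assms] by (simp add: frechet_derivative_works)

lemma smooth_on_deriv:
  assumes "smooth_on S f"
  shows "smooth_on S (\<lambda>x. frechet_derivative f (at x) v)"
  using assms unfolding smooth_on_def by (metis ck_on.simps(2))

text \<open>Mean value theorem along \<open>v\<close>, applied to the difference of \<open>g\<close>
  on two parallel segments a step \<open>w\<close> apart. Differentiability of \<open>g' u v\<close>
  at the single point \<open>x\<close> then controls the error.\<close>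

lemma second_difference:
  fixes g :: "'a::real_normed_vector \<Rightarrow> real"
  assumes S: "open S" "x \<in> S" and g: "\<And>u. u \<in> S \<Longrightarrow> (g has_derivative g' u) (at u)"
    and H: "((\<lambda>u. g' u v) has_derivative H) (at x)" and \<epsilon>: "\<epsilon> > 0"
  shows "\<exists>\<delta>>0. \<forall>t. 0 < t \<and> t < \<delta> \<longrightarrow>
    \<bar>g (x + t *\<^sub>R v + t *\<^sub>R w) - g (x + t *\<^sub>R v) - g (x + t *\<^sub>R w) + g x - t\<^sup>2 * H w\<bar> \<le> \<epsilon> * t\<^sup>2"
proof -
  \<comment> \<open>\<open>t * M\<close> bounds the distance to \<open>x\<close> on the whole
    parallelogram; the summand 1 keeps \<open>M\<close> positive even if \<open>v\<close> and
    \<open>w\<close> vanish.\<close>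
  define M where "M = norm v + norm w + 1"
  have M: "M > 0" by (simp add: M_def add_nonneg_pos)
  obtain r where r: "r > 0" "ball x r \<subseteq> S"
    using S open_contains_ball by blast
  have linH: "linear H" using H has_derivative_linear by blast
  have "\<forall>e>0. \<exists>d>0. \<forall>y. norm (y - x) < d \<longrightarrow> norm (g' y v - g' x v - H (y - x)) \<le> e * norm (y - x)"
    using H by (simp add: has_derivative_at_alt)
  moreover have "\<epsilon> / (2 * M) > 0" using \<epsilon> M by simp
  ultimately obtain d where d: "d > 0"
    "\<And>y. norm (y - x) < d \<Longrightarrow> norm (g' y v - g' x v - H (y - x)) \<le> \<epsilon> / (2 * M) * norm (y - x)"
    by blast
  define \<delta> where "\<delta> = min r d / M"
  have "\<delta> > 0" using r d M by (simp add: \<delta>_def)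
  moreover have "\<bar>g (x + t *\<^sub>R v + t *\<^sub>R w) - g (x + t *\<^sub>R v) - g (x + t *\<^sub>R w) + g x - t\<^sup>2 * H w\<bar> \<le> \<epsilon> * t\<^sup>2"
    if t: "0 < t" "t < \<delta>" for t
  proof -
    have tM: "t * M < r" "t * M < d"
      using t M by (simp_all add: \<delta>_def pos_less_divide_eq)
    have nb: "norm (s *\<^sub>R (t *\<^sub>R v) + b *\<^sub>R (t *\<^sub>R w)) \<le> t * M"
      if "0 \<le> s" "s \<le> 1" "0 \<le> b" "b \<le> 1" for s b
    proof -
      have "norm (s *\<^sub>R (t *\<^sub>R v) + b *\<^sub>R (t *\<^sub>R w)) \<le> s * (t * norm v) + b * (t * norm w)"
        using that t by (intro order_trans[OF norm_triangle_ineq]) simp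
      also have "\<dots> \<le> 1 * (t * norm v) + 1 * (t * norm w)"
        using that t by (intro add_mono mult_right_mono) auto
      also have "\<dots> \<le> t * M" using t by (simp add: M_def algebra_simps)
      finally show ?thesis .
    qed
    define y where "y b s = x + (s *\<^sub>R (t *\<^sub>R v) + b *\<^sub>R (t *\<^sub>R w))" for b s :: real
    have yS: "y b s \<in> S" if "0 \<le> s" "s \<le> 1" "0 \<le> b" "b \<le> 1" for s b
      using nb[OF that] tM r(2) by (auto simp: y_def dist_norm subset_iff norm_minus_commute)
    have dy: "((\<lambda>s. g (y b s)) has_derivative (\<lambda>h. g' (y b s) (h *\<^sub>R (t *\<^sub>R v)))) (at s within {0..1})"
      if "0 \<le> s" "s \<le> 1" "0 \<le> b" "b \<le> 1" for s b
    proof -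
      have "(y b has_derivative (\<lambda>h. h *\<^sub>R (t *\<^sub>R v))) (at s within {0..1})"
        unfolding y_def by (auto intro!: derivative_eq_intros)
      from has_derivative_compose[OF this, OF g[OF yS[OF that]]] show ?thesis .
    qed
    have "\<exists>s\<in>{0<..<1}. (g (y 1 1) - g (y 0 1)) - (g (y 1 0) - g (y 0 0)) =
        g' (y 1 s) ((1 - 0) *\<^sub>R (t *\<^sub>R v)) - g' (y 0 s) ((1 - 0) *\<^sub>R (t *\<^sub>R v))"
      by (rule mvt_simple, simp, intro has_derivative_diff dy) simp_all
    then obtain s where s: "0 < s" "s < 1"
      and eq: "(g (y 1 1) - g (y 0 1)) - (g (y 1 0) - g (y 0 0)) = g' (y 1 s) (t *\<^sub>R v) - g' (y 0 s) (t *\<^sub>R v)"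
      by auto
    have lin: "g' u (t *\<^sub>R v) = t * g' u v" if "u \<in> S" for u
      using has_derivative_linear[OF g[OF that]] by (simp add: linear_cmul)
    have b: "\<bar>g' (y b s) v - g' x v - H (y b s - x)\<bar> \<le> \<epsilon> / 2 * t" if "0 \<le> b" "b \<le> 1" for b
    proof -
      have n: "norm (y b s - x) \<le> t * M" using nb[of s b] s that by (simp add: y_def)
      then have "\<bar>g' (y b s) v - g' x v - H (y b s - x)\<bar> \<le> \<epsilon> / (2 * M) * norm (y b s - x)"
        using d(2)[of "y b s"] tM by simp
      also have "\<dots> \<le> \<epsilon> / (2 * M) * (t * M)"
        using n \<epsilon> M by (intro mult_left_mono) auto
      finally show ?thesis using M by simp
    qed
    have "H (y 1 s - x) - H (y 0 s - x) = t * H w"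
      using linH by (simp add: y_def linear_add linear_cmul)
    then have "\<bar>(g' (y 1 s) v - g' (y 0 s) v) - t * H w\<bar> \<le> \<epsilon> * t"
      using b[of 0] b[of 1] by (simp add: abs_if split: if_splits)
    then have "t * \<bar>(g' (y 1 s) v - g' (y 0 s) v) - t * H w\<bar> \<le> t * (\<epsilon> * t)"
      using t by (intro mult_left_mono) auto
    moreover have "t * \<bar>(g' (y 1 s) v - g' (y 0 s) v) - t * H w\<bar>
        = \<bar>(g (y 1 1) - g (y 0 1)) - (g (y 1 0) - g (y 0 0)) - t\<^sup>2 * H w\<bar>"
    proof -
      have "y 1 s \<in> S" "y 0 s \<in> S" using s by (simp_all add: yS)
      then have "(g (y 1 1) - g (y 0 1)) - (g (y 1 0) - g (y 0 0)) - t\<^sup>2 * H w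
          = t * ((g' (y 1 s) v - g' (y 0 s) v) - t * H w)"
        unfolding eq by (simp add: lin power2_eq_square algebra_simps)
      then show ?thesis using t by (simp only: abs_mult abs_of_pos)
    qed
    ultimately show ?thesis
      by (simp add: y_def power2_eq_square algebra_simps)
  qed
  ultimately show ?thesis by blast
qed

text \<open>The second difference is symmetric in \<open>v\<close> and \<open>w\<close>, and both
  \<open>t\<^sup>2 * H w\<close> and \<open>t\<^sup>2 * K v\<close> approximate it to an order
  better than \<open>t\<^sup>2\<close>.\<close>

lemma second_derivative_symmetric_real:
  fixes g :: "'a::real_normed_vector \<Rightarrow> real"
  assumes S: "open S" "x \<in> S" and g: "\<And>u. u \<in> S \<Longrightarrow> (g has_derivative g' u) (at u)"
    and H: "((\<lambda>u. g' u v) has_derivative H) (at x)" and K: "((\<lambda>u. g' u w) has_derivative K) (at x)"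
  shows "H w = K v"
proof (rule ccontr)
  assume ne: "H w \<noteq> K v"
  define \<epsilon> where "\<epsilon> = \<bar>H w - K v\<bar> / 3"
  have \<epsilon>: "\<epsilon> > 0" using ne by (simp add: \<epsilon>_def)
  obtain d1 where d1: "d1 > 0" "\<And>t. 0 < t \<and> t < d1 \<Longrightarrow>
    \<bar>g (x + t *\<^sub>R v + t *\<^sub>R w) - g (x + t *\<^sub>R v) - g (x + t *\<^sub>R w) + g x - t\<^sup>2 * H w\<bar> \<le> \<epsilon> * t\<^sup>2"
    using second_difference[OF S g H \<epsilon>] by blast
  obtain d2 where d2: "d2 > 0" "\<And>t. 0 < t \<and> t < d2 \<Longrightarrow>
    \<bar>g (x + t *\<^sub>R w + t *\<^sub>R v) - g (x + t *\<^sub>R w) - g (x + t *\<^sub>R v) + g x - t\<^sup>2 * K v\<bar> \<le> \<epsilon> * t\<^sup>2"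
    using second_difference[OF S g K \<epsilon>] by blast
  define t where "t = min d1 d2 / 2"
  have t: "0 < t" "t < d1" "t < d2" using d1 d2 by (auto simp: t_def)
  have "\<bar>t\<^sup>2 * H w - t\<^sup>2 * K v\<bar> \<le> 2 * (\<epsilon> * t\<^sup>2)"
    using d1(2)[of t] d2(2)[of t] t by (simp add: add_ac)
  moreover have "\<bar>t\<^sup>2 * H w - t\<^sup>2 * K v\<bar> = t\<^sup>2 * \<bar>H w - K v\<bar>"
    by (simp only: right_diff_distrib[symmetric] abs_mult) simp
  ultimately have "t\<^sup>2 * \<bar>H w - K v\<bar> \<le> t\<^sup>2 * (2 * \<epsilon>)" by (simp add: mult.commute)
  then have "\<bar>H w - K v\<bar> \<le> 2 * \<epsilon>"
    using t(1) by (simp add: mult_le_cancel_left_pos)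
  then show False using \<epsilon> by (simp add: \<epsilon>_def)
qed

lemma second_derivative_symmetric:
  fixes f :: "'a::euclidean_space \<Rightarrow> 'b::euclidean_space"
  assumes f: "smooth_on S f" and S: "open S" "x \<in> S"
  shows "frechet_derivative (\<lambda>u. frechet_derivative f (at u) v) (at x) w =
    frechet_derivative (\<lambda>u. frechet_derivative f (at u) w) (at x) v"
proof (rule euclidean_eqI)
  fix b :: 'b
  have "((\<lambda>u. f u \<bullet> b) has_derivative (\<lambda>h. frechet_derivative f (at u) h \<bullet> b)) (at u)" if "u \<in> S" for u
    by (intro has_derivative_inner_left smooth_on_has_derivative[OF f S(1) that])
  note 1 = this
  have 2: "((\<lambda>u. frechet_derivative f (at u) v \<bullet> b) has_derivative
      (\<lambda>h. frechet_derivative (\<lambda>u. frechet_derivative f (at u) v) (at x) h \<bullet> b)) (at x)" for v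
    by (intro has_derivative_inner_left smooth_on_has_derivative[OF smooth_on_deriv[OF f] S])
  show "frechet_derivative (\<lambda>u. frechet_derivative f (at u) v) (at x) w \<bullet> b =
    frechet_derivative (\<lambda>u. frechet_derivative f (at u) w) (at x) v \<bullet> b"
    by (rule second_derivative_symmetric_real[OF S 1 2 2])
qed

section \<open>Product rules for tensor fields in coordinates\<close>

lemma trilinear_axis_expand:
  fixes a :: "(real ^ 'n::finite) form3"
  assumes "trilinear a"
  shows "a x y z = (\<Sum>i\<in>UNIV. \<Sum>j\<in>UNIV. \<Sum>k\<in>UNIV. x $ i * (y $ j * (z $ k * a (axis i 1) (axis j 1) (axis k 1))))"
proof -
  have e: "w = (\<Sum>i\<in>UNIV. w $ i *\<^sub>R axis i 1)" for w :: "real ^ 'n"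
    using basis_expansion[of w] by (simp add: scalar_mult_eq_scaleR)
  have 1: "a x y z = (\<Sum>i\<in>UNIV. x $ i * a (axis i 1) y z)" for x y z
    using arg_cong[OF e[of x], of "\<lambda>x. a x y z"] by (simp add: trilinear_simps[OF assms])
  have 2: "a x y z = (\<Sum>i\<in>UNIV. y $ i * a x (axis i 1) z)" for x y z
    using arg_cong[OF e[of y], of "\<lambda>y. a x y z"] by (simp add: trilinear_simps[OF assms])
  have 3: "a x y z = (\<Sum>i\<in>UNIV. z $ i * a x y (axis i 1))" for x y z
    using arg_cong[OF e[of z], of "\<lambda>z. a x y z"] by (simp add: trilinear_simps[OF assms])
  show ?thesis
    by (simp only: 1[of x y z] 2[of "axis _ 1" y z] 3[of "axis _ 1" "axis _ 1" z] sum_distrib_left)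
qed

text \<open>\<open>T\<close> is differentiated with its arguments held fixed, so the arguments are
  expanded in the standard basis and the product rule is applied to coefficients. Trilinearity is
  asked for near \<open>F u\<close> only, since chart extensions are linear only over the chart
  domain.\<close>

lemma has_derivative_trilinear_field:
  fixes T :: "real ^ 'b::finite \<Rightarrow> (real ^ 'b) form3" and F :: "real ^ 'a::finite \<Rightarrow> real ^ 'b"
  assumes F: "(F has_derivative F') (at u)"
    and T: "\<And>x y z. ((\<lambda>v. T v x y z) has_derivative (\<lambda>w. T' w x y z)) (at (F u))"
    and tri: "\<forall>\<^sub>F v in nhds (F u). trilinear (T v)"
    and X: "(X has_derivative X') (at u)" and Y: "(Y has_derivative Y') (at u)" and Z: "(Z has_derivative Z') (at u)"
  shows "((\<lambda>s. T (F s) (X s) (Y s) (Z s)) has_derivative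
    (\<lambda>w. T' (F' w) (X u) (Y u) (Z u) + T (F u) (X' w) (Y u) (Z u) + T (F u) (X u) (Y' w) (Z u)
      + T (F u) (X u) (Y u) (Z' w))) (at u)"
proof -
  let ?t = "\<lambda>i j k. (axis i 1, axis j 1, axis k 1)"
  have Tu: "trilinear (T (F u))" using tri by (rule eventually_nhds_x_imp_x)
  have T'_expand: "T' w x y z = (\<Sum>i\<in>UNIV. \<Sum>j\<in>UNIV. \<Sum>k\<in>UNIV. x $ i * (y $ j * (z $ k * T' w (axis i 1) (axis j 1) (axis k 1))))" for w x y z
  proof -
    have "((\<lambda>v. \<Sum>i\<in>UNIV. \<Sum>j\<in>UNIV. \<Sum>k\<in>UNIV. x $ i * (y $ j * (z $ k * T v (axis i 1) (axis j 1) (axis k 1)))) has_derivative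
      (\<lambda>w. \<Sum>i\<in>UNIV. \<Sum>j\<in>UNIV. \<Sum>k\<in>UNIV. x $ i * (y $ j * (z $ k * T' w (axis i 1) (axis j 1) (axis k 1))))) (at (F u))"
      by (intro has_derivative_sum has_derivative_mult_right T)
    then have "((\<lambda>v. T v x y z) has_derivative
      (\<lambda>w. \<Sum>i\<in>UNIV. \<Sum>j\<in>UNIV. \<Sum>k\<in>UNIV. x $ i * (y $ j * (z $ k * T' w (axis i 1) (axis j 1) (axis k 1))))) (at (F u))"
      by (rule has_derivative_cong_ev) (use tri in eventually_elim, rule trilinear_axis_expand)
    from fun_cong[OF has_derivative_unique[OF this T], of w] show ?thesis by (rule sym)
  qed
  have nth: "((\<lambda>s. V s $ i) has_derivative (\<lambda>w. V' w $ i)) (at u)" if "(V has_derivative V') (at u)" for V V' i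
    using bounded_linear.has_derivative[OF bounded_linear_vec_nth that] .
  have TF: "((\<lambda>s. T (F s) x y z) has_derivative (\<lambda>w. T' (F' w) x y z)) (at u)" for x y z
    using has_derivative_compose[OF F T] .
  have "((\<lambda>s. \<Sum>i\<in>UNIV. \<Sum>j\<in>UNIV. \<Sum>k\<in>UNIV. X s $ i * (Y s $ j * (Z s $ k * T (F s) (axis i 1) (axis j 1) (axis k 1)))) has_derivative
      (\<lambda>w. \<Sum>i\<in>UNIV. \<Sum>j\<in>UNIV. \<Sum>k\<in>UNIV.
        X u $ i * (Y u $ j * (Z u $ k * T' (F' w) (axis i 1) (axis j 1) (axis k 1) + Z' w $ k * T (F u) (axis i 1) (axis j 1) (axis k 1))
          + Y' w $ j * (Z u $ k * T (F u) (axis i 1) (axis j 1) (axis k 1)))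
        + X' w $ i * (Y u $ j * (Z u $ k * T (F u) (axis i 1) (axis j 1) (axis k 1))))) (at u)"
    by (intro has_derivative_sum has_derivative_mult nth X Y Z TF)
  then have "((\<lambda>s. T (F s) (X s) (Y s) (Z s)) has_derivative
      (\<lambda>w. \<Sum>i\<in>UNIV. \<Sum>j\<in>UNIV. \<Sum>k\<in>UNIV.
        X u $ i * (Y u $ j * (Z u $ k * T' (F' w) (axis i 1) (axis j 1) (axis k 1) + Z' w $ k * T (F u) (axis i 1) (axis j 1) (axis k 1))
          + Y' w $ j * (Z u $ k * T (F u) (axis i 1) (axis j 1) (axis k 1)))
        + X' w $ i * (Y u $ j * (Z u $ k * T (F u) (axis i 1) (axis j 1) (axis k 1))))) (at u)"
  proof (rule has_derivative_cong_ev)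
    have "filterlim F (nhds (F u)) (nhds u)"
      using has_derivative_continuous[OF F] by (simp add: continuous_at tendsto_at_iff_tendsto_nhds)
    from eventually_compose_filterlim[OF tri this]
    show "\<forall>\<^sub>F s in nhds u. T (F s) (X s) (Y s) (Z s) = (\<Sum>i\<in>UNIV. \<Sum>j\<in>UNIV. \<Sum>k\<in>UNIV. X s $ i * (Y s $ j * (Z s $ k * T (F s) (axis i 1) (axis j 1) (axis k 1))))"
      by eventually_elim (rule trilinear_axis_expand)
  qed
  moreover have "(\<lambda>w. \<Sum>i\<in>UNIV. \<Sum>j\<in>UNIV. \<Sum>k\<in>UNIV.
        X u $ i * (Y u $ j * (Z u $ k * T' (F' w) (axis i 1) (axis j 1) (axis k 1) + Z' w $ k * T (F u) (axis i 1) (axis j 1) (axis k 1))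
          + Y' w $ j * (Z u $ k * T (F u) (axis i 1) (axis j 1) (axis k 1)))
        + X' w $ i * (Y u $ j * (Z u $ k * T (F u) (axis i 1) (axis j 1) (axis k 1)))) =
    (\<lambda>w. T' (F' w) (X u) (Y u) (Z u) + T (F u) (X' w) (Y u) (Z u) + T (F u) (X u) (Y' w) (Z u)
      + T (F u) (X u) (Y u) (Z' w))"
    unfolding T'_expand[of _ "X u" "Y u" "Z u"] trilinear_axis_expand[OF Tu, of "X' _" "Y u" "Z u"]
      trilinear_axis_expand[OF Tu, of "X u" "Y' _" "Z u"] trilinear_axis_expand[OF Tu, of "X u" "Y u" "Z' _"]
    by (simp only: distrib_left sum.distrib[symmetric] add_ac)
  ultimately show ?thesis by simp
qed

text \<open>The trilinear rule with a constant dummy third argument whose component \<open>k\<close>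
  is 1.\<close>

lemma has_derivative_bilinear_field:
  fixes T :: "real ^ 'b::finite \<Rightarrow> (real ^ 'b) form2" and F :: "real ^ 'a::finite \<Rightarrow> real ^ 'b"
  assumes F: "(F has_derivative F') (at u)"
    and T: "\<And>x y. ((\<lambda>v. T v x y) has_derivative (\<lambda>w. T' w x y)) (at (F u))"
    and bil: "\<forall>\<^sub>F v in nhds (F u). bilinear (T v)"
    and X: "(X has_derivative X') (at u)" and Y: "(Y has_derivative Y') (at u)"
  shows "((\<lambda>s. T (F s) (X s) (Y s)) has_derivative
    (\<lambda>w. T' (F' w) (X u) (Y u) + T (F u) (X' w) (Y u) + T (F u) (X u) (Y' w))) (at u)"
proof -
  fix k :: 'b
  let ?T = "\<lambda>v x y z. T v x y * z $ k" and ?T' = "\<lambda>w x y z. T' w x y * z $ k"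
  have "((\<lambda>s. ?T (F s) (X s) (Y s) (axis k 1)) has_derivative
    (\<lambda>w. ?T' (F' w) (X u) (Y u) (axis k 1) + ?T (F u) (X' w) (Y u) (axis k 1) + ?T (F u) (X u) (Y' w) (axis k 1)
      + ?T (F u) (X u) (Y u) 0)) (at u)"
  proof (rule has_derivative_trilinear_field[OF F _ _ X Y has_derivative_const])
    show "((\<lambda>v. T v x y * z $ k) has_derivative (\<lambda>w. T' w x y * z $ k)) (at (F u))" for x y and z :: "real ^ 'b"
      by (rule has_derivative_mult_left[OF T])
    show "\<forall>\<^sub>F v in nhds (F u). trilinear (?T v)"
      using bil
    proof eventually_elim
      case (elim v)
      then show ?case
        unfolding trilinear_def
        by (intro conjI allI linearI) (simp_all add: bilinear_form_simps algebra_simps)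
    qed
  qed
  then show ?thesis by simp
qed

section \<open>Regularity of solutions of linear systems\<close>

lemma differentiable_det:
  fixes M :: "'a::real_normed_vector \<Rightarrow> real ^ 'n::finite ^ 'n"
  assumes "\<And>i j. (\<lambda>u. M u $ i $ j) differentiable (at x)"
  shows "(\<lambda>u. det (M u)) differentiable (at x)"
proof -
  have "(\<lambda>u. \<Prod>i\<in>I. M u $ i $ p i) differentiable (at x)" if "finite I" for I p
    using that by (induction I) (simp_all add: assms differentiable_mult)
  then show ?thesis
    unfolding det_def by (intro differentiable_sum differentiable_mult) simp_all
qed

text \<open>By Cramer's rule, the solution of a linear system depends differentiably on the system.\<close>

lemma differentiable_linear_system:
  fixes M :: "'a::real_normed_vector \<Rightarrow> real ^ 'n::finite ^ 'n" and X b :: "'a \<Rightarrow> real ^ 'n"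
  assumes M: "\<And>i j. (\<lambda>u. M u $ i $ j) differentiable (at x)" and b: "\<And>i. (\<lambda>u. b u $ i) differentiable (at x)"
    and ev: "\<forall>\<^sub>F u in nhds x. det (M u) \<noteq> 0 \<and> M u *v X u = b u"
  shows "X differentiable (at x)"
proof -
  have "(\<lambda>u. det (\<chi> i j. if j = k then b u $ i else M u $ i $ j) / det (M u)) differentiable (at x)" for k
  proof (rule differentiable_divide)
    show "(\<lambda>u. det (\<chi> i j. if j = k then b u $ i else M u $ i $ j)) differentiable (at x)"
    proof (rule differentiable_det)
      fix i j
      show "(\<lambda>u. (\<chi> i j. if j = k then b u $ i else M u $ i $ j) $ i $ j) differentiable (at x)"
        by (cases "j = k") (simp_all add: M b)
    qed
    show "(\<lambda>u. det (M u)) differentiable (at x)" by (rule differentiable_det) (rule M)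
    show "det (M x) \<noteq> 0" using eventually_nhds_x_imp_x[OF ev] by simp
  qed
  moreover have "\<forall>\<^sub>F u in nhds x. X u $ k = det (\<chi> i j. if j = k then b u $ i else M u $ i $ j) / det (M u)" for k
    using ev
  proof eventually_elim
    case (elim u)
    then have "X u = (\<chi> k. det (\<chi> i j. if j = k then b u $ i else M u $ i $ j) / det (M u))"
      using cramer[of "M u" "X u" "b u"] by blast
    then show ?case by (metis (no_types, lifting) vec_lambda_beta)
  qed
  ultimately have "(\<lambda>u. X u $ k) differentiable (at x)" for k
    by (rule differentiable_cong_ev)
  then have *: "(\<lambda>u. \<Sum>k\<in>UNIV. X u $ k *\<^sub>R axis k 1) differentiable (at x)"
    by (intro differentiable_sum differentiable_scaleR) simp_all
  have "X u = (\<Sum>k\<in>UNIV. X u $ k *\<^sub>R axis k 1)" for u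
    using basis_expansion[of "X u"] by (simp add: scalar_mult_eq_scaleR)
  then show ?thesis by (intro differentiable_cong_ev[OF *] always_eventually allI)
qed

section \<open>Covariant derivatives along maps\<close>

context
  fixes A :: "('m::{t2_space, second_countable_topology}, 'n::finite) chart set"
  assumes atlas: "smooth_atlas A"
begin

lemma chart_at: "chart_at A p \<in> A" "p \<in> fst (chart_at A p)"
proof -
  have "\<exists>c. c \<in> A \<and> p \<in> fst c"
    using atlas unfolding smooth_atlas_def by (metis UNIV_I UN_E)
  then have "chart_at A p \<in> A \<and> p \<in> fst (chart_at A p)"
    unfolding chart_at_def by (rule someI_ex)
  then show "chart_at A p \<in> A" "p \<in> fst (chart_at A p)" by auto
qed

lemma chart_inv_left: "c \<in> A \<Longrightarrow> q \<in> fst c \<Longrightarrow> chart_inv c (snd c q) = q"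
  using atlas unfolding smooth_atlas_def homeomorphism_def by blast

lemma chart_inv_right: "c \<in> A \<Longrightarrow> u \<in> snd c ` fst c \<Longrightarrow> snd c (chart_inv c u) = u"
  by (elim imageE) (simp add: chart_inv_left)

lemma open_chart_image:
  assumes c: "c \<in> A" and W: "open W"
  shows "open (snd c ` (fst c \<inter> W))"
proof -
  have cont: "continuous_on (snd c ` fst c) (chart_inv c)" and op: "open (snd c ` fst c)"
    using atlas c unfolding smooth_atlas_def homeomorphism_def by blast+
  have "snd c ` (fst c \<inter> W) = snd c ` fst c \<inter> chart_inv c -` W"
    using chart_inv_left[OF c] by force
  then show ?thesis
    using continuous_open_preimage[OF cont op W] by simp
qed

lemma eventually_chart:
  assumes c: "c \<in> A" and q: "q \<in> fst c" "q \<in> W" and W: "open W"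
  shows "\<forall>\<^sub>F u in nhds (snd c q). u \<in> snd c ` (fst c \<inter> W)"
  using open_chart_image[OF c W] q by (intro eventually_nhds_in_open) auto

lemma open_chart: "c \<in> A \<Longrightarrow> open (fst c)"
  using atlas unfolding smooth_atlas_def by blast

lemma coord_change_derivative:
  assumes "c \<in> A" "d \<in> A" "q \<in> fst c" "q \<in> fst d"
  shows "((snd d \<circ> chart_inv c) has_derivative coord_change c d q) (at (snd c q))"
proof -
  have "smooth_on (snd c ` (fst c \<inter> fst d)) (snd d \<circ> chart_inv c)"
    using atlas assms unfolding smooth_atlas_def by blast
  then show ?thesis
    unfolding coord_change_def
    using assms open_chart_image[OF assms(1) open_chart[OF assms(2)]]
    by (intro smooth_on_has_derivative) auto
qed

lemma coord_change_linear:
  assumes "c \<in> A" "d \<in> A" "q \<in> fst c" "q \<in> fst d"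
  shows "linear (coord_change c d q)"
  using has_derivative_linear[OF coord_change_derivative[OF assms]] .

lemma coord_change_trans:
  assumes c: "c \<in> A" and d: "d \<in> A" and e: "e \<in> A" and q: "q \<in> fst c" "q \<in> fst d" "q \<in> fst e"
  shows "coord_change d e q (coord_change c d q x) = coord_change c e q x"
proof -
  have q': "(snd d \<circ> chart_inv c) (snd c q) = snd d q" using c q by (simp add: chart_inv_left)
  have "((snd e \<circ> chart_inv d) has_derivative coord_change d e q) (at ((snd d \<circ> chart_inv c) (snd c q)))"
    unfolding q' by (rule coord_change_derivative[OF d e q(2,3)])
  from has_derivative_compose[OF coord_change_derivative[OF c d q(1,2)] this]
  have 1: "((\<lambda>u. (snd e \<circ> chart_inv d) ((snd d \<circ> chart_inv c) u)) has_derivative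
      (\<lambda>x. coord_change d e q (coord_change c d q x))) (at (snd c q))" .
  have "((snd e \<circ> chart_inv c) has_derivative (\<lambda>x. coord_change d e q (coord_change c d q x))) (at (snd c q))"
  proof (rule has_derivative_cong_ev[OF 1])
    show "\<forall>\<^sub>F u in nhds (snd c q). (snd e \<circ> chart_inv c) u = (snd e \<circ> chart_inv d) ((snd d \<circ> chart_inv c) u)"
      using eventually_chart[OF c q(1,2) open_chart[OF d]]
      by eventually_elim (auto simp: chart_inv_left c d)
  qed
  from has_derivative_unique[OF this coord_change_derivative[OF c e q(1,3)]]
  show ?thesis by (rule fun_cong)
qed

lemma coord_change_same:
  assumes c: "c \<in> A" and q: "q \<in> fst c"
  shows "coord_change c c q x = x"
proof -
  have "((snd c \<circ> chart_inv c) has_derivative (\<lambda>x. x)) (at (snd c q))"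
  proof (rule has_derivative_cong_ev[OF has_derivative_ident])
    show "\<forall>\<^sub>F u in nhds (snd c q). (snd c \<circ> chart_inv c) u = u"
      using eventually_chart[OF c q UNIV_I open_UNIV]
      by eventually_elim (auto simp: chart_inv_left c)
  qed
  from has_derivative_unique[OF this coord_change_derivative[OF c c q q]]
  show ?thesis by (metis (no_types))
qed

lemma extend_same: "extend A p x p = x"
  unfolding extend_def by (rule coord_change_same[OF chart_at])

lemma extend_inverse:
  assumes "q \<in> fst (chart_at A p)"
  shows "extend A p (coord_change (chart_at A q) (chart_at A p) q x) q = x"
    "coord_change (chart_at A q) (chart_at A p) q (extend A p x q) = x"
  unfolding extend_def
  by (simp_all add: coord_change_trans[OF chart_at(1) chart_at(1) chart_at(1) chart_at(2) assms chart_at(2)]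
      coord_change_trans[OF chart_at(1) chart_at(1) chart_at(1) assms chart_at(2) assms]
      coord_change_same[OF chart_at] coord_change_same[OF chart_at(1) assms])

lemma extend_linear: "q \<in> fst (chart_at A p) \<Longrightarrow> linear (\<lambda>x. extend A p x q)"
  unfolding extend_def using coord_change_linear[OF chart_at(1) chart_at(1) _ chart_at(2)] by simp

lemma eventually_chart_at:
  assumes "open W" "p \<in> W"
  shows "\<forall>\<^sub>F u in nhds (snd (chart_at A p) p). u \<in> snd (chart_at A p) ` fst (chart_at A p) \<and>
    chart_inv (chart_at A p) u \<in> fst (chart_at A p) \<and> chart_inv (chart_at A p) u \<in> W"
  using eventually_chart[OF chart_at assms(2,1)]
  by eventually_elim (auto simp: chart_inv_left[OF chart_at(1)])

end

section \<open>Pointwise differentiability and Leibniz rules\<close>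

lemma deriv_at_eq:
  assumes "((f \<circ> chart_inv (chart_at A p)) has_derivative D) (at (snd (chart_at A p) p))"
  shows "deriv_at A p f v = D v"
  unfolding deriv_at_def frechet_derivative_eq[OF assms] ..

text \<open>Differentiability at one point instead of smoothness: the Leibniz rules ask for no more,
  and it can be read off from the derivatives computed for the induced metric, \<open>\<rho>\<close>
  and \<open>I\<close>.\<close>

definition tensor2_diff_at ::
    "('m, 'n::finite) chart set \<Rightarrow> 'm \<Rightarrow> ('m \<Rightarrow> (real ^ 'n) form2) \<Rightarrow> bool" where
  "tensor2_diff_at A p T \<longleftrightarrow> (\<forall>x y. ((\<lambda>q. T q (extend A p x q) (extend A p y q))
     \<circ> chart_inv (chart_at A p)) differentiable (at (snd (chart_at A p) p)))"

definition tensor3_diff_at ::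
    "('m, 'n::finite) chart set \<Rightarrow> 'm \<Rightarrow> ('m \<Rightarrow> (real ^ 'n) form3) \<Rightarrow> bool" where
  "tensor3_diff_at A p T \<longleftrightarrow> (\<forall>x y z. ((\<lambda>q. T q (extend A p x q) (extend A p y q) (extend A p z q))
     \<circ> chart_inv (chart_at A p)) differentiable (at (snd (chart_at A p) p)))"

definition along_diff_at ::
    "('m, 'a::finite) chart set \<Rightarrow> ('n, 'b::finite) chart set \<Rightarrow> ('m \<Rightarrow> 'n) \<Rightarrow> 'm \<Rightarrow> ('m \<Rightarrow> real ^ 'b) \<Rightarrow> bool" where
  "along_diff_at A B f p V \<longleftrightarrow>
     ((\<lambda>q. coord_change (chart_at B (f q)) (chart_at B (f p)) (f q) (V q)) \<circ> chart_inv (chart_at A p))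
       differentiable (at (snd (chart_at A p) p))"

locale smooth_map_between =
  fixes A :: "('m::{t2_space, second_countable_topology}, 'a::finite) chart set"
    and B :: "('n::{t2_space, second_countable_topology}, 'b::finite) chart set"
    and f :: "'m \<Rightarrow> 'n"
  assumes A: "smooth_atlas A" and B: "smooth_atlas B" and f: "smooth_map A B f"
begin

lemma open_preimage: "open W \<Longrightarrow> open (f -` W)"
  using f unfolding smooth_map_def by (metis Int_UNIV_right continuous_on_open_vimage open_UNIV)

lemma smooth_local:
  assumes "c \<in> A" "d \<in> B"
  shows "smooth_on (snd c ` (fst c \<inter> f -` fst d)) (snd d \<circ> f \<circ> chart_inv c)"
    "open (snd c ` (fst c \<inter> f -` fst d))"
  using f assms open_chart_image[OF A assms(1) open_preimage[OF open_chart[OF B assms(2)]]]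
  unfolding smooth_map_def by blast+

lemma local_derivative:
  assumes "c \<in> A" "d \<in> B" "q \<in> fst c" "f q \<in> fst d"
  shows "((snd d \<circ> f \<circ> chart_inv c) has_derivative
    frechet_derivative (snd d \<circ> f \<circ> chart_inv c) (at (snd c q))) (at (snd c q))"
  using assms by (intro smooth_on_has_derivative[OF smooth_local]) auto

lemma differential_derivative:
  "((snd (chart_at B (f p)) \<circ> f \<circ> chart_inv (chart_at A p)) has_derivative differential A B f p) (at (snd (chart_at A p) p))"
  unfolding differential_def by (rule local_derivative[OF chart_at(1)[OF A] chart_at(1)[OF B] chart_at(2)[OF A] chart_at(2)[OF B]])

lemma differential_linear: "linear (differential A B f p)"
  by (rule has_derivative_linear[OF differential_derivative])

text \<open>The singled-out charts at \<open>q\<close> and \<open>f q\<close> may jump as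
  \<open>q\<close> moves. The chain rule replaces them by fixed charts \<open>c\<close> and
  \<open>d\<close>, in which the differential is an ordinary derivative.\<close>

lemma differential_local:
  assumes c: "c \<in> A" and d: "d \<in> B" and q: "q \<in> fst c" "f q \<in> fst d"
  shows "coord_change (chart_at B (f q)) d (f q) (differential A B f q (coord_change c (chart_at A q) q x))
    = frechet_derivative (snd d \<circ> f \<circ> chart_inv c) (at (snd c q)) x"
proof -
  let ?a = "chart_at A q" and ?b = "chart_at B (f q)"
  have a: "?a \<in> A" "q \<in> fst ?a" and b: "?b \<in> B" "f q \<in> fst ?b"
    by (rule chart_at[OF A] chart_at[OF B])+
  have 1: "((\<lambda>u. (snd ?b \<circ> f \<circ> chart_inv ?a) ((snd ?a \<circ> chart_inv c) u)) has_derivative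
      (\<lambda>x. differential A B f q (coord_change c ?a q x))) (at (snd c q))"
  proof (rule has_derivative_compose[OF coord_change_derivative[OF A c a(1) q(1) a(2)]])
    have "(snd ?a \<circ> chart_inv c) (snd c q) = snd ?a q" using c q by (simp add: chart_inv_left[OF A])
    then show "((snd ?b \<circ> f \<circ> chart_inv ?a) has_derivative differential A B f q) (at ((snd ?a \<circ> chart_inv c) (snd c q)))"
      using differential_derivative by simp
  qed
  have 2: "((\<lambda>u. (snd d \<circ> chart_inv ?b) ((snd ?b \<circ> f \<circ> chart_inv ?a) ((snd ?a \<circ> chart_inv c) u))) has_derivative
      (\<lambda>x. coord_change ?b d (f q) (differential A B f q (coord_change c ?a q x)))) (at (snd c q))"
  proof (rule has_derivative_compose[OF 1])
    have "(snd ?b \<circ> f \<circ> chart_inv ?a) ((snd ?a \<circ> chart_inv c) (snd c q)) = snd ?b (f q)"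
      using c q a by (simp add: chart_inv_left[OF A])
    then show "((snd d \<circ> chart_inv ?b) has_derivative coord_change ?b d (f q))
        (at ((snd ?b \<circ> f \<circ> chart_inv ?a) ((snd ?a \<circ> chart_inv c) (snd c q))))"
      using coord_change_derivative[OF B b(1) d b(2) q(2)] by simp
  qed
  have "((snd d \<circ> f \<circ> chart_inv c) has_derivative
      (\<lambda>x. coord_change ?b d (f q) (differential A B f q (coord_change c ?a q x)))) (at (snd c q))"
  proof (rule has_derivative_cong_ev[OF 2])
    have "open (fst ?a \<inter> f -` fst ?b)"
      using open_chart[OF A a(1)] open_preimage[OF open_chart[OF B b(1)]] by blast
    from eventually_chart[OF A c q(1) _ this]
    have "\<forall>\<^sub>F u in nhds (snd c q). u \<in> snd c ` (fst c \<inter> (fst ?a \<inter> f -` fst ?b))"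
      using a b by simp
    then show "\<forall>\<^sub>F u in nhds (snd c q). (snd d \<circ> f \<circ> chart_inv c) u =
        (snd d \<circ> chart_inv ?b) ((snd ?b \<circ> f \<circ> chart_inv ?a) ((snd ?a \<circ> chart_inv c) u))"
      by eventually_elim (auto simp: chart_inv_left[OF A] chart_inv_left[OF B] a b c)
  qed
  from has_derivative_unique[OF local_derivative[OF c d q] this]
  show ?thesis by (simp add: fun_eq_iff)
qed

lemma smooth_along_diff_at:
  assumes "smooth_along A B f U V" "open U" "p \<in> U"
  shows "along_diff_at A B f p V"
proof -
  have "open (U \<inter> f -` fst (chart_at B (f p)))"
    using assms(2) open_preimage[OF open_chart[OF B chart_at(1)[OF B]]] by blast
  from open_chart_image[OF A chart_at(1)[OF A] this]
  have "open (snd (chart_at A p) ` (fst (chart_at A p) \<inter> U \<inter> f -` fst (chart_at B (f p))))"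
    by (simp add: Int_assoc)
  moreover have "smooth_on (snd (chart_at A p) ` (fst (chart_at A p) \<inter> U \<inter> f -` fst (chart_at B (f p))))
      ((\<lambda>q. coord_change (chart_at B (f q)) (chart_at B (f p)) (f q) (V q)) \<circ> chart_inv (chart_at A p))"
    using assms(1) chart_at(1)[OF A] chart_at(1)[OF B] unfolding smooth_along_def by blast
  ultimately show ?thesis
    unfolding along_diff_at_def using assms(3) chart_at(2)[OF A] chart_at(2)[OF B]
    by (intro smooth_on_differentiable) auto
qed

lemma along_derivative:
  assumes "along_diff_at A B f p V"
  shows "(((\<lambda>q. coord_change (chart_at B (f q)) (chart_at B (f p)) (f q) (V q)) \<circ> chart_inv (chart_at A p))
    has_derivative (\<lambda>w. nabla_along A B g f V p w - christoffel B g (f p) (differential A B f p w) (V p)))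
      (at (snd (chart_at A p) p))"
proof -
  have "deriv_at A p (\<lambda>q. coord_change (chart_at B (f q)) (chart_at B (f p)) (f q) (V q)) =
    frechet_derivative ((\<lambda>q. coord_change (chart_at B (f q)) (chart_at B (f p)) (f q) (V q)) \<circ> chart_inv (chart_at A p))
      (at (snd (chart_at A p) p))"
    unfolding deriv_at_def ..
  then show ?thesis
    using assms unfolding along_diff_at_def nabla_along_def by (simp add: frechet_derivative_works)
qed

text \<open>No property of the Christoffel symbols enters: they cancel.\<close>

lemma leibniz3:
  assumes T: "tensor3_diff_at B (f p) T" "\<And>q. trilinear (T q)"
    and V: "along_diff_at A B f p V1" "along_diff_at A B f p V2" "along_diff_at A B f p V3"
  shows "((\<lambda>q. T (f q) (V1 q) (V2 q) (V3 q)) \<circ> chart_inv (chart_at A p) has_derivative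
    (\<lambda>w. nabla3 B g T (f p) (differential A B f p w) (V1 p) (V2 p) (V3 p)
      + T (f p) (nabla_along A B g f V1 p w) (V2 p) (V3 p)
      + T (f p) (V1 p) (nabla_along A B g f V2 p w) (V3 p)
      + T (f p) (V1 p) (V2 p) (nabla_along A B g f V3 p w))) (at (snd (chart_at A p) p))"
proof -
  let ?c = "chart_at A p" and ?d = "chart_at B (f p)"
  let ?F = "snd ?d \<circ> f \<circ> chart_inv ?c"
  let ?T = "\<lambda>v x y z. T (chart_inv ?d v) (extend B (f p) x (chart_inv ?d v)) (extend B (f p) y (chart_inv ?d v)) (extend B (f p) z (chart_inv ?d v))"
  let ?V = "\<lambda>V u. coord_change (chart_at B (f (chart_inv ?c u))) ?d (f (chart_inv ?c u)) (V (chart_inv ?c u))"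
  let ?G = "\<lambda>V w. nabla_along A B g f V p w - christoffel B g (f p) (differential A B f p w) (V p)"
  have p: "chart_inv ?c (snd ?c p) = p" by (rule chart_inv_left[OF A chart_at[OF A]])
  have fp: "chart_inv ?d (snd ?d (f p)) = f p" by (rule chart_inv_left[OF B chart_at[OF B]])
  have Fp: "?F (snd ?c p) = snd ?d (f p)" using p by simp
  have Vp: "?V V (snd ?c p) = V p" for V
    by (simp add: p coord_change_same[OF B chart_at[OF B]])
  have trT: "\<forall>\<^sub>F v in nhds (snd ?d (f p)). trilinear (?T v)"
    using eventually_chart_at[OF B open_UNIV UNIV_I, of "f p"]
  proof eventually_elim
    case (elim v)
    then have l: "linear (\<lambda>x. extend B (f p) x (chart_inv ?d v))"
      by (intro extend_linear[OF B]) simp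
    then show ?case
      unfolding trilinear_def
      by (intro conjI allI linearI) (simp_all add: linear_add[OF l] linear_scale[OF l] trilinear_simps[OF T(2)])
  qed
  have dT: "((\<lambda>v. ?T v x y z) has_derivative
      (\<lambda>w. deriv_at B (f p) (\<lambda>q. T q (extend B (f p) x q) (extend B (f p) y q) (extend B (f p) z q)) w)) (at (snd ?d (f p)))" for x y z
    using T(1) unfolding tensor3_diff_at_def deriv_at_def o_def by (simp add: frechet_derivative_works)
  have dV: "(?V V has_derivative ?G V) (at (snd ?c p))" if "along_diff_at A B f p V" for V
    using along_derivative[OF that] by (simp add: o_def)
  have "((\<lambda>u. ?T (?F u) (?V V1 u) (?V V2 u) (?V V3 u)) has_derivative
    (\<lambda>w. deriv_at B (f p) (\<lambda>q. T q (extend B (f p) (V1 p) q) (extend B (f p) (V2 p) q) (extend B (f p) (V3 p) q)) (differential A B f p w)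
      + ?T (snd ?d (f p)) (?G V1 w) (V2 p) (V3 p) + ?T (snd ?d (f p)) (V1 p) (?G V2 w) (V3 p)
      + ?T (snd ?d (f p)) (V1 p) (V2 p) (?G V3 w))) (at (snd ?c p))"
    using has_derivative_trilinear_field[of ?F "differential A B f p" "snd ?c p" ?T
        "\<lambda>w x y z. deriv_at B (f p) (\<lambda>q. T q (extend B (f p) x q) (extend B (f p) y q) (extend B (f p) z q)) w",
        OF differential_derivative _ _ dV[OF V(1)] dV[OF V(2)] dV[OF V(3)]] dT trT
    unfolding Fp Vp by simp
  moreover have "(\<lambda>w. deriv_at B (f p) (\<lambda>q. T q (extend B (f p) (V1 p) q) (extend B (f p) (V2 p) q) (extend B (f p) (V3 p) q)) (differential A B f p w)
      + ?T (snd ?d (f p)) (?G V1 w) (V2 p) (V3 p) + ?T (snd ?d (f p)) (V1 p) (?G V2 w) (V3 p)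
      + ?T (snd ?d (f p)) (V1 p) (V2 p) (?G V3 w)) =
    (\<lambda>w. nabla3 B g T (f p) (differential A B f p w) (V1 p) (V2 p) (V3 p)
      + T (f p) (nabla_along A B g f V1 p w) (V2 p) (V3 p)
      + T (f p) (V1 p) (nabla_along A B g f V2 p w) (V3 p)
      + T (f p) (V1 p) (V2 p) (nabla_along A B g f V3 p w))"
    unfolding fp by (simp add: fun_eq_iff nabla3_def Let_def extend_same[OF B] trilinear_simps[OF T(2)])
  ultimately have "((\<lambda>u. ?T (?F u) (?V V1 u) (?V V2 u) (?V V3 u)) has_derivative
    (\<lambda>w. nabla3 B g T (f p) (differential A B f p w) (V1 p) (V2 p) (V3 p)
      + T (f p) (nabla_along A B g f V1 p w) (V2 p) (V3 p)
      + T (f p) (V1 p) (nabla_along A B g f V2 p w) (V3 p)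
      + T (f p) (V1 p) (V2 p) (nabla_along A B g f V3 p w))) (at (snd ?c p))" by simp
  then show ?thesis
  proof (rule has_derivative_cong_ev)
    \<comment> \<open>As long as \<open>f\<close> stays in the chart at \<open>f p\<close>, taking
      components in that chart and extending them back is the identity, so the two functions agree
      near \<open>p\<close>.\<close>
    have "open (f -` fst ?d)" by (rule open_preimage[OF open_chart[OF B chart_at(1)[OF B]]])
    from eventually_chart_at[OF A this, of p]
    have "\<forall>\<^sub>F u in nhds (snd ?c p). f (chart_inv ?c u) \<in> fst ?d"
      using chart_at(2)[OF B, of "f p"] by (auto elim: eventually_mono)
    then show "\<forall>\<^sub>F u in nhds (snd ?c p). ((\<lambda>q. T (f q) (V1 q) (V2 q) (V3 q)) \<circ> chart_inv ?c) u
        = ?T (?F u) (?V V1 u) (?V V2 u) (?V V3 u)"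
      by eventually_elim (simp add: chart_inv_left[OF B chart_at(1)[OF B]] extend_inverse[OF B])
  qed
qed

lemma leibniz2:
  assumes T: "tensor2_diff_at B (f p) T" "\<And>q. bilinear (T q)"
    and V: "along_diff_at A B f p V1" "along_diff_at A B f p V2"
  shows "((\<lambda>q. T (f q) (V1 q) (V2 q)) \<circ> chart_inv (chart_at A p) has_derivative
    (\<lambda>w. nabla2 B g T (f p) (differential A B f p w) (V1 p) (V2 p)
      + T (f p) (nabla_along A B g f V1 p w) (V2 p)
      + T (f p) (V1 p) (nabla_along A B g f V2 p w))) (at (snd (chart_at A p) p))"
proof -
  let ?c = "chart_at A p" and ?d = "chart_at B (f p)"
  let ?F = "snd ?d \<circ> f \<circ> chart_inv ?c"
  let ?T = "\<lambda>v x y. T (chart_inv ?d v) (extend B (f p) x (chart_inv ?d v)) (extend B (f p) y (chart_inv ?d v))"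
  let ?V = "\<lambda>V u. coord_change (chart_at B (f (chart_inv ?c u))) ?d (f (chart_inv ?c u)) (V (chart_inv ?c u))"
  let ?G = "\<lambda>V w. nabla_along A B g f V p w - christoffel B g (f p) (differential A B f p w) (V p)"
  have p: "chart_inv ?c (snd ?c p) = p" by (rule chart_inv_left[OF A chart_at[OF A]])
  have fp: "chart_inv ?d (snd ?d (f p)) = f p" by (rule chart_inv_left[OF B chart_at[OF B]])
  have Fp: "?F (snd ?c p) = snd ?d (f p)" using p by simp
  have Vp: "?V V (snd ?c p) = V p" for V
    by (simp add: p coord_change_same[OF B chart_at[OF B]])
  have trT: "\<forall>\<^sub>F v in nhds (snd ?d (f p)). bilinear (?T v)"
    using eventually_chart_at[OF B open_UNIV UNIV_I, of "f p"]
  proof eventually_elim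
    case (elim v)
    then have l: "linear (\<lambda>x. extend B (f p) x (chart_inv ?d v))"
      by (intro extend_linear[OF B]) simp
    then show ?case
      unfolding bilinear_def
      by (intro conjI allI linearI) (simp_all add: linear_add[OF l] linear_scale[OF l] bilinear_form_simps[OF T(2)])
  qed
  have dT: "((\<lambda>v. ?T v x y) has_derivative
      (\<lambda>w. deriv_at B (f p) (\<lambda>q. T q (extend B (f p) x q) (extend B (f p) y q)) w)) (at (snd ?d (f p)))" for x y
    using T(1) unfolding tensor2_diff_at_def deriv_at_def o_def by (simp add: frechet_derivative_works)
  have dV: "(?V V has_derivative ?G V) (at (snd ?c p))" if "along_diff_at A B f p V" for V
    using along_derivative[OF that] by (simp add: o_def)
  have "((\<lambda>u. ?T (?F u) (?V V1 u) (?V V2 u)) has_derivative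
    (\<lambda>w. deriv_at B (f p) (\<lambda>q. T q (extend B (f p) (V1 p) q) (extend B (f p) (V2 p) q)) (differential A B f p w)
      + ?T (snd ?d (f p)) (?G V1 w) (V2 p) + ?T (snd ?d (f p)) (V1 p) (?G V2 w))) (at (snd ?c p))"
    using has_derivative_bilinear_field[of ?F "differential A B f p" "snd ?c p" ?T
        "\<lambda>w x y. deriv_at B (f p) (\<lambda>q. T q (extend B (f p) x q) (extend B (f p) y q)) w",
        OF differential_derivative _ _ dV[OF V(1)] dV[OF V(2)]] dT trT
    unfolding Fp Vp by simp
  moreover have "(\<lambda>w. deriv_at B (f p) (\<lambda>q. T q (extend B (f p) (V1 p) q) (extend B (f p) (V2 p) q)) (differential A B f p w)
      + ?T (snd ?d (f p)) (?G V1 w) (V2 p) + ?T (snd ?d (f p)) (V1 p) (?G V2 w)) =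
    (\<lambda>w. nabla2 B g T (f p) (differential A B f p w) (V1 p) (V2 p)
      + T (f p) (nabla_along A B g f V1 p w) (V2 p)
      + T (f p) (V1 p) (nabla_along A B g f V2 p w))"
    unfolding fp by (simp add: fun_eq_iff nabla2_def Let_def extend_same[OF B] bilinear_form_simps[OF T(2)])
  ultimately have "((\<lambda>u. ?T (?F u) (?V V1 u) (?V V2 u)) has_derivative
    (\<lambda>w. nabla2 B g T (f p) (differential A B f p w) (V1 p) (V2 p)
      + T (f p) (nabla_along A B g f V1 p w) (V2 p)
      + T (f p) (V1 p) (nabla_along A B g f V2 p w))) (at (snd ?c p))" by simp
  then show ?thesis
  proof (rule has_derivative_cong_ev)
    have "open (f -` fst ?d)" by (rule open_preimage[OF open_chart[OF B chart_at(1)[OF B]]])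
    from eventually_chart_at[OF A this, of p]
    have "\<forall>\<^sub>F u in nhds (snd ?c p). f (chart_inv ?c u) \<in> fst ?d"
      using chart_at(2)[OF B, of "f p"] by (auto elim: eventually_mono)
    then show "\<forall>\<^sub>F u in nhds (snd ?c p). ((\<lambda>q. T (f q) (V1 q) (V2 q)) \<circ> chart_inv ?c) u
        = ?T (?F u) (?V V1 u) (?V V2 u)"
      by eventually_elim (simp add: chart_inv_left[OF B chart_at(1)[OF B]] extend_inverse[OF B])
  qed
qed


end

section \<open>The Levi-Civita connection\<close>

lemma christoffel_eqI:
  assumes "euclid (g p)" and s: "\<And>x y. \<Gamma> x y = \<Gamma> y x"
    and c: "\<And>v x y. deriv_at A p (\<lambda>q. g q (extend A p x q) (extend A p y q)) v = g p (\<Gamma> v x) y + g p x (\<Gamma> v y)"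
  shows "christoffel A g p = \<Gamma>"
  unfolding christoffel_def
proof (rule the_equality)
  interpret euclid "g p" by fact
  fix \<Delta>
  assume \<Delta>: "(\<forall>x y. \<Delta> x y = \<Delta> y x) \<and> (\<forall>v x y.
    deriv_at A p (\<lambda>q. g q (extend A p x q) (extend A p y q)) v = g p (\<Delta> v x) y + g p x (\<Delta> v y))"
  \<comment> \<open>Symmetric in the first two and skew in the last two arguments: applying these
    symmetries alternately, three times each, gives \<open>t = - t\<close>.\<close>
  define t where "t v x y = g p (\<Delta> v x) y - g p (\<Gamma> v x) y" for v x y
  have t1: "t v x y = t x v y" for v x y
    using \<Delta> s[of v x] by (simp add: t_def)
  have t2: "t v x y = - t v y x" for v x y
    using \<Delta> c[of x y v] sym[of x "\<Delta> v y"] sym[of x "\<Gamma> v y"] by (simp add: t_def)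
  have "t v x y = 0" for v x y
    using t1[of v x y] t2[of x v y] t1[of x y v] t2[of y x v] t1[of y v x] t2[of v y x] by simp
  then have "g p (\<Delta> v x) y = g p (\<Gamma> v x) y" for v x y by (simp add: t_def)
  then show "\<Delta> = \<Gamma>" by (intro ext G_eqI)
qed (use s c in blast)

text \<open>Koszul formula: coordinate fields have vanishing brackets, and the resulting linear form
  in \<open>y\<close> is represented by \<open>riesz\<close>. This exhibits a solution, which
  \<open>christoffel_eqI\<close> identifies with the described one.\<close>

lemma christoffel:
  fixes A :: "('m::{t2_space, second_countable_topology}, 'n::finite) chart set"
  assumes A: "smooth_atlas A" and e: "\<And>q. euclid (g q)" and d: "tensor2_diff_at A p g"
  shows "christoffel A g p x y = christoffel A g p y x"
    and "deriv_at A p (\<lambda>q. g q (extend A p x q) (extend A p y q)) v =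
      g p (christoffel A g p v x) y + g p x (christoffel A g p v y)"
proof -
  interpret euclid "g p" by (rule e)
  let ?c = "chart_at A p"
  define b where "b v x y = deriv_at A p (\<lambda>q. g q (extend A p x q) (extend A p y q)) v" for v x y
  have D: "((\<lambda>q. g q (extend A p x q) (extend A p y q)) \<circ> chart_inv ?c has_derivative (\<lambda>v. b v x y)) (at (snd ?c p))" for x y
    using d unfolding tensor2_diff_at_def b_def deriv_at_def by (simp add: frechet_derivative_works)
  have lin1: "linear (\<lambda>v. b v x y)" for x y
    using has_derivative_linear[OF D] .
  have bsym: "b v x y = b v y x" for v x y
    unfolding b_def using euclid.sym[OF e] by (metis (no_types))
  have ev: "\<forall>\<^sub>F u in nhds (snd ?c p). chart_inv ?c u \<in> fst ?c"
    using eventually_chart_at[OF A open_UNIV UNIV_I, of p] by (auto elim: eventually_mono)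
  have add: "b v x (y + y') = b v x y + b v x y'" for v x y y'
  proof -
    have "((\<lambda>q. g q (extend A p x q) (extend A p (y + y') q)) \<circ> chart_inv ?c has_derivative (\<lambda>v. b v x y + b v x y')) (at (snd ?c p))"
    proof (rule has_derivative_cong_ev[OF has_derivative_add[OF D D]])
      show "\<forall>\<^sub>F u in nhds (snd ?c p). ((\<lambda>q. g q (extend A p x q) (extend A p (y + y') q)) \<circ> chart_inv ?c) u =
        ((\<lambda>q. g q (extend A p x q) (extend A p y q)) \<circ> chart_inv ?c) u
        + ((\<lambda>q. g q (extend A p x q) (extend A p y' q)) \<circ> chart_inv ?c) u"
        using ev by eventually_elim
          (simp add: linear_add[OF extend_linear[OF A]] bilinear_form_simps[OF euclid.bil[OF e]])
    qed
    from has_derivative_unique[OF D this] show ?thesis by (rule fun_cong)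
  qed
  have scale: "b v x (r *\<^sub>R y) = r * b v x y" for v x y r
  proof -
    have "((\<lambda>q. g q (extend A p x q) (extend A p (r *\<^sub>R y) q)) \<circ> chart_inv ?c has_derivative (\<lambda>v. r * b v x y)) (at (snd ?c p))"
    proof (rule has_derivative_cong_ev[OF has_derivative_mult_right[OF D]])
      show "\<forall>\<^sub>F u in nhds (snd ?c p). ((\<lambda>q. g q (extend A p x q) (extend A p (r *\<^sub>R y) q)) \<circ> chart_inv ?c) u =
        r * ((\<lambda>q. g q (extend A p x q) (extend A p y q)) \<circ> chart_inv ?c) u"
        using ev by eventually_elim
          (simp add: linear_scale[OF extend_linear[OF A]] bilinear_form_simps[OF euclid.bil[OF e]])
    qed
    from has_derivative_unique[OF D this] show ?thesis by (rule fun_cong)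
  qed
  have "linear (\<lambda>y. (b v x y + b x v y - b y v x) / 2)" for v x
    by (rule linearI) (simp_all add: add scale linear_add[OF lin1] linear_scale[OF lin1] field_simps)
  from riesz[OF this] obtain \<Gamma> where \<Gamma>: "\<And>v x y. g p (\<Gamma> v x) y = (b v x y + b x v y - b y v x) / 2"
    by metis
  have "\<Gamma> x y = \<Gamma> y x" for x y
    by (rule G_eqI) (simp add: \<Gamma> bsym[of _ x y])
  moreover have "b v x y = g p (\<Gamma> v x) y + g p x (\<Gamma> v y)" for v x y
    using sym[of x "\<Gamma> v y"] bsym[of v x y] bsym[of x v y] bsym[of y v x] by (simp add: \<Gamma> field_simps)
  ultimately have *: "christoffel A g p = \<Gamma>" "\<And>x y. \<Gamma> x y = \<Gamma> y x" "\<And>v x y. b v x y = g p (\<Gamma> v x) y + g p x (\<Gamma> v y)"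
    by (auto intro!: christoffel_eqI e simp: b_def)
  show "christoffel A g p x y = christoffel A g p y x" unfolding *(1) by (rule *(2))
  show "deriv_at A p (\<lambda>q. g q (extend A p x q) (extend A p y q)) v =
      g p (christoffel A g p v x) y + g p x (christoffel A g p v y)"
    unfolding *(1) b_def[symmetric] by (rule *(3))
qed

lemma riemannian_metric_diff:
  assumes "smooth_atlas A" "riemannian_metric A g"
  shows "tensor2_diff_at A p g" "euclid (g p)"
proof -
  have "smooth_on (snd (chart_at A p) ` fst (chart_at A p)) ((\<lambda>q. g q (extend A p x q) (extend A p y q)) \<circ> chart_inv (chart_at A p))" for x y
    using assms(2) chart_at(1)[OF assms(1)] unfolding riemannian_metric_def smooth_tensor2_def extend_def by blast
  then show "tensor2_diff_at A p g"
    unfolding tensor2_diff_at_def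
    using open_chart_image[OF assms(1) chart_at(1)[OF assms(1)] open_UNIV, of p] chart_at(2)[OF assms(1), of p]
    by (auto intro!: smooth_on_differentiable)
  show "euclid (g p)"
    using assms(2) unfolding riemannian_metric_def euclid_def by blast
qed

lemma smooth_tensor3_diff:
  assumes "smooth_atlas A" "smooth_tensor3 A T"
  shows "tensor3_diff_at A p T"
proof -
  have "smooth_on (snd (chart_at A p) ` fst (chart_at A p)) ((\<lambda>q. T q (extend A p x q) (extend A p y q) (extend A p z q)) \<circ> chart_inv (chart_at A p))" for x y z
    using assms(2) chart_at(1)[OF assms(1)] unfolding smooth_tensor3_def extend_def by blast
  then show ?thesis
    unfolding tensor3_diff_at_def
    using open_chart_image[OF assms(1) chart_at(1)[OF assms(1)] open_UNIV, of p] chart_at(2)[OF assms(1), of p]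
    by (auto intro!: smooth_on_differentiable)
qed

lemma nabla2_metric:
  assumes "smooth_atlas A" "\<And>q. euclid (g q)" "tensor2_diff_at A p g"
  shows "nabla2 A g g p v x y = 0"
  using christoffel(2)[OF assms, of x y v] by (simp add: nabla2_def Let_def)

lemma smooth_map_id:
  assumes "smooth_atlas A"
  shows "smooth_map_between A A id"
proof
  show "smooth_map A A id"
    using assms unfolding smooth_map_def smooth_atlas_def by simp
qed (fact assms)+

lemma differential_id: "smooth_atlas A \<Longrightarrow> differential A A id p x = x"
  using coord_change_same[OF _ chart_at] unfolding differential_def coord_change_def by simp

lemma locally_constant_derivative:
  assumes A: "smooth_atlas A" and U: "open U" "p \<in> U" "\<And>q. q \<in> U \<Longrightarrow> h q = (C :: real)"
  shows "(h \<circ> chart_inv (chart_at A p) has_derivative (\<lambda>_. 0)) (at (snd (chart_at A p) p))"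
proof (rule has_derivative_cong_ev[OF has_derivative_const[of C]])
  show "\<forall>\<^sub>F u in nhds (snd (chart_at A p) p). (h \<circ> chart_inv (chart_at A p)) u = C"
    using eventually_chart_at[OF A U(1,2)] by eventually_elim (simp add: U(3))
qed

section \<open>Push-forward of coordinate fields\<close>

context smooth_map_between
begin

lemma metric_leibniz:
  assumes g: "\<And>q. euclid (g q)" "tensor2_diff_at B (f p) g"
    and V: "along_diff_at A B f p V1" "along_diff_at A B f p V2"
  shows "((\<lambda>q. g (f q) (V1 q) (V2 q)) \<circ> chart_inv (chart_at A p) has_derivative
    (\<lambda>w. g (f p) (nabla_along A B g f V1 p w) (V2 p) + g (f p) (V1 p) (nabla_along A B g f V2 p w)))
      (at (snd (chart_at A p) p))"
  using leibniz2[OF g(2) euclid.bil[OF g(1)] V, of g] by (simp add: nabla2_metric[OF B g])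

text \<open>Covariant derivatives of push-forwards thereby reduce to second partial derivatives of
  one fixed coordinate expression of \<open>f\<close>.\<close>

lemma pushforward_local:
  "\<forall>\<^sub>F u in nhds (snd (chart_at A p) p).
    ((\<lambda>q. coord_change (chart_at B (f q)) (chart_at B (f p)) (f q) (differential A B f q (extend A p x q))) \<circ> chart_inv (chart_at A p)) u =
    frechet_derivative (snd (chart_at B (f p)) \<circ> f \<circ> chart_inv (chart_at A p)) (at u) x"
proof -
  let ?c = "chart_at A p" and ?d = "chart_at B (f p)"
  have "open (f -` fst ?d)" by (rule open_preimage[OF open_chart[OF B chart_at(1)[OF B]]])
  from eventually_chart_at[OF A this, of p]
  have "\<forall>\<^sub>F u in nhds (snd ?c p). u \<in> snd ?c ` fst ?c \<and> chart_inv ?c u \<in> fst ?c \<and> f (chart_inv ?c u) \<in> fst ?d"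
    using chart_at(2)[OF B, of "f p"] by auto
  then show ?thesis
  proof eventually_elim
    case (elim u)
    then show ?case
      using differential_local[OF chart_at(1)[OF A] chart_at(1)[OF B], of "chart_inv ?c u" p "f p" x]
      by (simp add: extend_def chart_inv_right[OF A chart_at(1)[OF A]])
  qed
qed

lemma pushforward_diff_at: "along_diff_at A B f p (\<lambda>q. differential A B f q (extend A p x q))"
  unfolding along_diff_at_def
proof (rule differentiable_cong_ev[OF _ pushforward_local])
  let ?S = "snd (chart_at A p) ` (fst (chart_at A p) \<inter> f -` fst (chart_at B (f p)))"
  show "(\<lambda>u. frechet_derivative (snd (chart_at B (f p)) \<circ> f \<circ> chart_inv (chart_at A p)) (at u) x) differentiable
      at (snd (chart_at A p) p)"
    using smooth_local[OF chart_at(1)[OF A, of p] chart_at(1)[OF B, of "f p"]] chart_at(2)[OF A, of p] chart_at(2)[OF B, of "f p"]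
    by (intro smooth_on_differentiable[of ?S] smooth_on_deriv) auto
qed

text \<open>Torsion-freeness along a map: second partial derivatives commute and the Christoffel
  symbols are symmetric. It yields the symmetry of the second fundamental form and of the induced
  connection.\<close>

lemma pushforward_nabla_symmetric:
  assumes "\<And>x y. christoffel B g (f p) x y = christoffel B g (f p) y x"
  shows "nabla_along A B g f (\<lambda>q. differential A B f q (extend A p x q)) p w =
    nabla_along A B g f (\<lambda>q. differential A B f q (extend A p w q)) p x"
proof -
  let ?F = "snd (chart_at B (f p)) \<circ> f \<circ> chart_inv (chart_at A p)"
  let ?S = "snd (chart_at A p) ` (fst (chart_at A p) \<inter> f -` fst (chart_at B (f p)))"
  let ?u = "snd (chart_at A p) p"
  have S: "smooth_on ?S ?F" "open ?S" "?u \<in> ?S"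
    using smooth_local[OF chart_at(1)[OF A, of p] chart_at(1)[OF B, of "f p"]] chart_at(2)[OF A, of p] chart_at(2)[OF B, of "f p"]
    by auto
  have "deriv_at A p (\<lambda>q. coord_change (chart_at B (f q)) (chart_at B (f p)) (f q) (differential A B f q (extend A p x q))) w =
    frechet_derivative (\<lambda>u. frechet_derivative ?F (at u) x) (at ?u) w" for x w
    by (rule deriv_at_eq, rule has_derivative_cong_ev[OF smooth_on_has_derivative[OF smooth_on_deriv[OF S(1)] S(2,3)] pushforward_local])
  then show ?thesis
    using second_derivative_symmetric[OF S, of x w] assms
    by (simp add: nabla_along_def extend_same[OF A])
qed

end

section \<open>Hypersurfaces of nearly parallel G2-manifolds\<close>

locale nearly_parallel =
  fixes A :: "('m::{t2_space, second_countable_topology}, 7) chart set"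
    and g :: "'m \<Rightarrow> (real ^ 7) form2" and \<phi> :: "'m \<Rightarrow> (real ^ 7) form3" and k :: real
  assumes g2_str: "g2_structure A g \<phi>" and X1: "\<And>p x y. rbar A g \<phi> p x y = k / 4 * g p x y"
begin

lemma A: "smooth_atlas A" and metric: "riemannian_metric A g"
  and phi_smooth: "smooth_tensor3 A \<phi>" and phi_tri: "trilinear (\<phi> p)" and phi_alt: "alternating3 (\<phi> p)"
  using g2_str unfolding g2_structure_def by blast+

lemma g_euclid: "euclid (g p)" and g_diff: "tensor2_diff_at A p g"
  using riemannian_metric_diff[OF A metric] by blast+

lemma phi_diff: "tensor3_diff_at A p \<phi>"
  by (rule smooth_tensor3_diff[OF A phi_smooth])

lemma frame:
  obtains U e where "open U" "p \<in> U" "\<And>i. smooth_along A A id U (\<lambda>q. e q i)"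
    "\<And>q. q \<in> U \<Longrightarrow> adapted_frame (g q) (\<phi> q) (e q)"
  using g2_str unfolding g2_structure_def by metis

lemma g2_at: "g2 (g p) (\<phi> p)"
proof (intro g2.intro g2_axioms.intro g_euclid phi_tri phi_alt)
  show "\<exists>e. adapted_frame (g p) (\<phi> p) e" using frame[of p] by metis
qed

text \<open>Fields with constant components in a local adapted frame have constant inner products and
  constant values of \<open>\<phi>\<close>, so \<open>\<nabla>\<phi>\<close> is the action of a skew endomorphism.\<close>

lemma nabla_phi: "nabla3 A g \<phi> p v x y z = k / 4 * star (g p) (\<phi> p) v x y z"
proof -
  interpret g2 "g p" "\<phi> p" by (rule g2_at)
  interpret i: smooth_map_between A A id by (rule smooth_map_id[OF A])
  obtain U e where U: "open U" "p \<in> U" and sm: "\<And>i. smooth_along A A id U (\<lambda>q. e q i)"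
    and ad: "\<And>q. q \<in> U \<Longrightarrow> adapted_frame (g q) (\<phi> q) (e q)" by (rule frame[of p]) (rule that)
  \<comment> \<open>The extension of \<open>x\<close> with constant components in the moving frame,
    rather than in a chart.\<close>
  define V where "V x q = (\<Sum>i\<in>UNIV. g p x (e p i) *\<^sub>R e q i)" for x q
  have ep: "orthonormal (g p) (e p)" using ad[OF U(2)] by (simp add: adapted_frame_def)
  have Vp: "V x p = x" for x
    unfolding V_def by (rule orthonormal_expand[OF ep, symmetric])
  have Ve: "g q (V x q) (e q i) = g p x (e p i)" "g q (e q i) (V x q) = g p x (e p i)" if "q \<in> U" for x q i
  proof -
    have o: "g q (e q j) (e q i) = (if j = i then 1 else 0)" for i j
      using ad[OF that] by (simp add: adapted_frame_def orthonormal_def)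
    have "g q (V x q) (e q i) = (\<Sum>j\<in>UNIV. g p x (e p j) * (if j = i then 1 else 0))"
      unfolding V_def by (simp only: euclid.G_sum[OF g_euclid] euclid.G_simps[OF g_euclid] o)
    then show "g q (V x q) (e q i) = g p x (e p i)" by (simp add: if_distrib cong: if_cong)
    then show "g q (e q i) (V x q) = g p x (e p i)" using euclid.sym[OF g_euclid] by metis
  qed
  have V_diff: "along_diff_at A A id p (V x)" for x
  proof -
    let ?c = "chart_at A p"
    have d: "(\<lambda>q. coord_change (chart_at A (id q)) (chart_at A (id p)) (id q) (e q i)) \<circ> chart_inv ?c
        differentiable (at (snd ?c p))" for i
      using i.smooth_along_diff_at[OF sm U] unfolding along_diff_at_def .
    have "(\<lambda>u. \<Sum>i\<in>UNIV. g p x (e p i) *\<^sub>R ((\<lambda>q. coord_change (chart_at A (id q)) (chart_at A (id p)) (id q) (e q i)) \<circ> chart_inv ?c) u)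
        differentiable (at (snd ?c p))"
      using d by (intro differentiable_sum differentiable_scaleR differentiable_const) (simp_all add: o_def)
    then show ?thesis
      unfolding along_diff_at_def
    proof (rule differentiable_cong_ev)
      show "\<forall>\<^sub>F u in nhds (snd ?c p). ((\<lambda>q. coord_change (chart_at A (id q)) (chart_at A (id p)) (id q) (V x q)) \<circ> chart_inv ?c) u =
        (\<Sum>i\<in>UNIV. g p x (e p i) *\<^sub>R ((\<lambda>q. coord_change (chart_at A (id q)) (chart_at A (id p)) (id q) (e q i)) \<circ> chart_inv ?c) u)"
        using eventually_chart_at[OF A open_UNIV UNIV_I, of p]
      proof eventually_elim
        case (elim u)
        then have "linear (coord_change (chart_at A (chart_inv ?c u)) ?c (chart_inv ?c u))"
          by (intro coord_change_linear[OF A] chart_at[OF A]) simp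
        then show ?case by (simp add: V_def linear_sum linear_scale)
      qed
    qed
  qed
  define a where "a x = nabla_along A A g id (V x) p v" for x
  have skew: "g p (a x) y = - g p x (a y)" for x y
  proof -
    have "((\<lambda>q. g (id q) (V x q) (V y q)) \<circ> chart_inv (chart_at A p) has_derivative (\<lambda>_. 0)) (at (snd (chart_at A p) p))"
    proof (rule locally_constant_derivative[OF A U])
      fix q assume q: "q \<in> U"
      then have "orthonormal (g q) (e q)" using ad by (simp add: adapted_frame_def)
      from euclid.parseval[OF g_euclid this, of "V x q" "V y q"]
      show "g (id q) (V x q) (V y q) = (\<Sum>i\<in>UNIV. g p x (e p i) * g p y (e p i))"
        by (simp add: Ve[OF q])
    qed
    from has_derivative_unique[OF i.metric_leibniz[OF g_euclid _ V_diff V_diff] this]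
    have "g p (a x) y + g p x (a y) = 0"
      using g_diff by (simp add: fun_eq_iff a_def Vp)
    then show ?thesis by simp
  qed
  \<comment> \<open>Linearity comes for free from \<open>skew\<close>, which moves the argument into
    a linear slot of the metric.\<close>
  have lin: "linear a"
  proof (rule linearI)
    show "a (x + y) = a x + a y" for x y by (rule G_eqI) (simp add: skew G_simps)
    show "a (r *\<^sub>R x) = r *\<^sub>R a x" for r x by (rule G_eqI) (simp add: skew G_simps)
  qed
  have nab: "nabla3 A g \<phi> p v x y z = - (\<phi> p (a x) y z + \<phi> p x (a y) z + \<phi> p x y (a z))" for x y z
  proof -
    have "((\<lambda>q. \<phi> (id q) (V x q) (V y q) (V z q)) \<circ> chart_inv (chart_at A p) has_derivative (\<lambda>_. 0)) (at (snd (chart_at A p) p))"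
    proof (rule locally_constant_derivative[OF A U])
      fix q assume q: "q \<in> U"
      then have "\<phi> q x y z = (\<Sum>i\<in>UNIV. wedge (g q) [e q i, e q (i + 1), e q (i + 3)] [x, y, z])" for x y z
        using ad by (simp add: adapted_frame_def)
      then show "\<phi> (id q) (V x q) (V y q) (V z q) = \<phi> p x y z"
        using ad[OF U(2)] Ve[OF q] sym[of "e p _"] unfolding wedge3 adapted_frame_def by simp
    qed
    note z = this
    have p: "tensor3_diff_at A (id p) \<phi>" using phi_diff by simp
    from fun_cong[OF has_derivative_unique[OF i.leibniz3[where g=g, OF p phi_tri V_diff V_diff V_diff] z], of v]
    have "nabla3 A g \<phi> p v x y z + \<phi> p (a x) y z + \<phi> p x (a y) z + \<phi> p x y (a z) = 0"
      by (simp add: a_def Vp differential_id[OF A])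
    then show ?thesis by linarith
  qed
  obtain T where T: "\<And>x y z. \<phi> p (a x) y z + \<phi> p x (a y) z + \<phi> p x y (a z) = star (g p) (\<phi> p) T x y z"
    using skew_action[OF lin skew] by blast
  have n: "nabla3 A g \<phi> p v = star (g p) (\<phi> p) (- T)"
    by (intro ext) (simp add: nab T sigma_simps)
  \<comment> \<open>By \<open>sigma_inner\<close>, \<open>rbar\<close> evaluates to the inner
    product with \<open>- T\<close>, so the type X1 equation determines \<open>T\<close>.\<close>
  have "- T = (k / 4) *\<^sub>R v"
  proof (rule G_eqI)
    fix y
    show "g p (- T) y = g p ((k / 4) *\<^sub>R v) y"
      using X1[of p v y] sigma_inner[of "- T" y] by (simp add: rbar_def n G_simps)
  qed
  then show ?thesis by (simp add: n sigma_simps)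
qed

end

locale nearly_parallel_hypersurface = nearly_parallel A g \<phi> k
  for A :: "('m::{t2_space, second_countable_topology}, 7) chart set" and g \<phi> k +
  fixes A' :: "('h::{t2_space, second_countable_topology}, 6) chart set"
    and \<iota> :: "'h \<Rightarrow> 'm" and n :: "'h \<Rightarrow> real ^ 7"
  assumes hyp: "hypersurface_with_normal A g A' \<iota> n"
begin

abbreviation D where "D \<equiv> differential A' A \<iota>"
abbreviation h where "h \<equiv> induced_metric A g A' \<iota>"
abbreviation I where "I \<equiv> induced_I A g \<phi> A' \<iota> n"
abbreviation B where "B \<equiv> second_fund A g A' \<iota> n"
abbreviation tangential where "tangential p x \<equiv> (\<lambda>q. D q (extend A' p x q))"
abbreviation nabla where "nabla V p w \<equiv> nabla_along A' A g \<iota> V p w"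
abbreviation \<Gamma> where "\<Gamma> \<equiv> christoffel A' h"
abbreviation \<rho> :: "'h \<Rightarrow> (real ^ 6) form3" where "\<rho> \<equiv> \<lambda>p x y z. \<phi> (\<iota> p) (D p x) (D p y) (D p z)"

sublocale im: smooth_map_between A' A \<iota>
  using A hyp unfolding hypersurface_with_normal_def smooth_map_between_def by blast

lemmas A' = im.A

sublocale idm: smooth_map_between A' A' id
  by (rule smooth_map_id[OF A'])

sublocale H: hyperplane "g (\<iota> p)" "\<phi> (\<iota> p)" "n p" "D p" for p
proof (intro hyperplane.intro hyperplane_axioms.intro g2_at im.differential_linear)
qed (use hyp in \<open>auto simp: hypersurface_with_normal_def\<close>)

lemma G'_eq: "H.G' p = h p"
  by (intro ext) (simp add: H.G'_def induced_metric_def)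

lemma J_eq: "H.J p = I p"
  by (intro ext) (simp add: H.J_def induced_I_def)

lemma rho_eq: "H.\<rho> p = \<rho> p"
  by (intro ext) (simp add: H.\<rho>_def)

lemma su3: "su3 (h p) (I p) (\<rho> p)"
  using H.su3.su3_axioms[of p] unfolding G'_eq J_eq rho_eq .

sublocale S: su3 "h p" "I p" "\<rho> p" for p by (rule su3)

lemma h_euclid: "euclid (h p)" by (rule S.euclid_axioms)

section \<open>Second fundamental form, Gauss and Weingarten formulas\<close>

lemma n_diff: "along_diff_at A' A \<iota> p n"
  using hyp unfolding hypersurface_with_normal_def
  by (intro im.smooth_along_diff_at[of UNIV]) auto

lemma tangential_diff: "along_diff_at A' A \<iota> p (tangential p x)"
  by (rule im.pushforward_diff_at)

lemma nabla_tangential_sym: "nabla (tangential p x) p w = nabla (tangential p w) p x"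
  by (rule im.pushforward_nabla_symmetric) (rule christoffel(1)[OF A g_euclid g_diff])

lemma B_def': "B p x y = g (\<iota> p) (nabla (tangential p y) p x) (n p)"
  by (simp add: second_fund_def)

lemma B_sym: "B p x y = B p y x"
  unfolding B_def' by (subst nabla_tangential_sym) (rule refl)

lemma h_extend: "h q (extend A' p x q) (extend A' p y q) = g (\<iota> q) (tangential p x q) (tangential p y q)"
  by (simp add: induced_metric_def)

lemma h_derivative:
  "((\<lambda>q. h q (extend A' p x q) (extend A' p y q)) \<circ> chart_inv (chart_at A' p) has_derivative
    (\<lambda>w. g (\<iota> p) (nabla (tangential p x) p w) (D p y) + g (\<iota> p) (D p x) (nabla (tangential p y) p w)))
      (at (snd (chart_at A' p) p))"
  using im.metric_leibniz[OF g_euclid g_diff tangential_diff[of p x] tangential_diff[of p y]]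
  by (simp add: h_extend extend_same[OF A'])

lemma h_diff: "tensor2_diff_at A' p h"
  unfolding tensor2_diff_at_def differentiable_def using h_derivative by blast

text \<open>The tangential part of the ambient derivative is symmetric by
  \<open>nabla_tangential_sym\<close> and compatible with the induced metric by
  \<open>h_derivative\<close>; these two properties characterise \<open>\<Gamma>\<close>.\<close>

lemma gauss: "nabla (tangential p x) p w = D p (\<Gamma> p w x) + B p w x *\<^sub>R n p"
proof -
  have "\<exists>t. D p t = nabla (tangential p x) p w - B p w x *\<^sub>R n p" for w x
    using H.sym[of p "n p" "nabla (tangential p x) p w"]
    by (intro H.tangent) (simp add: H.G_simps H.n_unit B_def')
  note ex = this
  define t where "t w x = (SOME t. D p t = nabla (tangential p x) p w - B p w x *\<^sub>R n p)" for w x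
  have t: "D p (t w x) = nabla (tangential p x) p w - B p w x *\<^sub>R n p" for w x
    unfolding t_def by (rule someI_ex[OF ex])
  have "\<Gamma> p = t"
  proof (rule christoffel_eqI[where g=h and p=p and A=A'])
    show "euclid (h p)" by (rule h_euclid)
    show "t x y = t y x" for x y
    proof -
      have "D p (t x y) = D p (t y x)"
        unfolding t using nabla_tangential_sym[of p x y] B_sym[of p x y] by simp
      then show ?thesis by (simp only: H.D_eq_iff)
    qed
    show "deriv_at A' p (\<lambda>q. h q (extend A' p x q) (extend A' p y q)) v = h p (t v x) y + h p x (t v y)" for v x y
      unfolding deriv_at_eq[OF h_derivative]
      using H.sym[of p "D p x" "n p"]
      by (simp add: induced_metric_def t H.G_simps H.n_normal)
  qed
  then show ?thesis by (simp add: t)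
qed

text \<open>Both equations differentiate constants: the length of \<open>n\<close>, and its product
  with a tangential field.\<close>

lemma weingarten:
  "g (\<iota> p) (nabla n p w) (n p) = 0" "g (\<iota> p) (nabla n p w) (D p x) = - B p w x"
proof -
  have "((\<lambda>q. g (\<iota> q) (n q) (n q)) \<circ> chart_inv (chart_at A' p) has_derivative (\<lambda>_. 0)) (at (snd (chart_at A' p) p))"
    by (rule locally_constant_derivative[OF A' open_UNIV UNIV_I]) (rule H.n_unit)
  from fun_cong[OF has_derivative_unique[OF im.metric_leibniz[OF g_euclid g_diff n_diff n_diff] this], of w]
  show "g (\<iota> p) (nabla n p w) (n p) = 0"
    using H.sym[of p "n p" "nabla n p w"] by simp
  have "((\<lambda>q. g (\<iota> q) (n q) (tangential p x q)) \<circ> chart_inv (chart_at A' p) has_derivative (\<lambda>_. 0)) (at (snd (chart_at A' p) p))"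
    by (rule locally_constant_derivative[OF A' open_UNIV UNIV_I]) (rule H.n_normal)
  from fun_cong[OF has_derivative_unique[OF im.metric_leibniz[OF g_euclid g_diff n_diff tangential_diff] this], of w]
  show "g (\<iota> p) (nabla n p w) (D p x) = - B p w x"
    using H.sym[of p "n p" "nabla (tangential p x) p w"] by (simp add: extend_same[OF A'] B_def')
qed

definition shape :: "'h \<Rightarrow> real ^ 6 \<Rightarrow> real ^ 6" where
  "shape p w = (SOME s. D p s = - nabla n p w)"

lemma D_shape: "D p (shape p w) = - nabla n p w"
proof -
  have "\<exists>s. D p s = - nabla n p w"
    using weingarten(1)[of p w] H.sym[of p "n p" "nabla n p w"] by (intro H.tangent) (simp add: H.G_simps)
  then show ?thesis unfolding shape_def by (rule someI_ex)
qed

lemma h_shape: "h p (shape p w) x = B p w x"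
  by (simp add: induced_metric_def D_shape H.G_simps weingarten)

lemma shape_sym: "h p (shape p x) y = h p x (shape p y)"
  using S.sym[of p x "shape p y"] B_sym[of p x y] by (simp add: h_shape)

lemma shape_linear: "linear (shape p)"
  by (rule linearI; rule S.G_eqI[of p]; simp add: shape_sym S.G_simps)

lemma nabla_n: "nabla n p w = - D p (shape p w)"
  by (simp add: D_shape)

section \<open>Covariant derivatives of the Kaehler form and of rho\<close>

lemma omega_extend:
  "kaehler_form h I q (extend A' p x q) (extend A' p y q) = \<phi> (\<iota> q) (n q) (tangential p y q) (tangential p x q)"
  using H.phi_n[of q "extend A' p y q" "extend A' p x q"] S.sym[of q]
  by (simp add: kaehler_form_def G'_eq J_eq)

lemma omega_derivative:
  "((\<lambda>q. kaehler_form h I q (extend A' p x q) (extend A' p y q)) \<circ> chart_inv (chart_at A' p) has_derivative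
    (\<lambda>w. nabla3 A g \<phi> (\<iota> p) (D p w) (n p) (D p y) (D p x)
      + \<phi> (\<iota> p) (nabla n p w) (D p y) (D p x) + \<phi> (\<iota> p) (n p) (nabla (tangential p y) p w) (D p x)
      + \<phi> (\<iota> p) (n p) (D p y) (nabla (tangential p x) p w))) (at (snd (chart_at A' p) p))"
  using im.leibniz3[where g=g, OF phi_diff phi_tri n_diff tangential_diff[of p y] tangential_diff[of p x]]
  by (simp add: omega_extend extend_same[OF A'])

text \<open>The normal terms of the Gauss formula meet the \<open>n\<close> already present in
  \<open>\<phi>(n, \<cdot>, \<cdot>)\<close> and vanish, and the tangential ones cancel against
  \<open>\<Gamma>\<close>. What remains is the derivative of \<open>n\<close> and that of
  \<open>\<phi>\<close>.\<close>

lemma nabla_omega: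
  "nabla2 A' h (kaehler_form h I) p w x y = \<rho> p (shape p w) x y - k / 4 * \<rho> p (I p w) x y"
proof -
  have om: "kaehler_form h I p x y = \<phi> (\<iota> p) (n p) (D p y) (D p x)" for x y
    using H.phi_n[of p y x] S.sym[of p x "I p y"] by (simp add: kaehler_form_def G'_eq J_eq)
  have "star (g (\<iota> p)) (\<phi> (\<iota> p)) (D p w) (n p) (D p y) (D p x) = - \<rho> p (I p w) x y"
    using H.sigma_swap(1)[of p "D p w" "n p" "D p y" "D p x"] H.sigma_n[of p w y x] S.rho_swap(2)[of p "I p w" x y]
    by (simp add: J_eq rho_eq)
  moreover have "\<phi> (\<iota> p) (D p (shape p w)) (D p y) (D p x) = - \<rho> p (shape p w) x y"
    by (rule H.phi_swap)
  ultimately show ?thesis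
    unfolding nabla2_def Let_def deriv_at_eq[OF omega_derivative]
    by (simp add: nabla_phi gauss om nabla_n H.phi_simps H.phi_same)
qed

lemma rho_derivative:
  "((\<lambda>q. \<rho> q (extend A' p x q) (extend A' p y q) (extend A' p z q)) \<circ> chart_inv (chart_at A' p) has_derivative
    (\<lambda>w. nabla3 A g \<phi> (\<iota> p) (D p w) (D p x) (D p y) (D p z)
      + \<phi> (\<iota> p) (nabla (tangential p x) p w) (D p y) (D p z) + \<phi> (\<iota> p) (D p x) (nabla (tangential p y) p w) (D p z)
      + \<phi> (\<iota> p) (D p x) (D p y) (nabla (tangential p z) p w))) (at (snd (chart_at A' p) p))"
  using im.leibniz3[where g=g, OF phi_diff phi_tri tangential_diff[of p x] tangential_diff[of p y] tangential_diff[of p z]]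
  by (simp add: extend_same[OF A'])

lemma rho_diff: "tensor3_diff_at A' p \<rho>"
  unfolding tensor3_diff_at_def differentiable_def using rho_derivative by blast


text \<open>Here the normal terms of the Gauss formula survive: each puts \<open>n\<close> into one
  slot of \<open>\<phi>\<close> and so produces \<open>\<omega>\<close> times \<open>B\<close>. The
  terms with \<open>k\<close> come from restricting \<open>*\<phi>\<close>.\<close>

lemma nabla_rho:
  "nabla3 A' h \<rho> p w x y z =
    k / 4 * (h p (I p w) y * h p (I p x) z - h p (I p w) z * h p (I p x) y - h p (I p w) x * h p (I p y) z)
    + h p (shape p w) x * h p (I p y) z + h p (shape p w) y * h p (I p z) x + h p (shape p w) z * h p (I p x) y"
proof -
  have n: "\<phi> (\<iota> p) (n p) (D p y) (D p z) = h p (I p y) z" for y z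
    using H.phi_n[of p y z] by (simp only: G'_eq J_eq)
  have n2: "\<phi> (\<iota> p) (D p x) (n p) (D p z) = h p (I p z) x" for x z
    unfolding n[symmetric] by (rule H.phi_cycle)
  have n3: "\<phi> (\<iota> p) (D p x) (D p y) (n p) = h p (I p x) y" for x y
    unfolding n[symmetric] by (rule H.phi_cycle[symmetric])
  have s: "star (g (\<iota> p)) (\<phi> (\<iota> p)) (D p w) (D p x) (D p y) (D p z) =
      h p (I p w) y * h p (I p x) z - h p (I p w) z * h p (I p x) y - h p (I p w) x * h p (I p y) z"
    using H.sigma_tangent[of p w x y z] by (simp only: G'_eq J_eq)
  note e = deriv_at_eq[OF rho_derivative[of p x y z]]
  have "nabla3 A' h \<rho> p w x y z = nabla3 A g \<phi> (\<iota> p) (D p w) (D p x) (D p y) (D p z)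
      + \<phi> (\<iota> p) (nabla (tangential p x) p w) (D p y) (D p z) + \<phi> (\<iota> p) (D p x) (nabla (tangential p y) p w) (D p z)
      + \<phi> (\<iota> p) (D p x) (D p y) (nabla (tangential p z) p w)
      - \<rho> p (\<Gamma> p w x) y z - \<rho> p x (\<Gamma> p w y) z - \<rho> p x y (\<Gamma> p w z)"
    unfolding nabla3_def[of A'] Let_def e by (rule refl)
  also have "\<dots> = k / 4 * star (g (\<iota> p)) (\<phi> (\<iota> p)) (D p w) (D p x) (D p y) (D p z)
      + (B p w x * \<phi> (\<iota> p) (n p) (D p y) (D p z) + B p w y * \<phi> (\<iota> p) (D p x) (n p) (D p z)
      + B p w z * \<phi> (\<iota> p) (D p x) (D p y) (n p))"
    unfolding nabla_phi gauss H.phi_simps(1-3,10-12) by simp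
  finally show ?thesis unfolding s n n2 n3 h_shape by simp
qed

text \<open>\<open>I\<close> solves the linear system \<open>h(x, I y) = \<omega>(x, y)\<close>, whose coefficients are differentiable.\<close>

lemma I_diff: "along_diff_at A' A' id p (\<lambda>q. I q (extend A' p y q))"
proof -
  let ?c = "chart_at A' p"
  let ?q = "chart_inv ?c"
  let ?X = "\<lambda>u. coord_change (chart_at A' (?q u)) ?c (?q u) (I (?q u) (extend A' p y (?q u)))"
  let ?M = "\<lambda>u. \<chi> i j. h (?q u) (extend A' p (axis i 1) (?q u)) (extend A' p (axis j 1) (?q u))"
  let ?b = "\<lambda>u. \<chi> i. kaehler_form h I (?q u) (extend A' p (axis i 1) (?q u)) (extend A' p y (?q u))"
  have ax: "v = (\<Sum>j\<in>UNIV. v $ j *\<^sub>R axis j 1)" for v :: "real ^ 6"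
    using basis_expansion[of v] by (simp add: scalar_mult_eq_scaleR)
  have "?X differentiable (at (snd ?c p))"
  proof (rule differentiable_linear_system[of ?M _ ?b])
    show "(\<lambda>u. ?M u $ i $ j) differentiable (at (snd ?c p))" for i j
      using h_diff unfolding tensor2_diff_at_def by (simp add: o_def)
    show "(\<lambda>u. ?b u $ i) differentiable (at (snd ?c p))" for i
      using omega_derivative[of p "axis i 1" y] by (auto simp: o_def differentiable_def)
    show "\<forall>\<^sub>F u in nhds (snd ?c p). det (?M u) \<noteq> 0 \<and> ?M u *v ?X u = ?b u"
      using eventually_chart_at[OF A' open_UNIV UNIV_I, of p]
    proof eventually_elim
      case (elim u)
      then have u: "?q u \<in> fst ?c" by simp
      have mult: "(?M u *v v) $ i = h (?q u) (extend A' p (axis i 1) (?q u)) (extend A' p v (?q u))" for v i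
      proof -
        have "extend A' p v (?q u) = (\<Sum>j\<in>UNIV. v $ j *\<^sub>R extend A' p (axis j 1) (?q u))"
          using arg_cong[OF ax[of v], of "\<lambda>v. extend A' p v (?q u)"] extend_linear[OF A' u]
          by (simp add: linear_sum[OF extend_linear[OF A' u]] linear_scale[OF extend_linear[OF A' u]])
        then show ?thesis
          by (simp add: matrix_vector_mult_def S.G_simps S.G_sum mult.commute)
      qed
      \<comment> \<open>\<open>?M u\<close> is the Gram matrix of the coordinate fields; a kernel
        vector gives a vector orthogonal to all of them, hence to itself.\<close>
      have "v = 0" if "?M u *v v = 0" for v
      proof -
        have "h (?q u) (extend A' p (axis i 1) (?q u)) (extend A' p v (?q u)) = 0" for i
          using mult[of v i] that by simp
        moreover have "extend A' p v (?q u) = (\<Sum>j\<in>UNIV. v $ j *\<^sub>R extend A' p (axis j 1) (?q u))"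
          using arg_cong[OF ax[of v], of "\<lambda>v. extend A' p v (?q u)"]
          by (simp add: linear_sum[OF extend_linear[OF A' u]] linear_scale[OF extend_linear[OF A' u]])
        ultimately have "h (?q u) (extend A' p v (?q u)) (extend A' p v (?q u)) = 0"
          by (metis (no_types, lifting) S.G_simps(7) S.G_sum(1) mult_zero_right sum.neutral)
        then have "extend A' p v (?q u) = 0" by (simp only: S.G_eq_0_iff)
        then show "v = 0"
          using extend_inverse(2)[OF A' u, of v]
            linear_0[OF coord_change_linear[OF A' chart_at(1)[OF A'] chart_at(1)[OF A'] chart_at(2)[OF A'] u]] by simp
      qed
      then have "det (?M u) \<noteq> 0"
        using matrix_left_invertible_ker[of "?M u"] invertible_det_nz[of "?M u"] invertible_left_inverse[of "?M u"] by blast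
      moreover have "?M u *v ?X u = ?b u"
        unfolding vec_eq_iff mult by (simp add: extend_inverse[OF A' u] kaehler_form_def)
      ultimately show ?case by blast
    qed
  qed
  then show ?thesis unfolding along_diff_at_def by (simp add: o_def)
qed

section \<open>Covariant derivative of I and the W5-part\<close>

lemma extend_along: "along_diff_at A' A' id p (\<lambda>q. extend A' p x q)"
  and nabla_extend: "nabla_along A' A' h id (\<lambda>q. extend A' p x q) p w = \<Gamma> p w x"
proof -
  let ?c = "chart_at A' p"
  have "((\<lambda>q. coord_change (chart_at A' (id q)) (chart_at A' (id p)) (id q) (extend A' p x q)) \<circ> chart_inv ?c has_derivative (\<lambda>_. 0)) (at (snd ?c p))"
  proof (rule has_derivative_cong_ev[OF has_derivative_const[of x]])
    show "\<forall>\<^sub>F u in nhds (snd ?c p). ((\<lambda>q. coord_change (chart_at A' (id q)) (chart_at A' (id p)) (id q) (extend A' p x q)) \<circ> chart_inv ?c) u = x"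
      using eventually_chart_at[OF A' open_UNIV UNIV_I, of p]
      by eventually_elim (simp add: extend_inverse[OF A'])
  qed
  then show "along_diff_at A' A' id p (\<lambda>q. extend A' p x q)"
    "nabla_along A' A' h id (\<lambda>q. extend A' p x q) p w = \<Gamma> p w x"
    unfolding along_diff_at_def nabla_along_def differentiable_def
    by (blast, simp add: deriv_at_eq differential_id[OF A'] extend_same[OF A'] del: o_apply)
qed

lemma nabla_I_field:
  "nabla_along A' A' h id (\<lambda>q. I q (extend A' p y q)) p w = nabla_endo A' h I p w y + I p (\<Gamma> p w y)"
  by (simp add: nabla_along_def nabla_endo_def Let_def differential_id[OF A'] extend_same[OF A'])

text \<open>The product rule for \<open>\<omega>(x, y) = h(x, I y)\<close>, with the metric
  parallel. Differentiability of \<open>I\<close> enters here.\<close>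

lemma h_nabla_I: "h p x (nabla_endo A' h I p w y) = nabla2 A' h (kaehler_form h I) p w x y"
proof -
  have d: "tensor2_diff_at A' (id p) h" using h_diff by simp
  have "((\<lambda>q. kaehler_form h I q (extend A' p x q) (extend A' p y q)) \<circ> chart_inv (chart_at A' p) has_derivative
    (\<lambda>w. h p (\<Gamma> p w x) (I p y) + h p x (nabla_endo A' h I p w y + I p (\<Gamma> p w y)))) (at (snd (chart_at A' p) p))"
    using idm.metric_leibniz[OF h_euclid d extend_along[of p x] I_diff[of p y]]
    by (simp add: nabla_extend nabla_I_field kaehler_form_def extend_same[OF A'])
  then show ?thesis
    unfolding nabla2_def Let_def by (simp add: deriv_at_eq kaehler_form_def S.G_simps)
qed

text \<open>The factor \<open>s\<close> covers \<open>\<psi>\<^sub>-\<close> at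
  \<open>\<theta> = 0\<close>, where it is \<open>-1\<close>, and \<open>\<psi>\<^sub>+\<close> at
  \<open>\<theta> = pi / 2\<close>, where it is 1.\<close>

lemma nabla_rho_I:
  "nabla3 A' h (\<lambda>q x y z. s * \<rho> q (I q x) y z) p w x y z =
    s * (nabla3 A' h \<rho> p w (I p x) y z + \<rho> p (nabla_endo A' h I p w x) y z)"
proof -
  have d: "tensor3_diff_at A' (id p) \<rho>" using rho_diff by simp
  have "((\<lambda>q. \<rho> q (I q (extend A' p x q)) (extend A' p y q) (extend A' p z q)) \<circ> chart_inv (chart_at A' p) has_derivative
    (\<lambda>w. nabla3 A' h \<rho> p w (I p x) y z + \<rho> p (nabla_endo A' h I p w x + I p (\<Gamma> p w x)) y z
      + \<rho> p (I p x) (\<Gamma> p w y) z + \<rho> p (I p x) y (\<Gamma> p w z))) (at (snd (chart_at A' p) p))"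
    using idm.leibniz3[where g=h, OF d S.tri I_diff[of p x] extend_along[of p y] extend_along[of p z]]
    by (simp add: nabla_extend nabla_I_field extend_same[OF A'] differential_id[OF A'])
  from has_derivative_mult_right[OF this, of s]
  have "((\<lambda>q. s * \<rho> q (I q (extend A' p x q)) (extend A' p y q) (extend A' p z q)) \<circ> chart_inv (chart_at A' p) has_derivative
    (\<lambda>w. s * (nabla3 A' h \<rho> p w (I p x) y z + \<rho> p (nabla_endo A' h I p w x + I p (\<Gamma> p w x)) y z
      + \<rho> p (I p x) (\<Gamma> p w y) z + \<rho> p (I p x) y (\<Gamma> p w z)))) (at (snd (chart_at A' p) p))"
    by (simp add: o_def)
  from deriv_at_eq[OF this] show ?thesis
    unfolding nabla3_def[of A' h "\<lambda>q x y z. s * \<rho> q (I q x) y z"] Let_def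
    by (simp add: S.rho_simps algebra_simps)
qed

text \<open>By \<open>torsion_one_form\<close> the defining condition holds for a linear
  \<open>\<eta>\<close> exactly when it vanishes, so the description denotes 0. Stating the
  hypothesis for the unordered pair covers both values of \<open>\<theta>\<close>.\<close>

lemma w5_form_eq_0:
  assumes pp: "{pp, pm} = {\<rho>, \<lambda>q x y z. s * \<rho> q (I q x) y z}"
  shows "w5_form A' h I pp pm p = (\<lambda>x. 0)"
proof -
  define C where "C \<eta> x y = (- \<eta> (I p x)) *\<^sub>R I p y - (1 / 2) *\<^sub>R I p (nabla_endo A' h I p x y)"
    for \<eta> :: "real ^ 6 \<Rightarrow> real" and x y
  let ?N = "\<lambda>x y z w. nabla3 A' h \<rho> p x (I p y) z w + \<rho> p (nabla_endo A' h I p x y) z w"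
  have nabla_rho': "nabla3 A' h \<rho> p x y z w =
      - (- k / 4) * (h p (I p x) z * h p (I p y) w - h p (I p x) w * h p (I p y) z - h p (I p x) y * h p (I p z) w)
      + h p (shape p x) y * h p (I p z) w + h p (shape p x) z * h p (I p w) y + h p (shape p x) w * h p (I p y) z" for x y z w
    unfolding nabla_rho by simp
  have nabla_omega': "nabla2 A' h (kaehler_form h I) p x y z = \<rho> p (shape p x) y z + (- k / 4) * \<rho> p (I p x) y z" for x y z
    unfolding nabla_omega by simp
  note t = S.torsion_one_form[where p=p and S="shape p" and N\<omega>="nabla2 A' h (kaehler_form h I) p" and c="- k / 4"
      and NJ="nabla_endo A' h I p" and N\<rho>="nabla3 A' h \<rho> p" and N\<mu>="?N" and C="C \<eta>" and \<eta>=\<eta> for \<eta>,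
      OF shape_linear shape_sym nabla_omega' h_nabla_I nabla_rho' refl _ C_def]
  have P: "((\<forall>x y z. nabla2 A' h (kaehler_form h I) p x y z - kaehler_form h I p (C \<eta> x y) z - kaehler_form h I p y (C \<eta> x z) = 0) \<and>
      (\<forall>\<psi>\<in>{pp, pm}. \<forall>x y z w. nabla3 A' h \<psi> p x y z w
        - \<psi> p (C \<eta> x y) z w - \<psi> p y (C \<eta> x z) w - \<psi> p y z (C \<eta> x w) = 0)) \<longleftrightarrow> \<eta> = (\<lambda>x. 0)"
    if \<eta>: "linear \<eta>" for \<eta>
  proof -
    have "s * ?N x y z w - s * \<rho> p (I p (C \<eta> x y)) z w - s * \<rho> p (I p y) (C \<eta> x z) w - s * \<rho> p (I p y) z (C \<eta> x w) = 0"
      if "\<eta> = (\<lambda>x. 0)" for x y z w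
    proof -
      have "s * ?N x y z w - s * \<rho> p (I p (C \<eta> x y)) z w - s * \<rho> p (I p y) (C \<eta> x z) w - s * \<rho> p (I p y) z (C \<eta> x w)
        = s * (?N x y z w - \<rho> p (I p (C \<eta> x y)) z w - \<rho> p (I p y) (C \<eta> x z) w - \<rho> p (I p y) z (C \<eta> x w))"
        by (simp add: algebra_simps)
      then show ?thesis using t(3)[OF \<eta> that] by simp
    qed
    then show ?thesis
      unfolding pp ball_simps nabla_rho_I using t(1,2)[OF \<eta>] by (auto simp: kaehler_form_def)
  qed
  have "w5_form A' h I pp pm p = (THE \<eta>. linear \<eta> \<and> \<eta> = (\<lambda>x. 0))"
    unfolding w5_form_def Let_def C_def[symmetric] using P by (metis (no_types, lifting))
  also have "\<dots> = (\<lambda>x. 0)"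
    by (rule the_equality) (auto simp: linear_zero)
  finally show ?thesis .
qed

text \<open>The pointwise criterion \<open>su3_components\<close> with \<open>t = 6 h\<close> and
  \<open>c = - k / 4\<close>: thus \<open>t / 3\<close> becomes \<open>2 h\<close>, and the
  vanishing of \<open>c\<close> is that of \<open>k\<close>.\<close>

lemma su3_type_iff:
  assumes U: "U \<subseteq> {W1 \<epsilon>, W1 \<epsilon>', W2 \<epsilon>, W3}"
    and pp: "pp = \<rho> \<and> pm = (\<lambda>q x y z. - 1 * \<rho> q (I q x) y z) \<and> \<epsilon> = PlusPart \<and> \<epsilon>' = MinusPart \<or>
      pp = (\<lambda>q x y z. 1 * \<rho> q (I q x) y z) \<and> pm = \<rho> \<and> \<epsilon> = MinusPart \<and> \<epsilon>' = PlusPart"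
  shows "su3_type A' h I pp pm U \<longleftrightarrow> (\<forall>p. (W1 \<epsilon> \<in> U \<or> mean_h A g A' \<iota> n p = 0) \<and> (W1 \<epsilon>' \<in> U \<or> k = 0) \<and>
    (W2 \<epsilon> \<in> U \<or> (\<forall>x y. B p x y + act_I I B p x y = 2 * mean_h A g A' \<iota> n p * h p x y)) \<and>
    (W3 \<in> U \<or> (\<forall>x y. act_I I B p x y = B p x y)))"
proof -
  have "W5 \<notin> U" using U by auto
  have w5: "w5_form A' h I pp pm p x = 0" for p x
  proof -
    have "{pp, pm} = {\<rho>, \<lambda>q x y z. - 1 * \<rho> q (I q x) y z} \<or> {pp, pm} = {\<rho>, \<lambda>q x y z. 1 * \<rho> q (I q x) y z}"
      using pp by (elim disjE conjE) (simp_all only: insert_commute refl simp_thms)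
    then have "w5_form A' h I pp pm p = (\<lambda>x. 0)"
      by (elim disjE) (rule w5_form_eq_0, assumption)+
    then show ?thesis by simp
  qed
  have pp': "pp p = \<rho> p \<and> \<epsilon> = PlusPart \<and> \<epsilon>' = MinusPart \<or>
      pp p = (\<lambda>x. \<rho> p (I p x)) \<and> \<epsilon> = MinusPart \<and> \<epsilon>' = PlusPart" for p
    using pp by (elim disjE conjE) simp_all
  have t: "6 * mean_h A g A' \<iota> n p = (\<Sum>i\<in>UNIV. h p (shape p (onb (h p) i)) (onb (h p) i))" for p
    by (simp add: mean_h_def trace_form_def h_shape)
  have om: "nabla2 A' h (kaehler_form h I) p x y z = \<rho> p (shape p x) y z + (- k / 4) * \<rho> p (I p x) y z" for p x y z
    unfolding nabla_omega by simp
  show ?thesis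
    unfolding su3_type_def Let_def om
    unfolding S.su3_components[OF shape_linear shape_sym pp' U t] h_shape act_I_def
    using w5 \<open>W5 \<notin> U\<close> by simp
qed

end

theorem theorem4p5:
  fixes A :: "('m::{t2_space, second_countable_topology}, 7) chart set"
    and g :: "'m \<Rightarrow> (real ^ 7) form2"
    and \<phi> :: "'m \<Rightarrow> (real ^ 7) form3"
    and k :: real
    and A' :: "('h::{t2_space, second_countable_topology}, 6) chart set"
    and \<iota> :: "'h \<Rightarrow> 'm"
    and n :: "'h \<Rightarrow> real ^ 7"
    and \<theta> :: "'h \<Rightarrow> real"
    and \<epsilon> \<epsilon>' :: part
  assumes "g2_structure A g \<phi>"
    and "type_X1 A g \<phi>"
    and "\<forall>p x y z w. ext_deriv3 A \<phi> p x y z w = k * star (g p) (\<phi> p) x y z w"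
    and "hypersurface_with_normal A g A' \<iota> n"
    and "\<theta> = (\<lambda>p. 0) \<and> \<epsilon> = PlusPart \<and> \<epsilon>' = MinusPart \<or>
         \<theta> = (\<lambda>p. pi / 2) \<and> \<epsilon> = MinusPart \<and> \<epsilon>' = PlusPart"
  shows "let M_type = induced_type A g \<phi> A' \<iota> n \<theta>;
             metric = induced_metric A g A' \<iota>;
             I = induced_I A g \<phi> A' \<iota> n;
             B = second_fund A g A' \<iota> n;
             h = mean_h A g A' \<iota> n;
             IB_eq_B = (\<forall>p x y. act_I I B p x y = B p x y);
             IB_eq_minus_B = (\<forall>p x y. act_I I B p x y = - B p x y);
             one_plus_I_B = (\<forall>p x y. B p x y + act_I I B p x y = 2 * h p * metric p x y);
             minimal = minimal_variety A g A' \<iota> n;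
             umbilic = totally_umbilic A g A' \<iota> n;
             geodesic = totally_geodesic A g A' \<iota> n;
             parallel = type_P A g \<phi>
         in M_type {W1 \<epsilon>, W1 \<epsilon>', W2 \<epsilon>, W3} \<and>
            (M_type {W1 \<epsilon>, W1 \<epsilon>', W2 \<epsilon>} \<longleftrightarrow> IB_eq_B) \<and>
            (M_type {W1 \<epsilon>, W1 \<epsilon>', W3} \<longleftrightarrow> one_plus_I_B) \<and>
            (M_type {W1 \<epsilon>, W2 \<epsilon>, W3} \<longleftrightarrow> parallel) \<and>
            (M_type {W1 \<epsilon>', W2 \<epsilon>, W3} \<longleftrightarrow> minimal) \<and>
            (M_type {W1 \<epsilon>, W1 \<epsilon>'} \<longleftrightarrow> umbilic) \<and>
            (M_type {W1 \<epsilon>, W2 \<epsilon>} \<longleftrightarrow> IB_eq_B \<and> parallel) \<and>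
            (M_type {W1 \<epsilon>', W2 \<epsilon>} \<longleftrightarrow> IB_eq_B \<and> minimal) \<and>
            (M_type {W1 \<epsilon>, W3} \<longleftrightarrow> one_plus_I_B \<and> parallel) \<and>
            (M_type {W1 \<epsilon>', W3} \<longleftrightarrow> IB_eq_minus_B) \<and>
            (M_type {W2 \<epsilon>, W3} \<longleftrightarrow> minimal \<and> parallel) \<and>
            (M_type {W3} \<longleftrightarrow> IB_eq_minus_B \<and> parallel) \<and>
            (M_type {W2 \<epsilon>} \<longleftrightarrow> IB_eq_B \<and> minimal \<and> parallel) \<and>
            (M_type {W1 \<epsilon>'} \<longleftrightarrow> geodesic) \<and>
            (M_type {W1 \<epsilon>} \<longleftrightarrow> umbilic \<and> parallel) \<and>
            (M_type {} \<longleftrightarrow> geodesic \<and> parallel)"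
proof -
  obtain k' where k': "\<And>p x y. rbar A g \<phi> p x y = k' / 4 * g p x y"
    using assms(2) unfolding type_X1_def by blast
  interpret nearly_parallel_hypersurface A g \<phi> k' A' \<iota> n
    using assms(1,4) k' by unfold_locales
  let ?h = "mean_h A g A' \<iota> n"
  let ?pp = "induced_psi_plus A g \<phi> A' \<iota> n \<theta>" and ?pm = "induced_psi_minus A g \<phi> A' \<iota> n \<theta>"
  define a where "a p \<longleftrightarrow> ?h p = 0" for p
  define c where "c p \<longleftrightarrow> (\<forall>x y. B p x y + act_I I B p x y = 2 * ?h p * h p x y)" for p
  define d where "d p \<longleftrightarrow> (\<forall>x y. act_I I B p x y = B p x y)" for p
  have sg: "star (g (\<iota> p)) (\<phi> (\<iota> p)) (n p) (D p x) (D p y) (D p z) = - \<rho> p (I p x) y z" for p x y z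
    using H.sigma_n[of p x y z] by (simp only: J_eq rho_eq)
  have psi: "?pp = \<rho> \<and> ?pm = (\<lambda>q x y z. - 1 * \<rho> q (I q x) y z) \<and> \<epsilon> = PlusPart \<and> \<epsilon>' = MinusPart \<or>
      ?pp = (\<lambda>q x y z. 1 * \<rho> q (I q x) y z) \<and> ?pm = \<rho> \<and> \<epsilon> = MinusPart \<and> \<epsilon>' = PlusPart"
    using assms(5)
  proof
    assume a: "\<theta> = (\<lambda>p. 0) \<and> \<epsilon> = PlusPart \<and> \<epsilon>' = MinusPart"
    have "?pp = \<rho>" "?pm = (\<lambda>q x y z. - 1 * \<rho> q (I q x) y z)"
      by (intro ext, simp add: a induced_psi_plus_def induced_psi_minus_def Let_def sg)+
    with a show ?thesis by blast
  next
    assume a: "\<theta> = (\<lambda>p. pi / 2) \<and> \<epsilon> = MinusPart \<and> \<epsilon>' = PlusPart"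
    have "?pp = (\<lambda>q x y z. 1 * \<rho> q (I q x) y z)" "?pm = \<rho>"
      by (intro ext, simp add: a induced_psi_plus_def induced_psi_minus_def Let_def sg)+
    with a show ?thesis by blast
  qed
  have M: "induced_type A g \<phi> A' \<iota> n \<theta> U \<longleftrightarrow> (\<forall>p. (W1 \<epsilon> \<in> U \<or> a p) \<and> (W1 \<epsilon>' \<in> U \<or> k' = 0) \<and>
      (W2 \<epsilon> \<in> U \<or> c p) \<and> (W3 \<in> U \<or> d p))" if "U \<subseteq> {W1 \<epsilon>, W1 \<epsilon>', W2 \<epsilon>, W3}" for U
    unfolding induced_type_def a_def c_def d_def by (rule su3_type_iff[OF that psi])
  have dist: "\<epsilon> \<noteq> \<epsilon>'" "\<epsilon>' \<noteq> \<epsilon>" using assms(5) by auto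
  have par: "type_P A g \<phi> \<longleftrightarrow> k' = 0"
  proof
    assume P: "type_P A g \<phi>"
    \<comment> \<open>Types are inhabited, so there is a point at which to test; a unit vector there
      gives \<open>k' = 0\<close>.\<close>
    fix p
    have "k' / 4 * g p (onb (g p) 0) (onb (g p) 0) = 0"
      using P k'[of p "onb (g p) 0" "onb (g p) 0"] unfolding type_P_def by simp
    then show "k' = 0"
      using euclid.orthonormal_G[OF g_euclid euclid.onb[OF g_euclid], of p 0 0] by simp
  qed (simp add: type_P_def k')
  have tr: "(\<Sum>i\<in>UNIV. B p (I p (onb (h p) i)) (I p (onb (h p) i))) = 6 * ?h p" for p
  proof -
    have "orthonormal (h p) (\<lambda>i. I p (onb (h p) i))"
      using S.onb[of p] by (simp add: orthonormal_def S.GJJ)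
    moreover have "bilinear (B p)"
      unfolding bilinear_def h_shape[symmetric, abs_def]
      using linear_compose[OF shape_linear S.linear_left] S.linear_right by (auto simp: o_def)
    ultimately show ?thesis
      using S.trace_orthonormal[OF _ S.onb, of "B p" p] by (simp add: mean_h_def trace_form_def)
  qed
  \<comment> \<open>\<open>I\<close> maps an orthonormal basis to an orthonormal basis, so
    \<open>IB\<close> and \<open>B\<close> have the same trace. If \<open>IB = - B\<close> it must
    vanish, and then \<open>c p\<close> says the same as \<open>IB = - B\<close>.\<close>
  have eqm: "(\<forall>p x y. act_I I B p x y = - B p x y) \<longleftrightarrow> (\<forall>p. a p \<and> c p)"
  proof -
    have "?h p = 0" if "\<forall>x y. act_I I B p x y = - B p x y" for p
      using tr[of p] that by (simp add: act_I_def sum_negf mean_h_def trace_form_def)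
    then show ?thesis
      unfolding a_def c_def by (metis (no_types, lifting) add_eq_0_iff mult_zero_left mult_zero_right)
  qed
  \<comment> \<open>\<open>c p\<close> fixes the average of \<open>B\<close> and \<open>IB\<close>
    to be \<open>?h p\<close> times the metric, and \<open>d p\<close> says that this average is
    \<open>B\<close> itself.\<close>
  have umb: "totally_umbilic A g A' \<iota> n \<longleftrightarrow> (\<forall>p. c p \<and> d p)"
  proof
    assume "totally_umbilic A g A' \<iota> n"
    then have u: "B p x y = ?h p * h p x y" for p x y unfolding totally_umbilic_def by blast
    show "\<forall>p. c p \<and> d p" unfolding c_def d_def act_I_def u S.GJJ by simp
  next
    assume cd: "\<forall>p. c p \<and> d p"
    show "totally_umbilic A g A' \<iota> n"
      unfolding totally_umbilic_def
    proof (intro allI)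
      fix p x y
      have "B p x y + act_I I B p x y = 2 * ?h p * h p x y" "act_I I B p x y = B p x y"
        using cd unfolding c_def d_def by blast+
      then show "B p x y = ?h p * h p x y" by simp
    qed
  qed
  have geo: "totally_geodesic A g A' \<iota> n \<longleftrightarrow> (\<forall>p. a p \<and> c p \<and> d p)"
  proof
    assume "totally_geodesic A g A' \<iota> n"
    then have u: "B p x y = 0" for p x y unfolding totally_geodesic_def by blast
    show "\<forall>p. a p \<and> c p \<and> d p"
      unfolding a_def c_def d_def act_I_def mean_h_def trace_form_def u by simp
  next
    assume acd: "\<forall>p. a p \<and> c p \<and> d p"
    show "totally_geodesic A g A' \<iota> n"
      unfolding totally_geodesic_def
    proof (intro allI)
      fix p x y
      have "B p x y + act_I I B p x y = 2 * ?h p * h p x y" "act_I I B p x y = B p x y" "?h p = 0"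
        using acd unfolding a_def c_def d_def by blast+
      then show "B p x y = 0" by simp
    qed
  qed
  show ?thesis
    unfolding Let_def par eqm umb geo minimal_variety_def a_def[symmetric] c_def[symmetric] d_def[symmetric]
    by (auto simp: M dist)
qed

end
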